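(* Let $(X,G)$ be a minimal topological dynamical system, and let $\pi_{eq}:X\to X_{eq}$ be the factor map to its maximal equicontinuous factor. Assume one of the following conditions holds: (1) $(X,G)$ is incontractible; (2) $(X,G)$ satisfies the local Bronstein condition and admits a $G$-invariant Borel probability measure. Then there exists a dense $G_\delta$ subset $Z\subset X_{eq}$ with $\nu_{eq}(Z)=1$ such that $\pi_{eq}^{-1}(y)$ is an IT-set for every $y\in Z$.
   Context: Throughout, $G$ is an infinite countable discrete group. A topological dynamical system (tds) $(X,G)$ is a compact metric space $(X,d)$ on which $G$ acts by homeomorphisms. It is minimal if $X$ has no proper nonempty closed $G$-invariant subset. A point $x$ is a minimal point if $(\overline{\{gx:g\in G\}},G)$ is minimal. $\pi_{eq}:(X,G)\to (X_{eq},G)$ is the factor map onto the maximal equicontinuous factor; when $(X,G)$ is minimal, $(X_{eq},G)$ is minimal and uniquely ergodic, and $\nu_{eq}$ denotes its unique invariant Borel probability measure. $(X,G)$ is incontractible if for every $n\in\mathbb N$ the set of minimal points of $(X^n,G)$ (diagonal action) is dense in $X^n$. $RP_2(X,G)$ is the set of $(x_1,x_2)\in X^2$ such that for every $\epsilon>0$ there exist $x_1',x_2'\in X$ and $g\in G$ with $d(x_k,x_k')\le\epsilon$ ($k=1,2$) and $d(gx_1',gx_2')\le\epsilon$. $(X,G)$ satisfies the local Bronstein condition if whenever $(x,x')\in RP_2(X,G)$ is a minimal point of $(X\times X,G)$, there exist minimal points $(x_n,x_n')$ of $(X\times X,G)$ and $g_n\in G$ with $(x_n,x_n')\to(x,x')$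 and $d(g_nx_n,g_nx_n')\to 0$. For subsets $A_1,\dots,A_K$ of $X$, a set $J\subset G$ is an independence set for $(A_1,\dots,A_K)$ if for every nonempty finite $I\subset J$ and every $\sigma:I\to\{1,\dots,K\}$, $\bigcap_{g\in I}g^{-1}A_{\sigma(g)}\neq\emptyset$. A tuple $(x_1,\dots,x_K)\in X^K$ is a $K$-IT-tuple if for all open neighborhoods $U_k$ of $x_k$, $(U_1,\dots,U_K)$ has an infinite independence set. A nonempty set $A\subset X$ is an IT-set if every tuple (of any length, entries in $A$) is an IT-tuple. *)

theory Defs
  imports "HOL-Analysis.Analysis" "HOL-Probability.Probability"
begin

definition tds :: "'a::metric_space set \<Rightarrow> ('g::group_add \<Rightarrow> 'a \<Rightarrow> 'a) \<Rightarrow> bool" where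
  "tds X T \<longleftrightarrow> compact X \<and> (\<forall>g. continuous_on X (T g) \<and> T g ` X \<subseteq> X)
     \<and> (\<forall>x\<in>X. T 0 x = x) \<and> (\<forall>g h. \<forall>x\<in>X. T (g + h) x = T g (T h x))"

definition minimal_sys :: "'a::metric_space set \<Rightarrow> ('g::group_add \<Rightarrow> 'a \<Rightarrow> 'a) \<Rightarrow> bool" where
  "minimal_sys X T \<longleftrightarrow> X \<noteq> {} \<and>
     (\<forall>A. A \<subseteq> X \<longrightarrow> closed A \<longrightarrow> A \<noteq> {} \<longrightarrow> (\<forall>g. T g ` A \<subseteq> A) \<longrightarrow> A = X)"

definition orbit :: "('g \<Rightarrow> 'a \<Rightarrow> 'a) \<Rightarrow> 'a \<Rightarrow> 'a set" where
  "orbit T x = range (\<lambda>g. T g x)"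

definition minimal_point :: "'a::metric_space set \<Rightarrow> ('g::group_add \<Rightarrow> 'a \<Rightarrow> 'a) \<Rightarrow> 'a \<Rightarrow> bool" where
  "minimal_point X T x \<longleftrightarrow> x \<in> X \<and> minimal_sys (closure (orbit T x)) T"

text \<open>X^n is represented as the extensional functions PiE {..<n} (%_. X) in
the metric space nat => 'a (product topology), with the diagonal action.\<close>
definition tuple_act :: "nat \<Rightarrow> ('g \<Rightarrow> 'a \<Rightarrow> 'a) \<Rightarrow> 'g \<Rightarrow> (nat \<Rightarrow> 'a) \<Rightarrow> (nat \<Rightarrow> 'a)" where
  "tuple_act n T g f = restrict (\<lambda>i. T g (f i)) {..<n}"

definition incontractible :: "'a::metric_space set \<Rightarrow> ('g::group_add \<Rightarrow> 'a \<Rightarrow> 'a) \<Rightarrow> bool" where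
  "incontractible X T \<longleftrightarrow> (\<forall>n::nat.
     PiE {..<n} (\<lambda>_. X) \<subseteq>
       closure {f \<in> PiE {..<n} (\<lambda>_. X). minimal_point (PiE {..<n} (\<lambda>_. X)) (tuple_act n T) f})"

definition pair_act :: "('g \<Rightarrow> 'a \<Rightarrow> 'a) \<Rightarrow> 'g \<Rightarrow> 'a \<times> 'a \<Rightarrow> 'a \<times> 'a" where
  "pair_act T g p = (T g (fst p), T g (snd p))"

definition RP2 :: "'a::metric_space set \<Rightarrow> ('g \<Rightarrow> 'a \<Rightarrow> 'a) \<Rightarrow> ('a \<times> 'a) set" where
  "RP2 X T = {(x1, x2). x1 \<in> X \<and> x2 \<in> X \<and> (\<forall>e>0. \<exists>x1'\<in>X. \<exists>x2'\<in>X. \<exists>g.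
      dist x1 x1' \<le> e \<and> dist x2 x2' \<le> e \<and> dist (T g x1') (T g x2') \<le> e)}"

definition local_Bronstein :: "'a::metric_space set \<Rightarrow> ('g::group_add \<Rightarrow> 'a \<Rightarrow> 'a) \<Rightarrow> bool" where
  "local_Bronstein X T \<longleftrightarrow> (\<forall>x x'. (x, x') \<in> RP2 X T \<and> minimal_point (X \<times> X) (pair_act T) (x, x') \<longrightarrow>
     (\<exists>xs xs' gs. (\<forall>n. minimal_point (X \<times> X) (pair_act T) (xs n, xs' n))
        \<and> (\<lambda>n. (xs n, xs' n)) \<longlonglongrightarrow> (x, x')
        \<and> (\<lambda>n. dist (T (gs n) (xs n)) (T (gs n) (xs' n))) \<longlonglongrightarrow> 0))"

definition equicontinuous_sys :: "'a::metric_space set \<Rightarrow> ('g \<Rightarrow> 'a \<Rightarrow> 'a) \<Rightarrow> bool" where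
  "equicontinuous_sys Y S \<longleftrightarrow> (\<forall>e>0. \<exists>d>0. \<forall>x\<in>Y. \<forall>y\<in>Y. dist x y < d \<longrightarrow> (\<forall>g. dist (S g x) (S g y) < e))"

definition factor_map :: "'a::metric_space set \<Rightarrow> ('g::group_add \<Rightarrow> 'a \<Rightarrow> 'a) \<Rightarrow>
    'b::metric_space set \<Rightarrow> ('g \<Rightarrow> 'b \<Rightarrow> 'b) \<Rightarrow> ('a \<Rightarrow> 'b) \<Rightarrow> bool" where
  "factor_map X T Y S p \<longleftrightarrow> tds X T \<and> tds Y S \<and> continuous_on X p \<and> p ` X = Y
     \<and> (\<forall>g. \<forall>x\<in>X. p (T g x) = S g (p x))"

text \<open>Maximal equicontinuous factor: an equicontinuous factor through which every
equicontinuous factor factors. Every compact metric space is homeomorphic to a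
subset of the Hilbert cube, so it suffices to test factors living in nat => real
(product topology).\<close>
definition max_eq_factor :: "'a::metric_space set \<Rightarrow> ('g::group_add \<Rightarrow> 'a \<Rightarrow> 'a) \<Rightarrow>
    'b::metric_space set \<Rightarrow> ('g \<Rightarrow> 'b \<Rightarrow> 'b) \<Rightarrow> ('a \<Rightarrow> 'b) \<Rightarrow> bool" where
  "max_eq_factor X T Y S p \<longleftrightarrow> factor_map X T Y S p \<and> equicontinuous_sys Y S \<and>
     (\<forall>(Y' :: (nat \<Rightarrow> real) set) S' q. factor_map X T Y' S' q \<and> equicontinuous_sys Y' S' \<longrightarrow>
        (\<exists>f. \<forall>x\<in>X. q x = f (p x)))"

definition inv_measure :: "'a::metric_space set \<Rightarrow> ('g \<Rightarrow> 'a \<Rightarrow> 'a) \<Rightarrow> 'a measure \<Rightarrow> bool" where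
  "inv_measure X T \<mu> \<longleftrightarrow> prob_space \<mu> \<and> sets \<mu> = sets (restrict_space borel X) \<and> space \<mu> = X \<and>
     (\<forall>g. \<forall>A\<in>sets \<mu>. measure \<mu> {x\<in>X. T g x \<in> A} = measure \<mu> A)"

definition indep_set :: "'a set \<Rightarrow> ('g \<Rightarrow> 'a \<Rightarrow> 'a) \<Rightarrow> 'a set list \<Rightarrow> 'g set \<Rightarrow> bool" where
  "indep_set X T As J \<longleftrightarrow> (\<forall>I. finite I \<and> I \<noteq> {} \<and> I \<subseteq> J \<longrightarrow>
     (\<forall>\<sigma>. \<sigma> ` I \<subseteq> {..<length As} \<longrightarrow> (\<Inter>g\<in>I. {x\<in>X. T g x \<in> As ! \<sigma> g}) \<noteq> {}))"

definition IT_tuple :: "'a::metric_space set \<Rightarrow> ('g \<Rightarrow> 'a \<Rightarrow> 'a) \<Rightarrow> 'a list \<Rightarrow> bool" where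
  "IT_tuple X T xs \<longleftrightarrow> (\<forall>Us. length Us = length xs \<and> (\<forall>k<length xs. open (Us ! k) \<and> xs ! k \<in> Us ! k) \<longrightarrow>
     (\<exists>J. infinite J \<and> indep_set X T (map (\<lambda>U. U \<inter> X) Us) J))"

definition IT_set :: "'a::metric_space set \<Rightarrow> ('g \<Rightarrow> 'a \<Rightarrow> 'a) \<Rightarrow> 'a set \<Rightarrow> bool" where
  "IT_set X T A \<longleftrightarrow> A \<noteq> {} \<and> (\<forall>xs. xs \<noteq> [] \<and> set xs \<subseteq> A \<longrightarrow> IT_tuple X T xs)"

end

theory Submission
  imports Defs
begin

text \<open>
Let \<open>F\<close> be the orbit closure of a box \<open>Q\<^sub>1 \<times> \<dots> \<times> Q\<^sub>N\<close> in \<open>X\<^sup>N\<close>. Measuring sections of \<open>F\<close> by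
positive functionals on \<open>C(X\<^sup>N)\<close> yields an invariant continuous pseudometric on \<open>X\<close>, so sections over
points in the same fibre of \<open>p\<close> agree, and \<open>F\<close> contains \<open>p\<^sup>-\<^sup>1(int p(Q\<^sub>1)) \<times> \<dots> \<times> p\<^sup>-\<^sup>1(int p(Q\<^sub>N))\<close>:
the system is mixing of all orders relative to \<open>Y\<close>. The functionals are products of the invariant
measure in case (2). In case (1) they form a minimal subset of an irreducible compact convex set of
functionals; such a set is proximal, hence disjoint from the incontractible system \<open>X\<close>.

Let \<open>A\<close> be the intersection of the closures of the images of neighbourhoods \<open>U\<^sub>j\<close> of points in one
fibre. If \<open>A\<close> has positive measure, an independence set is built one element at a time. Every
cylinder \<open>U\<^sub>s\<close> carries a point \<open>c\<^sub>s\<close> in the interior of \<open>p(U\<^sub>s)\<close> such that the translates moving all \<open>c\<^sub>s\<close>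
close to \<open>A\<close> have positive mean; this property is stable under small perturbations of the \<open>c\<^sub>s\<close>,
because translation is continuous in mean. Moving all \<open>c\<^sub>s\<close> close to \<open>A\<close> and applying relative mixing
gives the next element. The set \<open>Z\<close> is the complement of the countably many such \<open>A\<close> of measure
zero, where the \<open>U\<^sub>j\<close> run through a countable base.
\<close>

section \<open>Averages over translates\<close>

text \<open>The group need not be amenable, and this shapes both halves of the proof.
  \<open>X\<close> may carry no invariant measure; a closed set of functionals whose product with
  \<open>X\<close> is minimal replaces it, since minimality alone forces the mass of a section to be
  the same for all these functionals and all base points. Nor are there Folner sets along which
  translates could be counted: averages over all two-sided translates of one finite list take their
  place, and for functions along an orbit of the equicontinuous system \<open>Y\<close> they are
  controlled by integrals against \<open>\<nu>\<close>. The factor map need not be open, so relative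
  mixing reaches only fibres over the interior of an image, and after each extension new points in
  the interior of the smaller images have to be chosen. They can be found close to the old ones, but
  not equal to them; hence the property carried through the induction has to be stable under
  perturbation. A single orbit time moving the points close to \<open>A\<close> would not
  be.\<close>

lemma tds_mem: "tds X T \<Longrightarrow> x \<in> X \<Longrightarrow> T g x \<in> X"
  unfolding tds_def by blast

lemma tds_zero: "tds X T \<Longrightarrow> x \<in> X \<Longrightarrow> T 0 x = x"
  unfolding tds_def by blast

lemma tds_add: "tds X T \<Longrightarrow> x \<in> X \<Longrightarrow> T g (T h x) = T (g + h) x"
  unfolding tds_def by simp

lemma tds_cancel:
  assumes "tds X T" "x \<in> X"
  shows "T (- g) (T g x) = x" "T g (T (- g) x) = x"
  using assms by (simp_all add: tds_add tds_zero)

lemma tds_cont: "tds X T \<Longrightarrow> continuous_on X (T g)"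
  unfolding tds_def by blast

lemma tds_compact: "tds X T \<Longrightarrow> compact X"
  unfolding tds_def by blast

lemma closure_orbit_invariant:
  assumes "tds X T" "x \<in> X"
  shows "closure (orbit T x) \<subseteq> X" "T g ` closure (orbit T x) \<subseteq> closure (orbit T x)"
    "x \<in> closure (orbit T x)"
proof -
  have o: "orbit T x \<subseteq> X"
    using assms by (auto simp: orbit_def tds_mem)
  then show c: "closure (orbit T x) \<subseteq> X"
    using assms(1) by (meson closure_minimal compact_imp_closed tds_compact)
  have "T g ` orbit T x \<subseteq> orbit T x"
    using assms by (auto simp: orbit_def tds_add)
  then have "T g ` orbit T x \<subseteq> closure (orbit T x)"
    using closure_subset by blast
  then show "T g ` closure (orbit T x) \<subseteq> closure (orbit T x)"
    using c assms(1) by (intro image_closure_subset) (auto intro: continuous_on_subset tds_cont)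
  have "T 0 x \<in> orbit T x"
    unfolding orbit_def by blast
  then show "x \<in> closure (orbit T x)"
    using assms closure_subset by (auto simp: tds_zero)
qed

lemma minimal_sys_hits:
  assumes "tds X T" "minimal_sys X T" "x \<in> X" "open U" "U \<inter> X \<noteq> {}"
  obtains g where "T g x \<in> U"
proof -
  have "closure (orbit T x) = X"
    using assms closure_orbit_invariant[OF assms(1,3)]
    unfolding minimal_sys_def by (metis closed_closure empty_iff)
  then have "U \<inter> orbit T x \<noteq> {}"
    using assms(4,5) open_Int_closure_eq_empty by blast
  then show ?thesis
    using that unfolding orbit_def by blast
qed

text \<open>Covering \<open>X \<times> X\<close> rather than \<open>X\<close> by the open sets
  \<open>W k\<close> makes one finite set of times serve all starting points and all
  targets.\<close>

lemma minimal_sys_finite_hits: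
  assumes X: "tds X T" "minimal_sys X T" and "\<delta> > 0"
  obtains F where "finite F" "F \<noteq> {}" "\<And>x z. x \<in> X \<Longrightarrow> z \<in> X \<Longrightarrow> \<exists>k\<in>F. dist (T k x) z < \<delta>"
proof -
  have cX: "compact (X \<times> X)"
    using X by (simp add: compact_Times tds_compact)
  define W where "W k = (X \<times> X) \<inter> (\<lambda>w. dist (T k (fst w)) (snd w)) -` {..<\<delta>}" for k
  have W: "openin (top_of_set (X \<times> X)) (W k)" for k
    unfolding W_def
    by (rule continuous_openin_preimage_gen)
      (intro continuous_intros continuous_on_compose2[OF tds_cont[OF X(1)]], auto)
  have "X \<times> X \<subseteq> (\<Union>k. W k)"
  proof
    fix w assume "w \<in> X \<times> X"
    then obtain x z where w: "w = (x, z)" "x \<in> X" "z \<in> X" by blast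
    then obtain k where "T k x \<in> ball z \<delta>"
      using minimal_sys_hits[OF X \<open>x \<in> X\<close>, of "ball z \<delta>"] \<open>\<delta> > 0\<close> by (metis Int_iff centre_in_ball empty_iff open_ball)
    then show "w \<in> (\<Union>k. W k)"
      using w by (auto simp: W_def dist_commute)
  qed
  then obtain \<C> where C: "\<C> \<subseteq> range W" "finite \<C>" "X \<times> X \<subseteq> \<Union>\<C>"
    using cX W unfolding compact_eq_openin_cover by (metis (no_types, lifting) imageE)
  then obtain F where F: "finite F" "\<C> = W ` F"
    by (meson finite_subset_image)
  obtain x where "x \<in> X"
    using X(2) unfolding minimal_sys_def by blast
  then have "F \<noteq> {}"
    using C F by auto
  moreover have "\<exists>k\<in>F. dist (T k x) z < \<delta>" if "x \<in> X" "z \<in> X" for x z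
  proof -
    have "(x, z) \<in> \<Union>\<C>"
      using C(3) that by blast
    then show ?thesis
      unfolding F W_def by auto
  qed
  ultimately show ?thesis
    using F(1) that by blast
qed

lemma equicontinuous_sys_compose:
  fixes \<psi> :: "'b::metric_space \<Rightarrow> real"
  assumes Y: "tds Y S" "equicontinuous_sys Y S" and "continuous_on Y \<psi>" and "e > 0"
  obtains d where "d > 0"
    "\<And>y z g. y \<in> Y \<Longrightarrow> z \<in> Y \<Longrightarrow> dist y z < d \<Longrightarrow> \<bar>\<psi> (S g y) - \<psi> (S g z)\<bar> < e"
proof -
  have "uniformly_continuous_on Y \<psi>"
    using assms(3) Y(1) by (simp add: compact_uniformly_continuous tds_compact)
  then obtain d' where d': "d' > 0" "\<And>y z. y \<in> Y \<Longrightarrow> z \<in> Y \<Longrightarrow> dist y z < d' \<Longrightarrow> dist (\<psi> y) (\<psi> z) < e"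
    unfolding uniformly_continuous_on_def using \<open>e > 0\<close> by meson
  obtain d where "d > 0" "\<And>y z g. y \<in> Y \<Longrightarrow> z \<in> Y \<Longrightarrow> dist y z < d \<Longrightarrow> dist (S g y) (S g z) < d'"
    using Y(2) d'(1) unfolding equicontinuous_sys_def by meson
  then show ?thesis
    using that[of d] d'(2) Y(1) by (simp add: dist_real_def tds_mem)
qed

lemma inv_measure_continuous_measurable:
  fixes f :: "'a::metric_space \<Rightarrow> 'c::topological_space"
  assumes "inv_measure X T \<mu>" "continuous_on X f"
  shows "f \<in> borel_measurable \<mu>"
proof -
  have "sets \<mu> = sets (restrict_space borel X)"
    using assms(1) by (simp add: inv_measure_def)
  then show ?thesis
    using borel_measurable_continuous_on_restrict[OF assms(2)] measurable_cong_sets by blast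
qed

lemma inv_measure_continuous_integrable:
  fixes f :: "'a::metric_space \<Rightarrow> real"
  assumes "inv_measure X T \<mu>" "compact X" "continuous_on X f"
  shows "integrable \<mu> f"
proof -
  interpret prob_space \<mu>
    using assms(1) by (simp add: inv_measure_def)
  have "bounded (f ` X)"
    using assms compact_continuous_image compact_imp_bounded by blast
  then obtain B where "\<And>x. x \<in> X \<Longrightarrow> norm (f x) \<le> B"
    unfolding bounded_iff by blast
  then show ?thesis
    using assms(1) inv_measure_continuous_measurable[OF assms(1,3)]
    by (intro integrable_const_bound[of _ B]) (auto simp: inv_measure_def)
qed

lemma inv_measure_integral_invariant:
  fixes f :: "'a::metric_space \<Rightarrow> real"
  assumes X: "tds X T" and \<mu>: "inv_measure X T \<mu>" and f: "continuous_on X f"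
  shows "(\<integral>x. f (T g x) \<partial>\<mu>) = (\<integral>x. f x \<partial>\<mu>)"
proof -
  interpret prob_space \<mu>
    using \<mu> by (simp add: inv_measure_def)
  have sp: "space \<mu> = X" and se: "sets \<mu> = sets (restrict_space borel X)"
    using \<mu> by (auto simp: inv_measure_def)
  have "T g \<in> measurable \<mu> (restrict_space borel X)"
    using inv_measure_continuous_measurable[OF \<mu> tds_cont[OF X]] sp tds_mem[OF X]
    by (intro measurable_restrict_space2) auto
  then have Tg: "T g \<in> measurable \<mu> \<mu>"
    using se measurable_cong_sets by blast
  have "distr \<mu> \<mu> (T g) = \<mu>"
  proof (rule measure_eqI)
    fix A assume A: "A \<in> sets (distr \<mu> \<mu> (T g))"
    then have "measure \<mu> {x \<in> X. T g x \<in> A} = measure \<mu> A"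
      using \<mu> by (simp add: inv_measure_def)
    moreover have "T g -` A \<inter> space \<mu> = {x \<in> X. T g x \<in> A}"
      using sp by auto
    ultimately show "emeasure (distr \<mu> \<mu> (T g)) A = emeasure \<mu> A"
      using A Tg by (simp add: emeasure_distr emeasure_eq_measure)
  qed simp
  then show ?thesis
    using integral_distr[OF Tg inv_measure_continuous_measurable[OF \<mu> f]] by simp
qed

lemma inv_measure_integral_translates:
  fixes f :: "'a::metric_space \<Rightarrow> real"
  assumes X: "tds X T" and \<mu>: "inv_measure X T \<mu>" and f: "continuous_on X f"
  shows "continuous_on X (\<lambda>x. \<Sum>g\<leftarrow>P. f (T g x))"
    and "(\<integral>x. (\<Sum>g\<leftarrow>P. f (T g x)) \<partial>\<mu>) = (\<integral>x. f x \<partial>\<mu>) * length P"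
proof -
  have c: "continuous_on X (\<lambda>x. f (T g x))" for g
    using f tds_cont[OF X] tds_mem[OF X] by (blast intro: continuous_on_compose2)
  then have int: "integrable \<mu> (\<lambda>x. f (T g x))" for g
    using inv_measure_continuous_integrable[OF \<mu> tds_compact[OF X]] by blast
  show "continuous_on X (\<lambda>x. \<Sum>g\<leftarrow>P. f (T g x))"
    by (induction P) (simp_all add: c continuous_on_add)
  have "integrable \<mu> (\<lambda>x. \<Sum>g\<leftarrow>P. f (T g x)) \<and>
      (\<integral>x. (\<Sum>g\<leftarrow>P. f (T g x)) \<partial>\<mu>) = (\<integral>x. f x \<partial>\<mu>) * length P"
    by (induction P) (simp_all add: int inv_measure_integral_invariant[OF X \<mu> f] algebra_simps)
  then show "(\<integral>x. (\<Sum>g\<leftarrow>P. f (T g x)) \<partial>\<mu>) = (\<integral>x. f x \<partial>\<mu>) * length P"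
    by simp
qed

lemma inv_measure_ex_le_integral:
  fixes f :: "'a::metric_space \<Rightarrow> real"
  assumes \<mu>: "inv_measure X T \<mu>" and X: "compact X" and f: "continuous_on X f"
  obtains x where "x \<in> X" "f x \<le> (\<integral>x. f x \<partial>\<mu>)"
proof -
  interpret prob_space \<mu>
    using \<mu> by (simp add: inv_measure_def)
  have sp: "space \<mu> = X"
    using \<mu> by (auto simp: inv_measure_def)
  then have "X \<noteq> {}"
    using not_empty by blast
  then obtain x where x: "x \<in> X" "\<And>z. z \<in> X \<Longrightarrow> f x \<le> f z"
    using continuous_attains_inf[OF X _ f] by blast
  have "(\<integral>z. f x \<partial>\<mu>) \<le> (\<integral>z. f z \<partial>\<mu>)"
    using x(2) sp inv_measure_continuous_integrable[OF \<mu> X f] by (intro integral_mono) auto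
  then show ?thesis
    using that x(1) by (simp add: prob_space)
qed

lemma sum_list_product:
  fixes f :: "'a \<Rightarrow> 'b \<Rightarrow> 'c::comm_monoid_add"
  shows "(\<Sum>(x, y)\<leftarrow>List.product xs ys. f x y) = (\<Sum>x\<leftarrow>xs. \<Sum>y\<leftarrow>ys. f x y)"
  by (induction xs) (auto simp: comp_def)

lemma sum_list_product':
  fixes f :: "'a \<Rightarrow> 'b \<Rightarrow> real"
  shows "(\<Sum>(x, y)\<leftarrow>List.product xs ys. f x y) = (\<Sum>y\<leftarrow>ys. \<Sum>x\<leftarrow>xs. f x y)"
proof -
  have "(\<Sum>x\<leftarrow>xs. \<Sum>y\<leftarrow>ys. f x y) = (\<Sum>y\<leftarrow>ys. \<Sum>x\<leftarrow>xs. f x y)"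
    by (induction xs) (auto simp: sum_list_addf)
  then show ?thesis
    by (simp add: sum_list_product)
qed

lemma sum_list_le_const:
  fixes f :: "'a \<Rightarrow> real"
  assumes "\<And>x. x \<in> set xs \<Longrightarrow> f x \<le> c"
  shows "(\<Sum>x\<leftarrow>xs. f x) \<le> c * length xs"
  using assms by (induction xs) (auto simp: algebra_simps add_mono)

lemma sum_list_le_const_gain:
  fixes f :: "'a \<Rightarrow> real"
  assumes "\<And>x. x \<in> set xs \<Longrightarrow> f x \<le> c" "x \<in> set xs" "f x \<le> c - d"
  shows "(\<Sum>x\<leftarrow>xs. f x) \<le> c * length xs - d"
  using assms
proof (induction xs)
  case (Cons a xs)
  show ?case
  proof (cases "x = a")
    case True
    then show ?thesis
      using Cons.prems sum_list_le_const[of xs f c] by (auto simp: algebra_simps)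
  next
    case False
    then have "(\<Sum>x\<leftarrow>xs. f x) \<le> c * length xs - d" "f a \<le> c"
      using Cons by auto
    then show ?thesis
      by (auto simp: algebra_simps)
  qed
qed simp

text \<open>By equicontinuity the gain of a single averaging step does not depend on the averages taken
before; iterating it brings the maximum down to the integral.\<close>

lemma uniform_average:
  fixes \<psi> :: "'b::metric_space \<Rightarrow> real"
  assumes Y: "tds Y S" "minimal_sys Y S" "equicontinuous_sys Y S" and \<nu>: "inv_measure Y S \<nu>"
    and \<psi>: "continuous_on Y \<psi>" "\<And>y. y \<in> Y \<Longrightarrow> \<psi> y \<le> 1" and t: "(\<integral>y. \<psi> y \<partial>\<nu>) < t"
  obtains P where "P \<noteq> []" "\<And>h y. y \<in> Y \<Longrightarrow> (\<Sum>g\<leftarrow>P. \<psi> (S (h + g) y)) \<le> t * length P"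
proof -
  define m where "m = (\<integral>y. \<psi> y \<partial>\<nu>)"
  define e where "e = t - m"
  have e: "e > 0"
    using t by (simp add: m_def e_def)
  obtain d where d: "d > 0"
    "\<And>y z g. y \<in> Y \<Longrightarrow> z \<in> Y \<Longrightarrow> dist y z < d \<Longrightarrow> \<bar>\<psi> (S g y) - \<psi> (S g z)\<bar> < e / 2"
    using equicontinuous_sys_compose[OF Y(1,3) \<psi>(1), of "e / 2"] e by (metis half_gt_zero)
  obtain F where F: "finite F" "F \<noteq> {}" "\<And>x z. x \<in> Y \<Longrightarrow> z \<in> Y \<Longrightarrow> \<exists>k\<in>F. dist (S k x) z < d"
    using minimal_sys_finite_hits[OF Y(1,2) d(1)] by metis
  obtain ks where ks: "set ks = F"
    using F(1) finite_list by blast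
  have kn: "ks \<noteq> []"
    using ks F(2) by auto
  \<comment> \<open>A step gains \<open>e / 2\<close> per entry of \<open>P\<close> for at least one
    of the \<open>length ks\<close> translates and loses nothing for the others;
    \<open>\<kappa>\<close> is this gain averaged over the new list.\<close>
  define \<kappa> where "\<kappa> = e / 2 / length ks"
  have \<kappa>: "\<kappa> > 0"
    using e kn by (simp add: \<kappa>_def)
  define good where "good P s \<longleftrightarrow> P \<noteq> [] \<and> (\<forall>h. \<forall>y\<in>Y. (\<Sum>g\<leftarrow>P. \<psi> (S (h + g) y)) \<le> s * length P)" for P and s :: real
  have step: "\<exists>P'. good P' (s - \<kappa>)" if "good P s" "s \<ge> t" for P s
  proof -
    define P' where "P' = map (\<lambda>(g, k). g + k) (List.product P ks)"
    have len: "length P' = length P * length ks"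
      by (simp add: P'_def)
    have "(\<Sum>g\<leftarrow>P'. \<psi> (S (h + g) y)) \<le> (s - \<kappa>) * length P'" if y: "y \<in> Y" for h y
    proof -
      \<comment> \<open>At \<open>z\<close> the average over the translated list is at most the
        integral. Some \<open>k\<close> carries \<open>y\<close> close to \<open>z\<close>, and
        equicontinuity keeps every later translate within \<open>e / 2\<close>, however long
        \<open>P\<close> has become.\<close>
      obtain z where z: "z \<in> Y" "(\<Sum>g\<leftarrow>map ((+) h) P. \<psi> (S g z)) \<le> m * length P"
        using inv_measure_ex_le_integral[OF \<nu> tds_compact[OF Y(1)]
            inv_measure_integral_translates(1)[OF Y(1) \<nu> \<psi>(1), of "map ((+) h) P"]]
          inv_measure_integral_translates(2)[OF Y(1) \<nu> \<psi>(1), of "map ((+) h) P"]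
        by (auto simp only: m_def length_map)
      obtain k where k: "k \<in> F" "dist (S k y) z < d"
        using F(3) y z(1) by blast
      have "(\<Sum>g\<leftarrow>P. \<psi> (S (h + g) (S k y))) \<le> (\<Sum>g\<leftarrow>P. \<psi> (S (h + g) z) + e / 2)"
        using d(2)[OF tds_mem[OF Y(1) y] z(1) k(2)]
        by (intro sum_list_mono) (smt (verit))
      also have "\<dots> \<le> (m + e / 2) * length P"
        using z(2) by (simp add: comp_def sum_list_addf sum_list_triv algebra_simps)
      also have "\<dots> \<le> s * length P - (e / 2) * length P"
      proof -
        have "(m + e / 2) * length P \<le> (s - e / 2) * length P"
          using \<open>s \<ge> t\<close> by (intro mult_right_mono) (auto simp: e_def field_simps)
        then show ?thesis by (simp add: algebra_simps)
      qed
      finally have 1: "(\<Sum>g\<leftarrow>P. \<psi> (S (h + g) (S k y))) \<le> s * length P - (e / 2) * length P" .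
      have 2: "(\<Sum>g\<leftarrow>P. \<psi> (S (h + g) (S k y))) \<le> s * length P" for k
        using \<open>good P s\<close> tds_mem[OF Y(1) y] by (auto simp: good_def)
      have "(\<Sum>g\<leftarrow>P'. \<psi> (S (h + g) y)) = (\<Sum>k\<leftarrow>ks. \<Sum>g\<leftarrow>P. \<psi> (S (h + g) (S k y)))"
        unfolding P'_def sum_list_product'[symmetric]
        by (simp add: comp_def split_def tds_add[OF Y(1) y] add.assoc)
      also have "\<dots> \<le> s * length P * length ks - (e / 2) * length P"
        by (rule sum_list_le_const_gain[where x = k]) (use 1 2 k(1) ks in auto)
      also have "\<dots> = (s - \<kappa>) * length P'"
        using kn by (simp add: len \<kappa>_def field_simps)
      finally show ?thesis .
    qed
    then have "good P' (s - \<kappa>)"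
      using \<open>good P s\<close> kn len by (auto simp: good_def)
    then show ?thesis by blast
  qed
  have "\<exists>P s. good P s \<and> s \<le> max t (1 - n * \<kappa>)" for n :: nat
  proof (induction n)
    case 0
    have "good [0] 1"
      using \<psi>(2) by (simp add: good_def tds_mem[OF Y(1)])
    then show ?case by (intro exI[of _ "[0]"] exI[of _ 1]) auto
  next
    case (Suc n)
    then obtain P s where P: "good P s" "s \<le> max t (1 - n * \<kappa>)" by blast
    show ?case
    proof (cases "s \<ge> t")
      case True
      then obtain P' where "good P' (s - \<kappa>)"
        using step P(1) by blast
      moreover have "s - \<kappa> \<le> max t (1 - Suc n * \<kappa>)"
        using P(2) \<kappa> by (auto simp: algebra_simps max_def split: if_splits)
      ultimately show ?thesis by blast
    qed (use P in \<open>auto intro!: exI[of _ P] exI[of _ s]\<close>)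
  qed
  moreover obtain n :: nat where "1 - n * \<kappa> < t"
    using \<kappa> ex_less_of_nat_mult[of \<kappa> "1 - t"] by (auto simp: algebra_simps)
  ultimately obtain P s where P: "good P s" "s \<le> t"
    by (smt (verit))
  have "(\<Sum>g\<leftarrow>P. \<psi> (S (h + g) y)) \<le> t * length P" if "y \<in> Y" for h y
    using P that mult_right_mono[OF P(2), of "real (length P)"] unfolding good_def
    by (meson of_nat_0_le_iff order_trans)
  then show ?thesis
    using P that by (auto simp: good_def)
qed


section \<open>Two-sided upper means on the group\<close>

definition upper_mean_le :: "('g::group_add \<Rightarrow> real) \<Rightarrow> real \<Rightarrow> bool" where
  "upper_mean_le F t \<longleftrightarrow> (\<exists>P. P \<noteq> [] \<and> (\<forall>h h'. (\<Sum>g\<leftarrow>P. F (h + g + h')) \<le> t * length P))"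

text \<open>Averaging on both sides is what makes this upper mean subadditive without amenability.\<close>

lemma upper_mean_le_add:
  assumes "upper_mean_le F s" "upper_mean_le F' t"
  shows "upper_mean_le (\<lambda>g. F g + F' g) (s + t)"
proof -
  obtain P where P: "P \<noteq> []" "\<And>h h'. (\<Sum>g\<leftarrow>P. F (h + g + h')) \<le> s * length P"
    using assms(1) unfolding upper_mean_le_def by blast
  obtain Q where Q: "Q \<noteq> []" "\<And>h h'. (\<Sum>g\<leftarrow>Q. F' (h + g + h')) \<le> t * length Q"
    using assms(2) unfolding upper_mean_le_def by blast
  \<comment> \<open>Sums may coincide and are then counted with multiplicity, hence a list. For
    \<open>F\<close> the summand from \<open>Q\<close> is absorbed into the right translate, for
    \<open>F'\<close> the summand from \<open>P\<close> into the left one.\<close>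
  define R where "R = map (\<lambda>(g, k). g + k) (List.product P Q)"
  have len: "length R = length P * length Q"
    by (simp add: R_def)
  have "(\<Sum>g\<leftarrow>R. F (h + g + h') + F' (h + g + h')) \<le> (s + t) * length R" for h h'
  proof -
    have "(\<Sum>g\<leftarrow>R. F (h + g + h')) = (\<Sum>k\<leftarrow>Q. \<Sum>g\<leftarrow>P. F (h + g + (k + h')))"
      unfolding R_def sum_list_product'[symmetric] by (simp add: comp_def split_def add.assoc)
    also have "\<dots> \<le> s * length P * length Q"
      by (rule sum_list_le_const) (rule P(2))
    finally have 1: "(\<Sum>g\<leftarrow>R. F (h + g + h')) \<le> s * length P * length Q" .
    have "(\<Sum>g\<leftarrow>R. F' (h + g + h')) = (\<Sum>k\<leftarrow>P. \<Sum>g\<leftarrow>Q. F' (h + k + g + h'))"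
      unfolding R_def sum_list_product[symmetric] by (simp add: comp_def split_def add.assoc)
    also have "\<dots> \<le> t * length Q * length P"
      by (rule sum_list_le_const) (rule Q(2))
    finally have "(\<Sum>g\<leftarrow>R. F (h + g + h')) + (\<Sum>g\<leftarrow>R. F' (h + g + h')) \<le> (s + t) * length R"
      using 1 by (simp add: len algebra_simps)
    then show ?thesis
      by (simp only: sum_list_addf)
  qed
  moreover have "R \<noteq> []"
    using P(1) Q(1) len by (metis length_0_conv mult_is_0)
  ultimately show ?thesis
    unfolding upper_mean_le_def by blast
qed

lemma upper_mean_le_mono:
  assumes "upper_mean_le F s" "\<And>g. F' g \<le> F g" "s \<le> t"
  shows "upper_mean_le F' t"
proof -
  obtain P where P: "P \<noteq> []" "\<And>h h'. (\<Sum>g\<leftarrow>P. F (h + g + h')) \<le> s * length P"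
    using assms(1) unfolding upper_mean_le_def by blast
  have "(\<Sum>g\<leftarrow>P. F' (h + g + h')) \<le> t * length P" for h h'
    using P(2)[of h h'] sum_list_mono[of P "\<lambda>g. F' (h + g + h')" "\<lambda>g. F (h + g + h')"] assms(2)
      mult_right_mono[OF assms(3), of "real (length P)"] by fastforce
  then show ?thesis
    using P(1) unfolding upper_mean_le_def by blast
qed

lemma upper_mean_le_const: "upper_mean_le (\<lambda>_. t) t"
  unfolding upper_mean_le_def by (intro exI[of _ "[0]"]) simp

lemma upper_mean_le_sum:
  assumes "finite I" "\<And>i. i \<in> I \<Longrightarrow> upper_mean_le (F i) (t i)"
  shows "upper_mean_le (\<lambda>g. \<Sum>i\<in>I. F i g) (\<Sum>i\<in>I. t i)"
  using assms by (induction I) (auto simp: upper_mean_le_const intro: upper_mean_le_add)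

text \<open>A right translate only replaces \<open>c\<close> by another point of \<open>Y\<close>,
  and the bound of \<open>uniform_average\<close> is uniform in that point.\<close>

lemma upper_mean_le_integral:
  fixes \<psi> :: "'b::metric_space \<Rightarrow> real"
  assumes Y: "tds Y S" "minimal_sys Y S" "equicontinuous_sys Y S" and \<nu>: "inv_measure Y S \<nu>"
    and \<psi>: "continuous_on Y \<psi>" "\<And>y. y \<in> Y \<Longrightarrow> \<psi> y \<le> 1" and t: "(\<integral>y. \<psi> y \<partial>\<nu>) < t"
    and c: "c \<in> Y"
  shows "upper_mean_le (\<lambda>g. \<psi> (S g c)) t"
proof -
  obtain P where P: "P \<noteq> []" "\<And>h y. y \<in> Y \<Longrightarrow> (\<Sum>g\<leftarrow>P. \<psi> (S (h + g) y)) \<le> t * length P"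
    using uniform_average[OF Y \<nu> \<psi> t] by metis
  then have "(\<Sum>g\<leftarrow>P. \<psi> (S (h + g + h') c)) \<le> t * length P" for h h'
    using P(2)[OF tds_mem[OF Y(1) c], of h h'] by (simp add: tds_add[OF Y(1) c] add.assoc)
  then show ?thesis
    using P(1) unfolding upper_mean_le_def by blast
qed

section \<open>Continuous approximation of the measure of a closed set\<close>

definition tent :: "'b::metric_space set \<Rightarrow> real \<Rightarrow> 'b \<Rightarrow> real" where
  "tent A r y = max 0 (1 - infdist y A / r)"

lemma tent_bounds: "r > 0 \<Longrightarrow> 0 \<le> tent A r y" "r > 0 \<Longrightarrow> tent A r y \<le> 1"
  by (auto simp: tent_def infdist_nonneg)

lemma tent_mono: "0 < r \<Longrightarrow> r \<le> r' \<Longrightarrow> tent A r y \<le> tent A r' y"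
  unfolding tent_def using divide_left_mono[of r r' "infdist y A"]
  by (auto simp: infdist_nonneg)

lemma tent_continuous: "r > 0 \<Longrightarrow> continuous_on X (tent A r)"
  unfolding tent_def[abs_def] by (intro continuous_intros) auto

lemma tent_eq_one: "y \<in> A \<Longrightarrow> tent A r y = 1"
  by (simp add: tent_def)

text \<open>Since \<open>A\<close> is closed, the tents eventually vanish at each point outside it,
  and dominated convergence applies.\<close>

lemma tent_integral:
  fixes A :: "'b::metric_space set"
  assumes Y: "tds Y S" and \<nu>: "inv_measure Y S \<nu>" and A: "closed A" "A \<subseteq> Y" "A \<noteq> {}"
  shows "r > 0 \<Longrightarrow> measure \<nu> A \<le> (\<integral>y. tent A r y \<partial>\<nu>)"
    and "e > 0 \<Longrightarrow> \<exists>r>0. (\<integral>y. tent A r y \<partial>\<nu>) < measure \<nu> A + e"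
proof -
  interpret prob_space \<nu>
    using \<nu> by (simp add: inv_measure_def)
  have sp: "space \<nu> = Y" and se: "sets \<nu> = sets (restrict_space borel Y)"
    using \<nu> by (auto simp: inv_measure_def)
  have "A \<in> sets borel"
    using A(1) by auto
  then have As: "A \<in> sets \<nu>"
    using A(2) by (auto simp: se sets_restrict_space)
  have int: "integrable \<nu> (tent A r)" if "r > 0" for r
    using that inv_measure_continuous_integrable[OF \<nu> tds_compact[OF Y] tent_continuous] by blast
  have Ai: "integrable \<nu> (indicator A :: _ \<Rightarrow> real)" "(\<integral>y. indicator A y \<partial>\<nu>) = measure \<nu> A"
    using integrable_real_indicator[OF As] As sp A(2) by (simp_all add: emeasure_eq_measure Int_absorb2)
  show "measure \<nu> A \<le> (\<integral>y. tent A r y \<partial>\<nu>)" if "r > 0"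
    unfolding Ai(2)[symmetric] using that
    by (intro integral_mono Ai(1) int) (auto simp: indicator_def tent_eq_one tent_bounds)
  have "(\<lambda>n. \<integral>y. tent A (inverse (real (Suc n))) y \<partial>\<nu>) \<longlonglongrightarrow> (\<integral>y. indicator A y \<partial>\<nu>)"
  proof (rule integral_dominated_convergence[where w = "\<lambda>_. 1"])
    show "AE y in \<nu>. (\<lambda>n. tent A (inverse (real (Suc n))) y) \<longlonglongrightarrow> indicator A y"
    proof (rule AE_I2)
      fix y
      show "(\<lambda>n. tent A (inverse (real (Suc n))) y) \<longlonglongrightarrow> indicator A y"
      proof (cases "y \<in> A")
        case False
        then have "infdist y A > 0"
          using A in_closed_iff_infdist_zero infdist_nonneg by (metis less_eq_real_def)
        then obtain N where N: "inverse (real (Suc N)) < infdist y A"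
          using reals_Archimedean by blast
        have "tent A (inverse (real (Suc n))) y = 0" if "n \<ge> N" for n
        proof -
          have "inverse (real (Suc n)) \<le> inverse (real (Suc N))"
            using that by (simp add: field_simps)
          then have "inverse (real (Suc n)) \<le> infdist y A"
            using N by linarith
          then have "1 \<le> infdist y A / inverse (real (Suc n))"
            by (subst le_divide_eq_1_pos) auto
          then show ?thesis
            by (simp add: tent_def)
        qed
        then show ?thesis
          using False by (intro tendsto_eventually) (auto simp: eventually_sequentially)
      qed (simp add: tent_eq_one)
    qed
  qed (use As int in \<open>auto simp: tent_bounds intro: borel_measurable_integrable\<close>)
  moreover assume "e > 0"
  ultimately have "eventually (\<lambda>n. (\<integral>y. tent A (inverse (real (Suc n))) y \<partial>\<nu>) < measure \<nu> A + e) sequentially"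
    unfolding Ai(2) by (intro order_tendstoD) auto
  then obtain n where "(\<integral>y. tent A (inverse (real (Suc n))) y \<partial>\<nu>) < measure \<nu> A + e"
    using eventually_happens by force
  then show "\<exists>r>0. (\<integral>y. tent A r y \<partial>\<nu>) < measure \<nu> A + e"
    by (intro exI[of _ "inverse (real (Suc n))"]) auto
qed

section \<open>Simultaneous visits of finitely many points to neighbourhoods of a closed set\<close>

definition near ::
  "('g \<Rightarrow> 'b::metric_space \<Rightarrow> 'b) \<Rightarrow> 'b set \<Rightarrow> 's set \<Rightarrow> ('s \<Rightarrow> 'b) \<Rightarrow> real \<Rightarrow> 'g \<Rightarrow> real" where
  "near S A I c r g = of_bool (\<forall>s\<in>I. infdist (S g (c s)) A < r)"

text \<open>The translates \<^term>\<open>g\<close> moving all of the finitely many points \<^term>\<open>c s\<close> close to \<^term>\<open>A\<close>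
have positive mean. This stands in for: among the elements of the Ellis group of \<^term>\<open>Y\<close>, those
moving every \<^term>\<open>c s\<close> into \<^term>\<open>A\<close> have positive Haar measure.\<close>

definition often_near ::
  "('g::group_add \<Rightarrow> 'b::metric_space \<Rightarrow> 'b) \<Rightarrow> 'b set \<Rightarrow> 's set \<Rightarrow> ('s \<Rightarrow> 'b) \<Rightarrow> bool" where
  "often_near S A I c \<longleftrightarrow>
     (\<exists>\<delta>>0. \<forall>r>0. \<not> upper_mean_le (near S A I c r) \<delta>)"

text \<open>Repeating or dropping points does not shrink the set of good translates. This lets every
  extension of a word inherit the point of that word.\<close>

lemma often_near_reindex:
  assumes "often_near S A I c" "\<And>s. s \<in> J \<Longrightarrow> f s \<in> I \<and> c' s = c (f s)"
  shows "often_near S A J c'"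
proof -
  obtain \<delta> where \<delta>: "\<delta> > 0"
    "\<And>r. r > 0 \<Longrightarrow> \<not> upper_mean_le (near S A I c r) \<delta>"
    using assms(1) unfolding often_near_def by blast
  have "\<not> upper_mean_le (near S A J c' r) \<delta>" if "r > 0" for r
  proof
    assume "upper_mean_le (near S A J c' r) \<delta>"
    then have "upper_mean_le (near S A I c r) \<delta>"
      by (rule upper_mean_le_mono) (use assms(2) in \<open>auto simp: near_def\<close>)
    then show False
      using \<delta>(2) that by blast
  qed
  then show ?thesis
    using \<delta>(1) unfolding often_near_def by blast
qed

text \<open>The translates of a tent along \<open>P\<close> have average integral at least the
  measure of \<open>A\<close>, so at some point their average exceeds half of it. By continuity this
  happens on an open set, which the orbit of \<open>c s\<close> meets; so no list \<open>P\<close>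
  can witness the smaller upper mean.\<close>

lemma often_near_single:
  assumes Y: "tds Y S" "minimal_sys Y S" and \<nu>: "inv_measure Y S \<nu>"
    and A: "closed A" "A \<subseteq> Y" "measure \<nu> A > 0" and c: "c s \<in> Y"
  shows "often_near S A {s} c"
  unfolding often_near_def
proof (intro exI[of _ "measure \<nu> A / 2"] conjI allI impI notI)
  fix r :: real
  assume r: "r > 0"
  have An: "A \<noteq> {}"
    using A(3) by auto
  assume "upper_mean_le (near S A {s} c r) (measure \<nu> A / 2)"
  then have "upper_mean_le (\<lambda>g. tent A r (S g (c s))) (measure \<nu> A / 2)"
    by (rule upper_mean_le_mono) (use r in \<open>auto simp: near_def tent_def of_bool_def infdist_nonneg\<close>)
  then obtain P where P: "P \<noteq> []"
    "\<And>h h'. (\<Sum>g\<leftarrow>P. tent A r (S (h + g + h') (c s))) \<le> measure \<nu> A / 2 * length P"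
    unfolding upper_mean_le_def by blast
  \<comment> \<open>The sign is reversed because \<open>inv_measure_ex_le_integral\<close> gives a
    point below the integral, and a point above it is wanted.\<close>
  define \<psi> where "\<psi> y = - (\<Sum>g\<leftarrow>P. tent A r (S g y))" for y
  note translates = inv_measure_integral_translates[OF Y(1) \<nu> tent_continuous[OF r], where P = P]
  have cont: "continuous_on Y \<psi>"
    unfolding \<psi>_def using translates(1) by (rule continuous_on_minus)
  have "(\<integral>y. \<psi> y \<partial>\<nu>) = - ((\<integral>y. tent A r y \<partial>\<nu>) * length P)"
    unfolding \<psi>_def using translates(2) by simp
  moreover obtain y where y: "y \<in> Y" "\<psi> y \<le> (\<integral>y. \<psi> y \<partial>\<nu>)"
    using inv_measure_ex_le_integral[OF \<nu> tds_compact[OF Y(1)] cont] by metis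
  moreover have "measure \<nu> A * length P \<le> (\<integral>y. tent A r y \<partial>\<nu>) * length P"
    by (intro mult_right_mono tent_integral(1)[OF Y(1) \<nu> A(1,2) An r]) simp
  moreover have "measure \<nu> A / 2 * length P < measure \<nu> A * length P"
    using A(3) P(1) by simp
  ultimately have lt: "\<psi> y < - (measure \<nu> A / 2 * length P)"
    by linarith
  obtain U where U: "open U" "U \<inter> Y = \<psi> -` {..<- (measure \<nu> A / 2 * length P)} \<inter> Y"
    using cont open_lessThan unfolding continuous_on_open_invariant by metis
  then have "y \<in> U"
    using lt y(1) by auto
  then obtain h' where h': "S h' (c s) \<in> U"
    using minimal_sys_hits[OF Y c U(1)] y(1) by blast
  then have "\<psi> (S h' (c s)) < - (measure \<nu> A / 2 * length P)"
    using U(2) tds_mem[OF Y(1) c] by blast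
  then show False
    using P(2)[of 0 h'] by (simp add: \<psi>_def tds_add[OF Y(1) c])
qed (use A in simp)

text \<open>A translate that brings all \<open>c s\<close> within \<open>r / 4\<close> of
  \<open>A\<close>, but not all \<open>c' s\<close> within \<open>r1\<close>, puts some
  \<open>c' s\<close> into the shell between the distances \<open>r1\<close> and
  \<open>r / 2\<close>. The measure of such shells is small for every \<open>r1\<close>, once
  \<open>r\<close> is small, because \<open>A\<close> is closed; hence so is the upper mean of these
  translates. The radius \<open>d\<close> depends on \<open>r\<close> alone, which is fixed before
  \<open>r1\<close>.\<close>

lemma often_near_open:
  fixes A :: "'b::metric_space set"
  assumes Y: "tds Y S" "minimal_sys Y S" "equicontinuous_sys Y S" and \<nu>: "inv_measure Y S \<nu>"
    and A: "closed A" "A \<subseteq> Y" "A \<noteq> {}" and I: "finite I" and c: "\<And>s. s \<in> I \<Longrightarrow> c s \<in> Y"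
    and near: "often_near S A I c"
  obtains d where "d > 0"
    "\<And>c'. (\<And>s. s \<in> I \<Longrightarrow> c' s \<in> Y \<and> dist (c s) (c' s) < d) \<Longrightarrow> often_near S A I c'"
proof -
  obtain \<delta> where \<delta>: "\<delta> > 0"
    "\<And>r. r > 0 \<Longrightarrow> \<not> upper_mean_le (near S A I c r) \<delta>"
    using near unfolding often_near_def by blast
  \<comment> \<open>Each \<open>s\<close> will cost \<open>2 * e\<close>, since the difference of
    tents is only known to be at least 1/2 on the shell and is counted twice. All of
    \<open>I\<close> then costs at most \<open>\<delta> / 2\<close>; the \<open>+ 1\<close> covers
    the empty \<open>I\<close>.\<close>
  define e where "e = \<delta> / (4 * (card I + 1))"
  have e: "e > 0"
    using \<delta>(1) by (simp add: e_def)
  have "2 * e * card I \<le> \<delta> / 2"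
    using \<delta>(1) by (simp add: e_def field_simps)
  then have e2: "\<delta> / 2 + (\<Sum>s\<in>I. e + e) \<le> \<delta>"
    by (simp add: algebra_simps)
  obtain r where r: "r > 0" "(\<integral>y. tent A r y \<partial>\<nu>) < measure \<nu> A + e"
    using tent_integral(2)[OF Y(1) \<nu> A e] by blast
  obtain d where d: "d > 0"
    "\<And>y z g. y \<in> Y \<Longrightarrow> z \<in> Y \<Longrightarrow> dist y z < d \<Longrightarrow> dist (S g y) (S g z) < r / 4"
  proof -
    have "r / 4 > 0"
      using r(1) by simp
    then show thesis
      using Y(3) that unfolding equicontinuous_sys_def by blast
  qed
  show ?thesis
  proof (rule that[OF d(1)])
    fix c' assume c': "\<And>s. s \<in> I \<Longrightarrow> c' s \<in> Y \<and> dist (c s) (c' s) < d"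
    show "often_near S A I c'"
      unfolding often_near_def
    proof (intro exI[of _ "\<delta> / 2"] conjI allI impI notI)
      fix r1 :: real
      assume "r1 > 0" and ub: "upper_mean_le (near S A I c' r1) (\<delta> / 2)"
      \<comment> \<open>It must not exceed \<open>r\<close>, so that \<open>\<psi>\<close> is
        nonnegative, nor \<open>r1\<close>, so that the smaller tent vanishes wherever
        \<open>c' s\<close> fails to be \<open>r1\<close>-close.\<close>
      define r' where "r' = min r1 r"
      have r': "r' > 0" "r' \<le> r" "r' \<le> r1"
        using \<open>r1 > 0\<close> r(1) by (auto simp: r'_def)
      define \<psi> where "\<psi> y = tent A r y - tent A r' y" for y
      have "upper_mean_le (\<lambda>g. \<psi> (S g (c' s))) e" if "s \<in> I" for s
      proof (rule upper_mean_le_integral[OF Y \<nu>])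
        show "continuous_on Y \<psi>"
          unfolding \<psi>_def by (intro continuous_intros tent_continuous r r')
        show "\<psi> y \<le> 1" for y
          using tent_bounds[OF r(1)] tent_bounds[OF r'(1)] unfolding \<psi>_def by (smt (verit))
        have "integrable \<nu> (tent A r)" "integrable \<nu> (tent A r')"
          using inv_measure_continuous_integrable[OF \<nu> tds_compact[OF Y(1)] tent_continuous] r r' by blast+
        then show "(\<integral>y. \<psi> y \<partial>\<nu>) < e"
          unfolding \<psi>_def using r(2) tent_integral(1)[OF Y(1) \<nu> A r'(1)] by simp
      qed (use c' that in blast)
      then have "upper_mean_le (\<lambda>g. \<Sum>s\<in>I. \<psi> (S g (c' s)) + \<psi> (S g (c' s))) (\<Sum>s\<in>I. e + e)"
        by (intro upper_mean_le_sum upper_mean_le_add I)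
      from upper_mean_le_add[OF ub this]
      have "upper_mean_le (near S A I c (r / 4)) \<delta>"
      proof (rule upper_mean_le_mono[OF _ _ e2])
        fix g
        have \<psi>0: "0 \<le> \<psi> y" for y
          using tent_mono[OF r'(1,2)] by (simp add: \<psi>_def)
        show "near S A I c (r / 4) g \<le> near S A I c' r1 g + (\<Sum>s\<in>I. \<psi> (S g (c' s)) + \<psi> (S g (c' s)))"
        proof (cases "(\<forall>s\<in>I. infdist (S g (c s)) A < r / 4) \<and> \<not> (\<forall>s\<in>I. infdist (S g (c' s)) A < r1)")
          case True
          then obtain s where s: "s \<in> I" "infdist (S g (c' s)) A \<ge> r1" "infdist (S g (c s)) A < r / 4"
            by force
          have "infdist (S g (c' s)) A \<le> infdist (S g (c s)) A + dist (S g (c' s)) (S g (c s))"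
            by (rule infdist_triangle)
          also have "\<dots> < r / 2"
            using s(3) d(2)[OF c[OF s(1)], of "c' s" g] c'[OF s(1)] by (simp add: dist_commute)
          finally have "1 / 2 \<le> tent A r (S g (c' s))"
            using r(1) by (auto simp: tent_def field_simps max_def)
          moreover have "tent A r' (S g (c' s)) = 0"
            using s(2) r' by (auto simp: tent_def field_simps)
          ultimately have "1 \<le> \<psi> (S g (c' s)) + \<psi> (S g (c' s))"
            by (simp add: \<psi>_def)
          also have "\<dots> \<le> (\<Sum>s\<in>I. \<psi> (S g (c' s)) + \<psi> (S g (c' s)))"
            using s(1) I \<psi>0 by (intro member_le_sum) auto
          finally show ?thesis
            by (simp add: near_def of_bool_def)
        next
          case False
          then show ?thesis
            using \<psi>0 by (auto intro!: add_nonneg_nonneg sum_nonneg simp: near_def of_bool_def)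
        qed
      qed
      then show False
        using \<delta>(2)[of "r / 4"] r(1) by simp
    qed (use \<delta> in simp)
  qed
qed

lemma often_near_ex:
  assumes "often_near S A I c" "r > 0"
  obtains g where "\<And>s. s \<in> I \<Longrightarrow> infdist (S g (c s)) A < r"
proof -
  obtain \<delta> where \<delta>: "\<delta> > 0"
    "\<not> upper_mean_le (near S A I c r) \<delta>"
    using assms unfolding often_near_def by blast
  have "\<exists>g. \<forall>s\<in>I. infdist (S g (c s)) A < r"
  proof (rule ccontr)
    assume "\<not> ?thesis"
    then have "near S A I c r g \<le> 0" for g
      by (simp only: near_def not_ex of_bool_eq order_refl simp_thms)
    with \<delta>(1) have "upper_mean_le (near S A I c r) \<delta>"
      using upper_mean_le_mono[OF upper_mean_le_const] by (meson less_imp_le)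
    then show False
      using \<delta>(2) by blast
  qed
  then show ?thesis
    using that by blast
qed

section \<open>Invariant pseudometrics\<close>

lemma compact_preimage:
  fixes f :: "'a::t2_space \<Rightarrow> 'b::topological_space"
  assumes "continuous_on S f" "compact S" "closed C"
  shows "compact (S \<inter> f -` C)"
proof -
  have "closed (S \<inter> f -` C)"
    using assms by (simp add: continuous_closed_preimage compact_imp_closed)
  then have "compact (S \<inter> (S \<inter> f -` C))"
    using assms(2) by (rule compact_Int_closed[rotated])
  then show ?thesis
    by (simp add: Int_left_absorb)
qed

lemma compact_uniform_bound:
  fixes f h :: "'a::t2_space \<Rightarrow> real"
  assumes "compact S" "continuous_on S f" "continuous_on S h"
    and "\<And>x. x \<in> S \<Longrightarrow> r \<le> f x \<Longrightarrow> 0 < h x"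
  obtains d where "d > 0" "\<And>x. x \<in> S \<Longrightarrow> h x < d \<Longrightarrow> f x < r"
proof (cases "S \<inter> f -` {r..} = {}")
  case True
  then have "f x < r" if "x \<in> S" for x
    using that by force
  then show ?thesis
    using that[of 1] by simp
next
  case False
  have "compact (S \<inter> f -` {r..})"
    using assms by (intro compact_preimage) auto
  moreover have "continuous_on (S \<inter> f -` {r..}) h"
    using assms(3) by (rule continuous_on_subset) auto
  ultimately obtain w where w: "w \<in> S \<inter> f -` {r..}" "\<And>v. v \<in> S \<inter> f -` {r..} \<Longrightarrow> h w \<le> h v"
    using continuous_attains_inf[OF _ False] by blast
  show ?thesis
  proof (rule that[of "h w"])
    show "0 < h w"
      using w(1) assms(4) by auto
    show "f x < r" if "x \<in> S" "h x < h w" for x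
      using w(2)[of x] that by force
  qed
qed

lemma compact_countable_dense:
  fixes X :: "'a::metric_space set"
  assumes "compact X" "X \<noteq> {}"
  obtains e :: "nat \<Rightarrow> 'a" where "range e \<subseteq> X" "\<And>x r. x \<in> X \<Longrightarrow> r > 0 \<Longrightarrow> \<exists>k. dist x (e k) < r"
proof -
  have "\<exists>k. finite k \<and> k \<subseteq> X \<and> X \<subseteq> (\<Union>x\<in>k. ball x (inverse (real (Suc n))))" for n
    by (rule compactE_image[OF assms(1), of X "\<lambda>x. ball x (inverse (real (Suc n)))"]) auto
  then obtain E where E: "\<And>n. finite (E n)" "\<And>n. E n \<subseteq> X"
    "\<And>n. X \<subseteq> (\<Union>x\<in>E n. ball x (inverse (real (Suc n))))"
    by metis
  have cnt: "countable (\<Union>n. E n)"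
    using E(1) by (simp add: countable_finite)
  have ne: "(\<Union>n. E n) \<noteq> {}"
    using E(3)[of 0] assms(2) by auto
  have rng: "range (from_nat_into (\<Union>n. E n)) = (\<Union>n. E n)"
    by (rule range_from_nat_into[OF ne cnt])
  show ?thesis
  proof (rule that[of "from_nat_into (\<Union>n. E n)"])
    show "range (from_nat_into (\<Union>n. E n)) \<subseteq> X"
      using rng E(2) by auto
    fix x and r :: real
    assume "x \<in> X" "r > 0"
    obtain n where n: "inverse (real (Suc n)) < r"
      using reals_Archimedean \<open>r > 0\<close> by blast
    obtain z where z: "z \<in> E n" "dist z x < inverse (real (Suc n))"
      using E(3)[of n] \<open>x \<in> X\<close> by auto
    then obtain k where "z = from_nat_into (\<Union>n. E n) k"
      using rng by blast
    then show "\<exists>k. dist x (from_nat_into (\<Union>n. E n) k) < r"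
      using z(2) n by (metis dist_commute less_trans)
  qed
qed

lemma compact_countable_base:
  fixes X :: "'a::metric_space set"
  assumes "compact X" "X \<noteq> {}"
  obtains B :: "nat \<Rightarrow> 'a set" where "\<And>k. open (B k)"
    "\<And>x V. x \<in> X \<Longrightarrow> open V \<Longrightarrow> x \<in> V \<Longrightarrow> \<exists>k. x \<in> B k \<and> B k \<subseteq> V"
proof -
  obtain e :: "nat \<Rightarrow> 'a" where e: "\<And>x r. x \<in> X \<Longrightarrow> r > 0 \<Longrightarrow> \<exists>k. dist x (e k) < r"
    using compact_countable_dense[OF assms] by metis
  define B where "B n = ball (e (fst (prod_decode n))) (inverse (real (Suc (snd (prod_decode n)))))" for n
  have "\<exists>k. x \<in> B k \<and> B k \<subseteq> V" if x: "x \<in> X" and V: "open V" "x \<in> V" for x V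
  proof -
    obtain r where r: "r > 0" "ball x r \<subseteq> V"
      using V openE by blast
    obtain m where m: "inverse (real (Suc m)) < r / 2"
      using reals_Archimedean[of "r / 2"] r(1) by auto
    obtain k where k: "dist x (e k) < inverse (real (Suc m))"
      using e[OF x, of "inverse (real (Suc m))"] by auto
    have B: "B (prod_encode (k, m)) = ball (e k) (inverse (real (Suc m)))"
      by (simp add: B_def)
    have "ball (e k) (inverse (real (Suc m))) \<subseteq> ball x r"
    proof
      fix w assume "w \<in> ball (e k) (inverse (real (Suc m)))"
      then have "dist x w < r / 2 + r / 2"
        using k m dist_triangle[of x w "e k"] by (simp only: mem_ball)
      then show "w \<in> ball x r"
        by simp
    qed
    moreover have "x \<in> ball (e k) (inverse (real (Suc m)))"
      using k by (simp only: mem_ball dist_commute)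
    ultimately show ?thesis
      unfolding B[symmetric] using r(2) by blast
  qed
  moreover have "open (B k)" for k
    by (simp add: B_def)
  ultimately show ?thesis
    using that by blast
qed

text \<open>The distances to a dense sequence map \<^term>\<open>X\<close> onto an equicontinuous factor inside
\<^typ>\<open>nat \<Rightarrow> real\<close>.\<close>

lemma invariant_pseudometric_zero:
  fixes X :: "'a::metric_space set" and D :: "'a \<Rightarrow> 'a \<Rightarrow> real"
  assumes X: "tds X T" "X \<noteq> {}" and max: "max_eq_factor X T Y S p"
    and refl: "\<And>x. x \<in> X \<Longrightarrow> D x x = 0"
    and sym: "\<And>x y. x \<in> X \<Longrightarrow> y \<in> X \<Longrightarrow> D x y = D y x"
    and tri: "\<And>x y z. x \<in> X \<Longrightarrow> y \<in> X \<Longrightarrow> z \<in> X \<Longrightarrow> D x z \<le> D x y + D y z"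
    and inv: "\<And>x y g. x \<in> X \<Longrightarrow> y \<in> X \<Longrightarrow> D (T g x) (T g y) = D x y"
    and cont: "\<And>x r. x \<in> X \<Longrightarrow> r > 0 \<Longrightarrow> \<exists>d>0. \<forall>y\<in>X. dist x y < d \<longrightarrow> D x y < r"
    and ab: "a \<in> X" "b \<in> X" "p a = p b"
  shows "D a b = 0"
proof -
  have cX: "compact X"
    using X(1) by (rule tds_compact)
  have nonneg: "0 \<le> D x y" if "x \<in> X" "y \<in> X" for x y
    using tri[of x y x] sym[of x y] refl[of x] that by simp
  have contD: "continuous_on (X \<times> X) (\<lambda>w. D (fst w) (snd w))"
    unfolding continuous_on_iff
  proof clarsimp
    fix x y and r :: real
    assume x: "x \<in> X" and y: "y \<in> X" and r: "r > 0"
    obtain d1 where d1: "d1 > 0" "\<And>z. z \<in> X \<Longrightarrow> dist x z < d1 \<Longrightarrow> D x z < r / 2"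
      using cont[OF x, of "r / 2"] r by auto
    obtain d2 where d2: "d2 > 0" "\<And>z. z \<in> X \<Longrightarrow> dist y z < d2 \<Longrightarrow> D y z < r / 2"
      using cont[OF y, of "r / 2"] r by auto
    show "\<exists>d>0. \<forall>x'\<in>X. \<forall>y'\<in>X. dist (x', y') (x, y) < d \<longrightarrow> dist (D x' y') (D x y) < r"
    proof (intro exI[of _ "min d1 d2"] conjI ballI impI)
      fix x' y'
      assume x': "x' \<in> X" and y': "y' \<in> X" and "dist (x', y') (x, y) < min d1 d2"
      then have "dist x x' < d1" "dist y y' < d2"
        using dist_fst_le[of "(x', y')" "(x, y)"] dist_snd_le[of "(x', y')" "(x, y)"]
        by (auto simp: dist_commute)
      then have "D x x' < r / 2" "D y y' < r / 2"
        using d1(2) d2(2) x' y' by auto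
      moreover have "D x' y' \<le> D x x' + D x y + D y y'"
        using tri[OF x' x y'] tri[OF x y y'] sym[OF x x'] by simp
      moreover have "D x y \<le> D x x' + D x' y' + D y y'"
        using tri[OF x x' y] tri[OF x' y' y] sym[OF y y'] by simp
      ultimately show "dist (D x' y') (D x y) < r"
        by (simp add: dist_real_def)
    qed (use d1 d2 in auto)
  qed
  obtain e :: "nat \<Rightarrow> 'a" where e: "range e \<subseteq> X"
    "\<And>x r. x \<in> X \<Longrightarrow> r > 0 \<Longrightarrow> \<exists>k. dist x (e k) < r"
    using compact_countable_dense[OF cX X(2)] by metis
  define q where "q x k = D x (e k)" for x k
  have q: "continuous_on X q"
  proof (rule continuous_on_coordinatewise_then_product)
    fix k
    have "continuous_on X (\<lambda>x. (x, e k))"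
      by (intro continuous_intros)
    then show "continuous_on X (\<lambda>x. q x k)"
      unfolding q_def using continuous_on_compose2[OF contD, of X "\<lambda>x. (x, e k)"] e(1) by auto
  qed
  have q_eq: "q x = q y \<longleftrightarrow> D x y = 0" if x: "x \<in> X" and y: "y \<in> X" for x y
  proof
    assume eq: "q x = q y"
    show "D x y = 0"
    proof (rule antisym[OF field_le_epsilon nonneg[OF x y]])
      fix r :: real
      assume "r > 0"
      then obtain d where d: "d > 0" "\<And>z. z \<in> X \<Longrightarrow> dist y z < d \<Longrightarrow> D y z < r / 2"
        using cont[OF y, of "r / 2"] by auto
      obtain k where "dist y (e k) < d"
        using e(2)[OF y d(1)] by blast
      then have "D y (e k) < r / 2"
        using d(2) e(1) by blast
      moreover have "D x (e k) = D y (e k)"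
        using eq by (metis q_def)
      moreover have "D x y \<le> D x (e k) + D y (e k)"
        using tri[OF x _ y, of "e k"] sym[OF y, of "e k"] e(1) by (simp add: range_subsetD)
      ultimately show "D x y \<le> 0 + r"
        by simp
    qed
  next
    assume z: "D x y = 0"
    have "D x (e k) = D y (e k)" for k
      using tri[OF x y, of "e k"] tri[OF y x, of "e k"] sym[OF x y] z e(1) by (smt (verit) rangeI subsetD)
    then show "q x = q y"
      by (auto simp: q_def)
  qed
  have cq: "continuous_on (X \<times> X) (\<lambda>w. dist (q (fst w)) (q (snd w)))"
    by (intro continuous_intros continuous_on_compose2[OF q]) auto
  \<comment> \<open>\<open>D\<close> and the distance pulled back along \<open>q\<close> vanish at
    the same pairs, so compactness makes them uniformly equivalent. The invariance of
    \<open>D\<close> thereby becomes equicontinuity of \<open>S'\<close>.\<close>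
  have small_D: "\<exists>d>0. \<forall>x\<in>X. \<forall>y\<in>X. dist (q x) (q y) < d \<longrightarrow> D x y < r" if r: "r > 0" for r
  proof -
    have "dist (q (fst w)) (q (snd w)) > 0" if "w \<in> X \<times> X" "r \<le> D (fst w) (snd w)" for w
      using that q_eq[of "fst w" "snd w"] r by auto
    then obtain d where "d > 0"
      "\<And>w. w \<in> X \<times> X \<Longrightarrow> dist (q (fst w)) (q (snd w)) < d \<Longrightarrow> D (fst w) (snd w) < r"
      using compact_uniform_bound[OF compact_Times[OF cX cX] contD cq, of r] by metis
    then show ?thesis by force
  qed
  have small_q: "\<exists>d>0. \<forall>x\<in>X. \<forall>y\<in>X. D x y < d \<longrightarrow> dist (q x) (q y) < r" if r: "r > 0" for r
  proof -
    have "D (fst w) (snd w) > 0" if "w \<in> X \<times> X" "r \<le> dist (q (fst w)) (q (snd w))" for w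
    proof -
      have w: "fst w \<in> X" "snd w \<in> X"
        using that(1) by auto
      have "q (fst w) \<noteq> q (snd w)"
        using that(2) r by auto
      then show ?thesis
        using q_eq[OF w] nonneg[OF w] by linarith
    qed
    then obtain d where "d > 0"
      "\<And>w. w \<in> X \<times> X \<Longrightarrow> D (fst w) (snd w) < d \<Longrightarrow> dist (q (fst w)) (q (snd w)) < r"
      using compact_uniform_bound[OF compact_Times[OF cX cX] cq contD, of r] by metis
    then show ?thesis by force
  qed
  \<comment> \<open>The choice does not matter: two preimages of \<open>z\<close> have
    \<open>D\<close>-distance 0, and so have their translates.\<close>
  define S' where "S' g z = q (T g (SOME x. x \<in> X \<and> q x = z))" for g z
  have S': "S' g (q x) = q (T g x)" if "x \<in> X" for g x
  proof -
    define z where "z = (SOME z. z \<in> X \<and> q z = q x)"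
    have z: "z \<in> X" "q z = q x"
      using someI[of "\<lambda>z. z \<in> X \<and> q z = q x" x] that by (auto simp: z_def)
    have "D (T g z) (T g x) = 0"
      using q_eq z that inv by simp
    then show ?thesis
      unfolding S'_def z_def[symmetric] using q_eq z that tds_mem[OF X(1)] by simp
  qed
  have eq: "equicontinuous_sys (q ` X) S'"
    unfolding equicontinuous_sys_def
  proof (intro allI impI)
    fix r :: real
    assume "r > 0"
    then obtain d1 where d1: "d1 > 0" "\<And>x y. x \<in> X \<Longrightarrow> y \<in> X \<Longrightarrow> D x y < d1 \<Longrightarrow> dist (q x) (q y) < r"
      using small_q by metis
    obtain d2 where d2: "d2 > 0" "\<And>x y. x \<in> X \<Longrightarrow> y \<in> X \<Longrightarrow> dist (q x) (q y) < d2 \<Longrightarrow> D x y < d1"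
      using small_D[OF d1(1)] by metis
    show "\<exists>d>0. \<forall>x\<in>q ` X. \<forall>y\<in>q ` X. dist x y < d \<longrightarrow> (\<forall>g. dist (S' g x) (S' g y) < r)"
      using d1(2) d2 inv tds_mem[OF X(1)] by (intro exI[of _ d2]) (auto simp: S')
  qed
  have "continuous_on (q ` X) (S' g)" for g
    unfolding continuous_on_iff
  proof (intro ballI allI impI)
    fix z and r :: real
    assume "z \<in> q ` X" "r > 0"
    then show "\<exists>d>0. \<forall>z'\<in>q ` X. dist z' z < d \<longrightarrow> dist (S' g z') (S' g z) < r"
      using eq unfolding equicontinuous_sys_def by meson
  qed
  then have "tds (q ` X) S'"
    using q cX X(1) unfolding tds_def
    by (auto simp: S' tds_mem[OF X(1)] tds_zero[OF X(1)] tds_add[OF X(1)] compact_continuous_image)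
  then have "factor_map X T (q ` X) S' q"
    using X(1) q by (simp add: factor_map_def S')
  then obtain f where "\<And>x. x \<in> X \<Longrightarrow> q x = f (p x)"
    using max eq unfolding max_eq_factor_def by blast
  then have "q a = q b"
    using ab by simp
  then show ?thesis
    using q_eq ab by simp
qed

section \<open>States and closed invariant relations\<close>

lemma compact_PiE_UNIV:
  fixes B :: "'i \<Rightarrow> 'a::topological_space set"
  assumes "\<And>i. compact (B i)"
  shows "compact (PiE UNIV B)"
proof -
  have "compactin (product_topology (\<lambda>i. euclidean) UNIV) (PiE UNIV B)"
    using assms by (simp add: compactin_PiE)
  then show ?thesis
    by (simp add: euclidean_product_topology)
qed

type_synonym 'c functional = "('c \<Rightarrow> real) \<Rightarrow> real"

text \<open>Discontinuous functions are sent to \<open>0\<close>; this makes the set compact for pointwise convergence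
on all functions.\<close>

definition states :: "'c::topological_space set \<Rightarrow> 'c functional set" where
  "states K = {L.
     (\<forall>f. \<not> continuous_on K f \<longrightarrow> L f = 0) \<and>
     (\<forall>f f'. continuous_on K f \<and> continuous_on K f' \<longrightarrow> L (\<lambda>x. f x + f' x) = L f + L f') \<and>
     (\<forall>c f. continuous_on K f \<longrightarrow> L (\<lambda>x. c * f x) = c * L f) \<and>
     (\<forall>f. continuous_on K f \<and> (\<forall>x\<in>K. 0 \<le> f x) \<longrightarrow> 0 \<le> L f) \<and>
     L (\<lambda>x. 1) = 1}"

lemma statesD:
  assumes "L \<in> states K"
  shows state_discontinuous: "\<not> continuous_on K f \<Longrightarrow> L f = 0"
    and state_add: "continuous_on K f \<Longrightarrow> continuous_on K f' \<Longrightarrow> L (\<lambda>x. f x + f' x) = L f + L f'"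
    and state_scale: "continuous_on K f \<Longrightarrow> L (\<lambda>x. c * f x) = c * L f"
    and state_nonneg: "continuous_on K f \<Longrightarrow> (\<And>x. x \<in> K \<Longrightarrow> 0 \<le> f x) \<Longrightarrow> 0 \<le> L f"
    and state_one: "L (\<lambda>x. 1) = 1"
  using assms unfolding states_def by auto

lemma state_diff:
  assumes "L \<in> states K" "continuous_on K f" "continuous_on K f'"
  shows "L (\<lambda>x. f x - f' x) = L f - L f'"
proof -
  have "L (\<lambda>x. f x + (-1) * f' x) = L f + L (\<lambda>x. (-1) * f' x)"
    by (rule state_add[OF assms(1,2)]) (intro continuous_intros assms)
  then show ?thesis
    using state_scale[OF assms(1,3), of "-1"] by simp
qed

lemma state_mono:
  assumes "L \<in> states K" "continuous_on K f" "continuous_on K f'" "\<And>x. x \<in> K \<Longrightarrow> f x \<le> f' x"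
  shows "L f \<le> L f'"
proof -
  have "0 \<le> L (\<lambda>x. f' x - f x)"
    by (rule state_nonneg[OF assms(1)]) (auto intro!: continuous_intros assms)
  then show ?thesis
    using state_diff[OF assms(1,3,2)] by simp
qed

lemma state_cong:
  assumes "L \<in> states K" "\<And>x. x \<in> K \<Longrightarrow> f x = f' x"
  shows "L f = L f'"
proof (cases "continuous_on K f")
  case True
  then have "continuous_on K f'"
    using assms(2) continuous_on_cong by force
  then show ?thesis
    using True assms by (intro antisym state_mono[OF assms(1)]) auto
next
  case False
  then have "\<not> continuous_on K f'"
    using assms(2) continuous_on_cong by force
  then show ?thesis
    using False assms(1) by (simp add: state_discontinuous)
qed

lemma state_const: "L \<in> states K \<Longrightarrow> L (\<lambda>x. c) = c"
  using state_scale[of L K "\<lambda>x. 1" c] state_one[of L K] by simp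

lemma state_add_const:
  assumes "L \<in> states K" "continuous_on K f"
  shows "L (\<lambda>x. f x + c) = L f + c"
  using state_add[OF assms(1,2), of "\<lambda>_. c"] state_const[OF assms(1)] by simp

lemma closed_states: "closed (states K)"
  unfolding states_def
  by (intro closed_Collect_conj closed_Collect_all closed_Collect_imp open_Collect_const
      closed_Collect_eq closed_Collect_le continuous_intros continuous_on_product_coordinates)

text \<open>Tychonoff: a state takes a value of modulus at most the supremum of
  \<open>\<bar>f\<bar>\<close> at each continuous \<open>f\<close>. At a discontinuous
  \<open>f\<close> the interval shrinks to 0, which is where the convention on such functions is
  needed.\<close>

lemma compact_states:
  fixes K :: "'c::topological_space set"
  assumes "compact K"
  shows "compact (states K)"
proof -
  define B where "B f = (if continuous_on K f then Sup ((\<lambda>x. \<bar>f x\<bar>) ` K) else 0)" for f :: "'c \<Rightarrow> real"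
  have "states K \<subseteq> PiE UNIV (\<lambda>f. {- B f..B f})"
  proof
    fix L assume L: "L \<in> states K"
    have "L f \<in> {- B f..B f}" for f
    proof (cases "continuous_on K f")
      case True
      have "compact ((\<lambda>x. \<bar>f x\<bar>) ` K)"
        using True assms by (intro compact_continuous_image continuous_intros)
      then have "bdd_above ((\<lambda>x. \<bar>f x\<bar>) ` K)"
        by (simp add: bounded_imp_bdd_above compact_imp_bounded)
      then have le: "\<bar>f x\<bar> \<le> B f" if "x \<in> K" for x
        using True that unfolding B_def by (auto intro: cSUP_upper)
      have "L f \<le> L (\<lambda>x. B f)" "L (\<lambda>x. - B f) \<le> L f"
        using le by (auto intro!: state_mono[OF L] True simp: abs_le_iff minus_le_iff)
      then show ?thesis
        by (simp add: state_const[OF L])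
    next
      case False
      then show ?thesis
        using L by (simp add: B_def state_discontinuous)
    qed
    then show "L \<in> PiE UNIV (\<lambda>f. {- B f..B f})"
      by auto
  qed
  then have "states K = PiE UNIV (\<lambda>f. {- B f..B f}) \<inter> states K"
    by blast
  moreover have "compact (PiE UNIV (\<lambda>f. {- B f..B f}))"
    by (intro compact_PiE_UNIV compact_Icc)
  ultimately show ?thesis
    by (metis closed_states compact_Int_closed)
qed

text \<open>Push-forward of a measure along \<open>R g\<close> in dual form; the case distinction
  keeps the value 0 at discontinuous functions.\<close>

definition push :: "'c::topological_space set \<Rightarrow> ('g \<Rightarrow> 'c \<Rightarrow> 'c) \<Rightarrow> 'g \<Rightarrow> 'c functional \<Rightarrow> ('c \<Rightarrow> real) \<Rightarrow> real"
  where "push K R g L f = (if continuous_on K f then L (\<lambda>x. f (R g x)) else 0)"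

definition push_closed :: "'c::topological_space set \<Rightarrow> ('g \<Rightarrow> 'c \<Rightarrow> 'c) \<Rightarrow> 'c functional set \<Rightarrow> bool" where
  "push_closed K R \<Q> \<longleftrightarrow> (\<forall>g. \<forall>L\<in>\<Q>. push K R g L \<in> \<Q>)"

lemma tds_compose_continuous:
  assumes "tds K R" "continuous_on K f"
  shows "continuous_on K (\<lambda>x. f (R g x))"
  using assms tds_mem[OF assms(1)] tds_cont[OF assms(1)] by (blast intro: continuous_on_compose2)

lemma push_states:
  assumes "tds K R" "L \<in> states K"
  shows "push K R g L \<in> states K"
  unfolding states_def
proof (intro CollectI conjI allI impI; (elim conjE)?)
  fix f f' :: "'a \<Rightarrow> real" and c :: real
  show "push K R g L f = 0" if "\<not> continuous_on K f"
    using that by (simp add: push_def)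
  show "push K R g L (\<lambda>x. f x + f' x) = push K R g L f + push K R g L f'"
    if "continuous_on K f" "continuous_on K f'"
    using that state_add[OF assms(2) that[THEN tds_compose_continuous[OF assms(1)]]]
    by (simp add: push_def continuous_on_add)
  show "push K R g L (\<lambda>x. c * f x) = c * push K R g L f" if "continuous_on K f"
    using that state_scale[OF assms(2) that[THEN tds_compose_continuous[OF assms(1)]]]
    by (simp add: push_def continuous_on_mult)
  show "0 \<le> push K R g L f" if "continuous_on K f" "\<forall>x\<in>K. 0 \<le> f x"
    using that state_nonneg[OF assms(2) tds_compose_continuous[OF assms(1) that(1)]] tds_mem[OF assms(1)]
    by (simp add: push_def)
  show "push K R g L (\<lambda>x. 1) = 1"
    using state_one[OF assms(2)] by (simp add: push_def)
qed

lemma push_push: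
  assumes "tds K R" "L \<in> states K"
  shows "push K R g (push K R h L) = push K R (g + h) L"
proof
  fix f
  show "push K R g (push K R h L) f = push K R (g + h) L f"
    using tds_compose_continuous[OF assms(1)] tds_add[OF assms(1)]
    by (auto simp: push_def intro!: state_cong[OF assms(2)])
qed

lemma push_zero:
  assumes "tds K R" "L \<in> states K"
  shows "push K R 0 L = L"
proof
  fix f
  show "push K R 0 L f = L f"
    using tds_zero[OF assms(1)] assms(2)
    by (auto simp: push_def state_discontinuous intro!: state_cong[OF assms(2)])
qed

lemma continuous_push: "continuous_on UNIV (push K R g)"
proof (rule continuous_on_coordinatewise_then_product)
  fix f
  show "continuous_on UNIV (\<lambda>L. push K R g L f)"
    by (cases "continuous_on K f") (simp_all add: push_def)
qed

section \<open>The mass a state gives to a closed set\<close>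

definition majorants :: "'c::topological_space set \<Rightarrow> 'c set \<Rightarrow> ('c \<Rightarrow> real) set" where
  "majorants K C = {f. continuous_on K f \<and> (\<forall>x\<in>K. 0 \<le> f x) \<and> (\<forall>x\<in>C. 1 \<le> f x)}"

text \<open>For a closed subset \<open>C\<close> of a compact metric \<open>K\<close> this is the
  measure of \<open>C\<close> under the measure representing \<open>L\<close>. As an infimum of
  evaluations it is upper semicontinuous in \<open>L\<close>.\<close>

definition outer :: "'c::topological_space set \<Rightarrow> 'c functional \<Rightarrow> 'c set \<Rightarrow> real" where
  "outer K L C = Inf (L ` majorants K C)"

lemma outer_le:
  assumes "L \<in> states K" "f \<in> majorants K C"
  shows "outer K L C \<le> L f"
proof -
  have "bdd_below (L ` majorants K C)"
    using state_nonneg[OF assms(1)] by (intro bdd_belowI[of _ 0]) (auto simp: majorants_def)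
  then show ?thesis
    using assms(2) unfolding outer_def by (auto intro: cINF_lower)
qed

lemma one_majorant: "(\<lambda>x. 1) \<in> majorants K C"
  by (simp add: majorants_def)

lemma outer_ge:
  assumes "\<And>f. f \<in> majorants K C \<Longrightarrow> t \<le> L f"
  shows "t \<le> outer K L C"
  using assms one_majorant unfolding outer_def by (intro cINF_greatest) blast+

lemma outer_less:
  assumes "outer K L C < t"
  obtains f where "f \<in> majorants K C" "L f < t"
  using assms outer_ge[of K C t L] by (meson leI linorder_not_le)

lemma outer_mono:
  assumes "L \<in> states K" "C \<subseteq> C'"
  shows "outer K L C \<le> outer K L C'"
  using assms by (intro outer_ge outer_le) (auto simp: majorants_def)

lemma outer_bounds:
  assumes "L \<in> states K"
  shows "0 \<le> outer K L C" "outer K L C \<le> 1"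
proof -
  show "0 \<le> outer K L C"
    using state_nonneg[OF assms] by (intro outer_ge) (auto simp: majorants_def)
  show "outer K L C \<le> 1"
    using outer_le[OF assms one_majorant] state_one[OF assms] by simp
qed

text \<open>The maximum of two majorants serves the union, their minimum the intersection, and both
  pairs have the same sum. This is the source of the triangle inequality for the pseudometric
  \<open>D\<close> in \<open>section_bump_zero\<close>.\<close>

lemma outer_submodular:
  assumes L: "L \<in> states K"
  shows "outer K L (C \<union> C') + outer K L (C \<inter> C') \<le> outer K L C + outer K L C'"
proof (rule field_le_epsilon)
  fix e :: real
  assume "e > 0"
  then obtain f where f: "f \<in> majorants K C" "L f < outer K L C + e / 2"
    using outer_less[of K L C "outer K L C + e / 2"] by auto
  obtain f' where f': "f' \<in> majorants K C'" "L f' < outer K L C' + e / 2"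
    using outer_less[of K L C' "outer K L C' + e / 2"] \<open>e > 0\<close> by auto
  have c: "continuous_on K f" "continuous_on K f'"
    using f(1) f'(1) by (auto simp: majorants_def)
  have cm: "continuous_on K (\<lambda>x. max (f x) (f' x))" "continuous_on K (\<lambda>x. min (f x) (f' x))"
    by (intro continuous_intros c)+
  have "outer K L (C \<union> C') \<le> L (\<lambda>x. max (f x) (f' x))"
    using f(1) f'(1) cm by (intro outer_le[OF L]) (auto simp: majorants_def le_max_iff_disj)
  moreover have "outer K L (C \<inter> C') \<le> L (\<lambda>x. min (f x) (f' x))"
    using f(1) f'(1) cm by (intro outer_le[OF L]) (auto simp: majorants_def)
  moreover have "L (\<lambda>x. max (f x) (f' x)) + L (\<lambda>x. min (f x) (f' x)) = L f + L f'"
  proof -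
    have "(\<lambda>x. max (f x) (f' x) + min (f x) (f' x)) = (\<lambda>x. f x + f' x)"
      by (auto simp: max_def min_def)
    then show ?thesis
      using state_add[OF L cm] state_add[OF L c] by simp
  qed
  ultimately show "outer K L (C \<union> C') + outer K L (C \<inter> C') \<le> outer K L C + outer K L C' + e"
    using f(2) f'(2) by simp
qed

lemma outer_push_le:
  assumes K: "tds K R" and L: "L \<in> states K" and C: "C \<subseteq> K" "\<And>x. x \<in> C \<Longrightarrow> R g x \<in> C'"
  shows "outer K L C \<le> outer K (push K R g L) C'"
proof (rule outer_ge)
  fix f assume f: "f \<in> majorants K C'"
  then have cf: "continuous_on K f"
    by (simp add: majorants_def)
  have "(\<lambda>x. f (R g x)) \<in> majorants K C"
    using f C tds_compose_continuous[OF K] tds_mem[OF K] by (auto simp: majorants_def)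
  then show "outer K L C \<le> push K R g L f"
    using outer_le[OF L] cf by (simp add: push_def)
qed

text \<open>Subtracting \<open>b\<close> from a majorant \<open>f\<close> of the union leaves a
  majorant of \<open>C'\<close>: the difference is nonnegative because \<open>b\<close> is positive
  only on \<open>C\<close>, where \<open>f\<close> is at least 1, and on \<open>C'\<close> nothing
  is lost.\<close>

lemma outer_bump:
  assumes L: "L \<in> states K" and b: "continuous_on K b" "\<And>x. x \<in> K \<Longrightarrow> b x \<le> 1"
    "\<And>x. x \<in> K \<Longrightarrow> 0 < b x \<Longrightarrow> x \<in> C" and C: "C \<subseteq> K" "C' \<subseteq> K" "\<And>x. x \<in> C' \<Longrightarrow> b x \<le> 0"
  shows "outer K L C' + L b \<le> outer K L (C \<union> C')"
proof (rule outer_ge)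
  fix f assume f: "f \<in> majorants K (C \<union> C')"
  then have cf: "continuous_on K f"
    by (simp add: majorants_def)
  have "0 \<le> f x - b x" if "x \<in> K" for x
    using f b(2)[OF that] b(3)[OF that] that by (cases "0 < b x") (force simp: majorants_def)+
  moreover have "1 \<le> f x - b x" if "x \<in> C'" for x
    using f C(3)[OF that] that by (force simp: majorants_def)
  ultimately have "(\<lambda>x. f x - b x) \<in> majorants K C'"
    using cf b(1) by (auto simp: majorants_def intro!: continuous_intros)
  then have "outer K L C' \<le> L (\<lambda>x. f x - b x)"
    by (rule outer_le[OF L])
  then show "outer K L C' + L b \<le> L f"
    using state_diff[OF L cf b(1)] by simp
qed

text \<open>The last clause is minimality of the product system \<open>\<Xi> \<times> X\<close>. An
  invariant measure on \<open>K\<close> is the case of a singleton \<open>\<Xi>\<close>, where the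
  clause becomes minimality of \<open>X\<close>.\<close>

definition joint_minimal ::
  "'c::topological_space set \<Rightarrow> ('g \<Rightarrow> 'c \<Rightarrow> 'c) \<Rightarrow> 'a::topological_space set \<Rightarrow> ('g \<Rightarrow> 'a \<Rightarrow> 'a)
    \<Rightarrow> 'c functional set \<Rightarrow> bool" where
  "joint_minimal K R X T \<Xi> \<longleftrightarrow> \<Xi> \<noteq> {} \<and> closed \<Xi> \<and> \<Xi> \<subseteq> states K \<and> (\<forall>g. \<forall>L\<in>\<Xi>. push K R g L \<in> \<Xi>) \<and>
     (\<forall>\<Omega>. closed \<Omega> \<and> \<Omega> \<subseteq> \<Xi> \<times> X \<and> \<Omega> \<noteq> {} \<and> (\<forall>g. \<forall>(L, a)\<in>\<Omega>. (push K R g L, T g a) \<in> \<Omega>) \<longrightarrow> \<Omega> = \<Xi> \<times> X)"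

text \<open>The mass of the sections of \<^term>\<open>F\<close> is upper semicontinuous and invariant, hence constant on
\<open>\<Xi> \<times> X\<close>. So the mass of the union of two sections defines an invariant continuous pseudometric,
which vanishes on the fibres of \<^term>\<open>p\<close> by maximality.\<close>

lemma section_bump_zero:
  fixes X :: "'a::metric_space set" and K :: "'c::metric_space set"
  assumes X: "tds X T" "minimal_sys X T" and max: "max_eq_factor X T Y S p" and K: "tds K R"
    and \<Xi>: "joint_minimal K R X T \<Xi>"
    and F: "closed F" "F \<subseteq> K \<times> X" "\<And>g x a. (x, a) \<in> F \<Longrightarrow> (R g x, T g a) \<in> F"
    and ab: "a1 \<in> X" "a2 \<in> X" "p a1 = p a2"
    and b: "continuous_on K b" "\<And>x. x \<in> K \<Longrightarrow> b x \<le> 1"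
    "\<And>x. x \<in> K \<Longrightarrow> 0 < b x \<Longrightarrow> (x, a1) \<in> F \<and> (x, a2) \<notin> F"
    and L: "L \<in> \<Xi>"
  shows "L b \<le> 0"
proof -
  have cX: "compact X" and cK: "compact K" and X0: "X \<noteq> {}"
    using X K by (auto simp: tds_compact minimal_sys_def)
  have \<Xi>0: "\<Xi> \<noteq> {}" "compact \<Xi>"
    using \<Xi> compact_Int_closed[OF compact_states[OF cK], of \<Xi>]
    by (auto simp: joint_minimal_def Int_absorb1)
  have \<Xi>s: "\<And>L. L \<in> \<Xi> \<Longrightarrow> L \<in> states K"
    and \<Xi>p: "\<And>g L. L \<in> \<Xi> \<Longrightarrow> push K R g L \<in> \<Xi>"
    and \<Xi>m: "\<And>\<Omega>. closed \<Omega> \<Longrightarrow> \<Omega> \<subseteq> \<Xi> \<times> X \<Longrightarrow> \<Omega> \<noteq> {} \<Longrightarrow>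
       (\<And>g L a. (L, a) \<in> \<Omega> \<Longrightarrow> (push K R g L, T g a) \<in> \<Omega>) \<Longrightarrow> \<Omega> = \<Xi> \<times> X"
    using \<Xi> unfolding joint_minimal_def by (auto; blast)+
  define sec where "sec a = {x. (x, a) \<in> F}" for a
  have secK: "sec a \<subseteq> K" for a
    using F(2) by (auto simp: sec_def)
  have sec_inv: "R g x \<in> sec (T g a)" if "x \<in> sec a" for g x a
    using F(3) that by (auto simp: sec_def)
  have sec_inv': "x \<in> K" "R (- g) x \<in> sec a" if "x \<in> sec (T g a)" "a \<in> X" for g x a
    using that F(2) F(3)[of x "T g a" "- g"] tds_cancel[OF X(1) \<open>a \<in> X\<close>] by (auto simp: sec_def)
  have closed_near: "closed {a \<in> X. \<exists>x\<in>K. (x, a) \<in> F \<and> f x \<le> s}" if f: "continuous_on K f" for f :: "'c \<Rightarrow> real" and s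
  proof -
    have "compact (F \<inter> (K \<times> X))"
      using F(1) cK cX by (metis closed_Int_compact compact_Times)
    moreover have "continuous_on (F \<inter> (K \<times> X)) (\<lambda>w. f (fst w))"
      by (intro continuous_on_compose2[OF f] continuous_intros) auto
    ultimately have "compact ((F \<inter> (K \<times> X)) \<inter> (\<lambda>w. f (fst w)) -` {..s})"
      by (intro compact_preimage) auto
    then have "compact (snd ` ((F \<inter> (K \<times> X)) \<inter> (\<lambda>w. f (fst w)) -` {..s}))"
      by (intro compact_continuous_image continuous_intros)
    moreover have "snd ` ((F \<inter> (K \<times> X)) \<inter> (\<lambda>w. f (fst w)) -` {..s}) = {a \<in> X. \<exists>x\<in>K. (x, a) \<in> F \<and> f x \<le> s}"
      by force
    ultimately show ?thesis
      by (simp add: compact_imp_closed)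
  qed
  have push_le: "outer K L (sec a \<union> sec a') \<le> outer K (push K R g L) (sec (T g a) \<union> sec (T g a'))"
    if "L \<in> \<Xi>" for L g a a'
    using secK sec_inv by (intro outer_push_le[OF K \<Xi>s[OF that]]) auto

  \<comment> \<open>These superlevel sets of the mass are closed and invariant, so each of them is
    empty or everything; hence the mass is constant.\<close>
  define \<Omega> where "\<Omega> t = {(L, a). L \<in> \<Xi> \<and> a \<in> X \<and> t \<le> outer K L (sec a)}" for t
  have \<Omega>_closed: "closed (\<Omega> t)" for t
  proof -
    \<comment> \<open>The bound on the mass as a family of closed conditions: for every continuous
      \<open>f \<ge> 0\<close> and every \<open>e > 0\<close>, either \<open>f + e\<close> has value
      at least \<open>t\<close>, or the section contains a point where \<open>f \<le> 1 - e\<close>.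
      The set \<open>majorants K {}\<close> is just the set of nonnegative continuous
      functions.\<close>
    define G where "G f e = {(L, a). t \<le> L f + e} \<union>
      (\<Xi> \<times> {a \<in> X. \<exists>x\<in>K. (x, a) \<in> F \<and> f x \<le> 1 - e})" for f e
    have eq: "\<Omega> t = (\<Xi> \<times> X) \<inter> (\<Inter>f\<in>majorants K {}. \<Inter>e\<in>{0<..}. G f e)" (is "_ = ?R")
    proof (intro equalityI subsetI)
      fix w assume "w \<in> \<Omega> t"
      then obtain L a where w: "w = (L, a)" "L \<in> \<Xi>" "a \<in> X" "t \<le> outer K L (sec a)"
        by (auto simp: \<Omega>_def)
      have "(L, a) \<in> G f e" if "f \<in> majorants K {}" "e > 0" for f e
      proof (cases "\<exists>x\<in>K. (x, a) \<in> F \<and> f x \<le> 1 - e")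
        case False
        then have "(\<lambda>x. f x + e) \<in> majorants K (sec a)"
          using that secK[of a] by (force simp: majorants_def sec_def intro!: continuous_intros)
        from outer_le[OF \<Xi>s[OF w(2)] this] have "t \<le> L f + e"
          using w(4) state_add_const[OF \<Xi>s[OF w(2)]] that by (simp add: majorants_def)
        then show ?thesis by (simp add: G_def)
      qed (use w in \<open>simp add: G_def\<close>)
      then show "w \<in> ?R"
        using w by auto
    next
      fix w assume "w \<in> ?R"
      then obtain L a where w: "w = (L, a)" "L \<in> \<Xi>" "a \<in> X"
        "\<And>f e. f \<in> majorants K {} \<Longrightarrow> e > 0 \<Longrightarrow> (L, a) \<in> G f e"
        by auto
      have "t \<le> L f" if f: "f \<in> majorants K (sec a)" for f
      proof (rule field_le_epsilon)
        fix e :: real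
        assume "e > 0"
        have "f \<in> majorants K {}"
          using f by (simp add: majorants_def)
        then have "(L, a) \<in> G f e"
          using w(4) \<open>e > 0\<close> by blast
        moreover have "\<not> (\<exists>x\<in>K. (x, a) \<in> F \<and> f x \<le> 1 - e)"
          using f \<open>e > 0\<close> by (force simp: majorants_def sec_def)
        ultimately show "t \<le> L f + e"
          by (simp add: G_def)
      qed
      then have "t \<le> outer K L (sec a)"
        by (rule outer_ge)
      then show "w \<in> \<Omega> t"
        using w(1-3) by (simp add: \<Omega>_def)
    qed
    have c1: "closed {(L, a :: 'a). t \<le> L f + e}" for f :: "'c \<Rightarrow> real" and e
    proof -
      have "continuous_on UNIV (\<lambda>w :: 'c functional \<times> 'a. fst w f)"
        by (rule continuous_on_product_then_coordinatewise[OF continuous_on_fst[OF continuous_on_id]])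
      then have "closed {w :: 'c functional \<times> 'a. t \<le> fst w f + e}"
        by (rule closed_Collect_le[OF continuous_on_const continuous_on_add[OF _ continuous_on_const]])
      then show ?thesis
        by (simp add: case_prod_beta')
    qed
    have c\<Xi>: "closed \<Xi>"
      using \<Xi> by (simp add: joint_minimal_def)
    have "closed (G f e)" if "f \<in> majorants K {}" for f e
      unfolding G_def using that closed_near
      by (intro closed_Un c1 closed_Times c\<Xi>) (auto simp: majorants_def)
    then show ?thesis
      unfolding eq by (intro closed_Int closed_INT ballI closed_Times c\<Xi> compact_imp_closed[OF cX])
  qed
  have \<Omega>_inv: "(push K R g L, T g a) \<in> \<Omega> t" if "(L, a) \<in> \<Omega> t" for g L a t
    using that push_le[of L a a g] \<Xi>p tds_mem[OF X(1)] by (force simp: \<Omega>_def)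
  obtain L0 a0 where "L0 \<in> \<Xi>" "a0 \<in> X"
    using \<Xi>0 X0 by blast
  define c where "c = outer K L0 (sec a0)"
  have \<Omega>_all: "t \<le> outer K L a" if "L0' \<in> \<Xi>" "a0' \<in> X" "t \<le> outer K L0' (sec a0')" "L \<in> \<Xi>" "a' \<in> X" "a = sec a'"
    for L a t L0' a0' a'
  proof -
    have "\<Omega> t = \<Xi> \<times> X"
      using that by (intro \<Xi>m \<Omega>_closed \<Omega>_inv) (auto simp: \<Omega>_def)
    then show ?thesis
      using that by (auto simp: \<Omega>_def)
  qed
  have const: "outer K L (sec a) = c" if "L \<in> \<Xi>" "a \<in> X" for L a
    unfolding c_def
    using \<Omega>_all[OF that order_refl \<open>L0 \<in> \<Xi>\<close> \<open>a0 \<in> X\<close> refl]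
      \<Omega>_all[OF \<open>L0 \<in> \<Xi>\<close> \<open>a0 \<in> X\<close> order_refl that refl] by (rule antisym)

  \<comment> \<open>For one measure this is half the measure of the symmetric difference of the two
    sections, as all sections have mass \<open>c\<close>. The supremum over the invariant set
    \<open>\<Xi>\<close> makes it invariant.\<close>
  define D where "D a a' = (SUP L\<in>\<Xi>. outer K L (sec a \<union> sec a')) - c" for a a'
  have bdd: "bdd_above ((\<lambda>L. outer K L (sec a \<union> sec a')) ` \<Xi>)" for a a'
    using outer_bounds(2)[OF \<Xi>s] by (intro bdd_aboveI[of _ 1]) auto
  have D_le: "D a a' \<le> r" if "\<And>L. L \<in> \<Xi> \<Longrightarrow> outer K L (sec a \<union> sec a') \<le> c + r" for a a' r
  proof -
    have "(SUP L\<in>\<Xi>. outer K L (sec a \<union> sec a')) \<le> c + r"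
      using \<Xi>0(1) that by (intro cSUP_least)
    then show ?thesis
      by (simp add: D_def)
  qed
  have D_ge: "outer K L (sec a \<union> sec a') \<le> c + D a a'" if "L \<in> \<Xi>" for L a a'
    using cSUP_upper[OF that bdd] by (simp add: D_def)
  have "D a1 a2 = 0"
  proof (rule invariant_pseudometric_zero[OF X(1) X0 max _ _ _ _ _ ab, where D = D])
    show "D a a = 0" if "a \<in> X" for a
    proof (rule antisym)
      show "D a a \<le> 0"
        using const that by (intro D_le) auto
      show "0 \<le> D a a"
        using D_ge[OF \<open>L0 \<in> \<Xi>\<close>, of a a] const[OF \<open>L0 \<in> \<Xi>\<close> that] by simp
    qed
    show "D a a' = D a' a" for a a'
      by (simp add: D_def Un_commute)
    show "D x z \<le> D x y + D y z" if "x \<in> X" "y \<in> X" "z \<in> X" for x y z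
    proof (rule D_le)
      fix L assume L: "L \<in> \<Xi>"
      have "outer K L (sec x \<union> sec z) \<le> outer K L ((sec x \<union> sec y) \<union> (sec y \<union> sec z))"
        by (intro outer_mono \<Xi>s[OF L]) auto
      \<comment> \<open>Both unions contain the section over \<open>y\<close>. This pays for the
        second \<open>c\<close> that arises when the two bounds by \<open>D\<close> are
        added.\<close>
      moreover have "c \<le> outer K L ((sec x \<union> sec y) \<inter> (sec y \<union> sec z))"
        unfolding const[OF L that(2), symmetric] by (intro outer_mono \<Xi>s[OF L]) auto
      ultimately show "outer K L (sec x \<union> sec z) \<le> c + (D x y + D y z)"
        using outer_submodular[OF \<Xi>s[OF L], of "sec x \<union> sec y" "sec y \<union> sec z"]
          D_ge[OF L, of x y] D_ge[OF L, of y z] by linarith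
    qed
    have le: "D x y \<le> D (T g x) (T g y)" for x y g
    proof (rule D_le)
      fix L assume "L \<in> \<Xi>"
      then show "outer K L (sec x \<union> sec y) \<le> c + D (T g x) (T g y)"
        using push_le[of L x y g] D_ge[OF \<Xi>p, of L g "T g x" "T g y"] by linarith
    qed
    show "D (T g x) (T g y) = D x y" if "x \<in> X" "y \<in> X" for x y g
      using le[of x y g] le[of "T g x" "T g y" "- g"] tds_cancel[OF X(1)] that by simp
    show "\<exists>d>0. \<forall>y\<in>X. dist x y < d \<longrightarrow> D x y < r" if x: "x \<in> X" and r: "r > 0" for x r
    proof -
      \<comment> \<open>Finitely many majorants of the section over \<open>x\<close> serve all of
        \<open>\<Xi>\<close>. For \<open>y\<close> near \<open>x\<close> the section over
        \<open>y\<close> avoids the closed sets where they are at most \<open>1 - r / 3\<close>, so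
        adding \<open>r / 3\<close> makes them majorants of the union, within
        \<open>2 * r / 3\<close> of \<open>c\<close>.\<close>
      define V where "V f = {L. L f < c + r / 3}" for f :: "'c \<Rightarrow> real"
      have "open (V f)" for f
        unfolding V_def by (intro open_Collect_less continuous_intros continuous_on_product_coordinates)
      moreover have "\<Xi> \<subseteq> (\<Union>f\<in>majorants K (sec x). V f)"
      proof
        fix L assume L: "L \<in> \<Xi>"
        then have "outer K L (sec x) < c + r / 3"
          using const x r by simp
        then show "L \<in> (\<Union>f\<in>majorants K (sec x). V f)"
          using outer_less by (force simp: V_def)
      qed
      ultimately obtain M where M: "M \<subseteq> majorants K (sec x)" "finite M" "\<Xi> \<subseteq> (\<Union>f\<in>M. V f)"
        using compactE_image[OF \<Xi>0(2)] by metis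
      define Bad where "Bad = (\<Union>f\<in>M. {a \<in> X. \<exists>x\<in>K. (x, a) \<in> F \<and> f x \<le> 1 - r / 3})"
      have "closed Bad"
        unfolding Bad_def using M closed_near by (intro closed_UN) (auto simp: majorants_def)
      moreover have "x \<notin> Bad"
        using M(1) r by (force simp: Bad_def majorants_def sec_def)
      ultimately obtain d where d: "d > 0" "ball x d \<subseteq> - Bad"
        by (metis ComplI open_Compl open_contains_ball)
      have "D x y < r" if y: "y \<in> X" "dist x y < d" for y
      proof -
        have yB: "y \<notin> Bad"
          using d(2) y(2) by auto
        have "D x y \<le> 2 * r / 3"
        proof (rule D_le)
          fix L assume L: "L \<in> \<Xi>"
          then obtain f where f: "f \<in> M" "L f < c + r / 3"
            using M(3) by (auto simp: V_def)
          then have fm: "f \<in> majorants K (sec x)"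
            using M(1) by blast
          have "1 \<le> f z + r / 3" if "z \<in> sec y" for z
            using yB f(1) that y(1) secK by (force simp: Bad_def sec_def)
          moreover have "1 \<le> f z + r / 3" if "z \<in> sec x" for z
            using fm that r by (force simp: majorants_def)
          ultimately have "(\<lambda>z. f z + r / 3) \<in> majorants K (sec x \<union> sec y)"
            using fm r by (auto simp: majorants_def intro!: continuous_intros)
          from outer_le[OF \<Xi>s[OF L] this] show "outer K L (sec x \<union> sec y) \<le> c + 2 * r / 3"
            using state_add_const[OF \<Xi>s[OF L], of f "r / 3"] fm f(2) by (simp add: majorants_def)
        qed
        then show ?thesis
          using r by simp
      qed
      then show ?thesis
        using d(1) by blast
    qed
  qed
  then have "outer K L (sec a1 \<union> sec a2) \<le> c"
    using D_ge[OF L, of a1 a2] by simp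
  moreover have "outer K L (sec a2) + L b \<le> outer K L (sec a1 \<union> sec a2)"
    using b secK by (intro outer_bump[OF \<Xi>s[OF L]]) (force simp: sec_def not_less)+
  ultimately show ?thesis
    using const[OF L ab(2)] by simp
qed

section \<open>Mixing relative to the equicontinuous factor\<close>

abbreviation tuples :: "'a set \<Rightarrow> nat \<Rightarrow> (nat \<Rightarrow> 'a) set" where
  "tuples X n \<equiv> PiE {..<n} (\<lambda>_. X)"

lemma compact_tuples:
  fixes X :: "'a::topological_space set"
  assumes "compact X"
  shows "compact (tuples X N)"
proof -
  have "x \<in> tuples X N \<longleftrightarrow> (\<forall>i. (i < N \<longrightarrow> x i \<in> X) \<and> (\<not> i < N \<longrightarrow> x i = undefined))" for x
    by (auto simp: PiE_iff extensional_def)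
  moreover have "x i \<in> (if i < N then X else {undefined}) \<longleftrightarrow>
      (i < N \<longrightarrow> x i \<in> X) \<and> (\<not> i < N \<longrightarrow> x i = undefined)" for x i
    by simp
  ultimately have "tuples X N = PiE UNIV (\<lambda>i. if i < N then X else {undefined})"
    by (intro set_eqI) (simp only: PiE_iff UNIV_I ball_UNIV extensional_UNIV simp_thms)
  then show ?thesis
    using assms by (simp add: compact_PiE_UNIV)
qed

lemma tuple_act_continuous:
  assumes "continuous_on X (T g)"
  shows "continuous_on (tuples X N) (tuple_act N T g)"
proof (rule continuous_on_coordinatewise_then_product)
  fix i
  show "continuous_on (tuples X N) (\<lambda>x. tuple_act N T g x i)"
  proof (cases "i < N")
    case True
    have "continuous_on (tuples X N) (\<lambda>x. T g (x i))"
      using True by (intro continuous_on_compose2[OF assms]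
          continuous_on_product_then_coordinatewise[OF continuous_on_id]) auto
    then show ?thesis
      using True by (simp add: tuple_act_def)
  qed (simp add: tuple_act_def)
qed

lemma tds_tuples:
  fixes X :: "'a::metric_space set" and T :: "'g::group_add \<Rightarrow> 'a \<Rightarrow> 'a"
  assumes "tds X T"
  shows "tds (tuples X N) (tuple_act N T)"
  unfolding tds_def
proof (intro conjI allI ballI)
  show "compact (tuples X N)"
    by (rule compact_tuples[OF tds_compact[OF assms]])
  show "continuous_on (tuples X N) (tuple_act N T g)" for g
    by (rule tuple_act_continuous[OF tds_cont[OF assms]])
  show "tuple_act N T g ` tuples X N \<subseteq> tuples X N" for g
    using tds_mem[OF assms] by (auto simp: tuple_act_def PiE_iff)
  show "tuple_act N T 0 x = x" if "x \<in> tuples X N" for x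
    using that tds_zero[OF assms] by (auto simp: tuple_act_def PiE_iff extensional_def fun_eq_iff)
  show "tuple_act N T (g + h) x = tuple_act N T g (tuple_act N T h x)"
    if "x \<in> tuples X N" for g h x
    using that tds_add[OF assms] by (auto simp: tuple_act_def PiE_iff fun_eq_iff)
qed

lemma tuple_act_upd:
  "i < N \<Longrightarrow> (tuple_act N T g x)(i := T g t) = tuple_act N T g (x(i := t))"
  by (auto simp: tuple_act_def)

lemma open_tuple_box:
  fixes U :: "nat \<Rightarrow> 'a::topological_space set"
  assumes "\<And>s. s < N \<Longrightarrow> open (U s)"
  shows "open {x. \<forall>s<N. x s \<in> U s}"
proof -
  have "{x. \<forall>s<N. x s \<in> U s} = PiE UNIV (\<lambda>s. if s < N then U s else UNIV)"
    by (auto simp: PiE_iff split: if_splits)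
  moreover have "finite {s. (if s < N then U s else UNIV) \<noteq> UNIV}"
    by (rule finite_subset[of _ "{..<N}"]) (auto split: if_splits)
  then have "open (PiE UNIV (\<lambda>s. if s < N then U s else UNIV))"
    using assms by (intro open_PiE) auto
  ultimately show ?thesis
    by simp
qed

lemma continuous_on_fun_upd:
  fixes a :: "'b::topological_space \<Rightarrow> 'a::topological_space"
  assumes "continuous_on S x" "continuous_on S a"
  shows "continuous_on S (\<lambda>w. (x w :: 'i \<Rightarrow> 'a)(i := a w))"
proof (rule continuous_on_coordinatewise_then_product)
  show "continuous_on S (\<lambda>w. ((x w)(i := a w)) j)" for j
    using assms continuous_on_product_then_coordinatewise[OF assms(1), of j] by (cases "j = i") auto
qed

text \<open>Every open \<open>V\<close> that meets the tuple space has to be charged by a state to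
  which \<open>section_bump_zero\<close> applies. \<open>K\<close> may depend on \<open>V\<close>:
  it is the whole tuple space for product states, and the orbit closure of a minimal tuple in
  \<open>V\<close> for incontractible systems.\<close>

definition bump_supply ::
  "'a::metric_space set \<Rightarrow> ('g::group_add \<Rightarrow> 'a \<Rightarrow> 'a) \<Rightarrow> nat \<Rightarrow> bool" where
  "bump_supply X T N \<longleftrightarrow> (\<forall>V. open V \<and> V \<inter> tuples X N \<noteq> {} \<longrightarrow>
     (\<exists>K \<Xi>. K \<subseteq> tuples X N \<and> tds K (tuple_act N T) \<and>
        joint_minimal K (tuple_act N T) X T \<Xi> \<and>
        (\<forall>b. continuous_on (tuples X N) b \<and>
             (\<forall>x\<in>tuples X N. 0 \<le> b x) \<and> (\<forall>x\<in>V \<inter> tuples X N. 0 < b x) \<longrightarrow>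
             (\<exists>L\<in>\<Xi>. 0 < L b))))"

lemma ex_bump:
  fixes P :: "'c::metric_space set"
  assumes "closed P" "open V"
  obtains b :: "'c \<Rightarrow> real" where "continuous_on P b" "\<And>x. 0 \<le> b x" "\<And>x. b x \<le> 1"
    "\<And>x. x \<in> P \<Longrightarrow> 0 < b x \<longleftrightarrow> x \<in> V"
proof (cases "P \<subseteq> V")
  case True
  then show ?thesis
    using that[of "\<lambda>_. 1"] by auto
next
  case False
  then have ne: "P - V \<noteq> {}" and cl: "closed (P - V)"
    using assms by auto
  show ?thesis
  proof (rule that[of "\<lambda>x. min 1 (infdist x (P - V))"])
    show "continuous_on P (\<lambda>x. min 1 (infdist x (P - V)))"
      by (intro continuous_intros)
    show "0 < min 1 (infdist x (P - V)) \<longleftrightarrow> x \<in> V" if "x \<in> P" for x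
      using that in_closed_iff_infdist_zero[OF cl ne, of x] infdist_nonneg[of x "P - V"] by auto
  qed (auto simp: infdist_nonneg)
qed

text \<open>The orbit closure \<open>closure E\<close> of a box is saturated with respect to \<^term>\<open>p\<close>, one coordinate
after the other: two sections over points with the same image under \<^term>\<open>p\<close> cannot be
distinguished by the states supplied by \<open>bump_supply\<close>.\<close>

lemma relative_mixing:
  fixes X :: "'a::metric_space set" and T :: "'g::group_add \<Rightarrow> 'a \<Rightarrow> 'a" and Q V :: "nat \<Rightarrow> 'a set"
  assumes X: "tds X T" "minimal_sys X T" and max: "max_eq_factor X T Y S p"
    and bumps: "bump_supply X T N"
    and Q: "\<And>s. s < N \<Longrightarrow> openin (top_of_set X) (Q s)"
    and V: "\<And>s. s < N \<Longrightarrow> openin (top_of_set X) (V s)"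
    and W: "\<And>s. s < N \<Longrightarrow> openin (top_of_set Y) (W s)" "\<And>s. s < N \<Longrightarrow> W s \<subseteq> p ` Q s"
    and v: "\<And>s. s < N \<Longrightarrow> v s \<in> V s" "\<And>s. s < N \<Longrightarrow> p (v s) \<in> W s"
  obtains g where "\<And>s. s < N \<Longrightarrow> \<exists>x\<in>Q s. T g x \<in> V s"
proof -
  define P where "P = tuples X N"
  define R where "R = tuple_act N T"
  have P: "tds P R"
    unfolding P_def R_def by (rule tds_tuples[OF X(1)])
  have clP: "closed P"
    using P compact_imp_closed tds_compact by blast
  have QX: "Q s \<subseteq> X" and VX: "V s \<subseteq> X" if "s < N" for s
    using Q V that openin_imp_subset by blast+
  have pc: "continuous_on X p" "p ` X = Y"
    using max by (auto simp: max_eq_factor_def factor_map_def)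
  define E where "E = (\<Union>g. R g ` PiE {..<N} Q)"
  have boxP: "PiE {..<N} Q \<subseteq> P"
    using QX by (fastforce simp: P_def PiE_iff)
  then have EP: "E \<subseteq> P"
    using tds_mem[OF P] by (auto simp: E_def)
  then have clEP: "closure E \<subseteq> P"
    using clP by (rule closure_minimal)
  have inv: "R g x \<in> closure E" if "x \<in> closure E" for g x
  proof -
    have "R g z \<in> E" if zE: "z \<in> E" for z
    proof -
      obtain h y where y: "y \<in> PiE {..<N} Q" "z = R h y"
        using zE by (auto simp: E_def)
      then have "R g z = R (g + h) y"
        using boxP tds_add[OF P] by blast
      then show ?thesis
        using y(1) by (auto simp: E_def)
    qed
    then have "R g ` E \<subseteq> E"
      by blast
    then have "R g ` closure E \<subseteq> closure E"
      using closure_subset[of E] continuous_on_subset[OF tds_cont[OF P] clEP]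
      by (intro image_closure_subset) auto
    then show ?thesis
      using that by blast
  qed
  \<comment> \<open>In the first \<open>i\<close> coordinates the box is already enlarged to full
    preimages under \<open>p\<close>, in the others it is still the original one.\<close>
  define B where "B i s = (if s < i then {t \<in> X. p t \<in> W s} else Q s)" for i s :: nat
  have B_open: "openin (top_of_set X) (B i s)" if "s < N" for i s
  proof -
    have "openin (top_of_set X) (X \<inter> p -` W s)"
      using pc W(1)[OF that] by (intro continuous_openin_preimage[of X p Y]) auto
    moreover have "X \<inter> p -` W s = {t \<in> X. p t \<in> W s}"
      by auto
    ultimately show ?thesis
      using Q[OF that] by (simp add: B_def)
  qed
  have BX: "B i s \<subseteq> X" if "s < N" for i s
    using B_open[OF that] openin_imp_subset by blast
  have "x \<in> closure E" if "i \<le> N" "x \<in> P" "\<And>s. s < N \<Longrightarrow> x s \<in> B i s" for i x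
    using that
  proof (induction i arbitrary: x)
    case 0
    then have "x \<in> PiE {..<N} Q"
      by (auto simp: B_def P_def PiE_iff)
    moreover have "R 0 x = x"
      using P 0(2) by (rule tds_zero)
    ultimately have "x \<in> R 0 ` PiE {..<N} Q"
      by (metis image_eqI)
    then have "x \<in> E"
      unfolding E_def by blast
    then show ?case
      using closure_subset by blast
  next
    case (Suc i)
    then have i: "i < N"
      by simp
    define a2 where "a2 = x i"
    have a2: "a2 \<in> X" "p a2 \<in> W i"
      using Suc.prems(3)[OF i] by (auto simp: B_def a2_def)
    then obtain a1 where a1: "a1 \<in> Q i" "p a1 = p a2"
      using W(2)[OF i] by (metis image_iff subsetD)
    then have a1X: "a1 \<in> X"
      using QX[OF i] by blast
    show ?case
    proof (rule ccontr)
      assume notin: "x \<notin> closure E"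
      have "\<forall>s. \<exists>U. s < N \<longrightarrow> open U \<and> B i s = X \<inter> U"
        using B_open unfolding openin_open by blast
      from choice[OF this] obtain U where U: "\<And>s. s < N \<Longrightarrow> open (U s) \<and> B i s = X \<inter> U s"
        by blast
      define O1 where "O1 = {z. \<forall>s<N. z s \<in> (if s = i then UNIV else U s)}"
      have "open O1"
        unfolding O1_def using U by (intro open_tuple_box) auto
      have "open {z :: nat \<Rightarrow> 'a. z(i := a2) \<in> - closure E}"
      proof -
        have "continuous_on UNIV (\<lambda>z :: nat \<Rightarrow> 'a. z(i := a2))"
          by (intro continuous_on_fun_upd continuous_intros)
        then have "open ((\<lambda>z :: nat \<Rightarrow> 'a. z(i := a2)) -` (- closure E))"
          by (intro open_vimage) auto
        then show ?thesis
          by (simp add: vimage_def)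
      qed
      \<comment> \<open>Here the coordinates other than \<open>i\<close> obey the constraints of the
        induction hypothesis, coordinate \<open>i\<close> is free, and inserting \<open>a2\<close>
        there gives a point outside \<open>closure E\<close>. As \<open>x i\<close> is
        \<open>a2\<close>, the set contains \<open>x\<close>.\<close>
      define O2 where "O2 = O1 \<inter> {z. z(i := a2) \<in> - closure E}"
      have "open O2"
        unfolding O2_def by (intro open_Int) fact+
      have "x s \<in> U s" if "s < N" "s \<noteq> i" for s
      proof -
        have "B (Suc i) s = B i s"
          using that by (auto simp: B_def)
        then show ?thesis
          using Suc.prems(3)[OF that(1)] U[OF that(1)] by auto
      qed
      moreover have "x(i := a2) = x"
        by (simp add: a2_def)
      ultimately have "x \<in> O2"
        using notin by (auto simp: O2_def O1_def)
      then have "O2 \<inter> P \<noteq> {}"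
        using Suc.prems(2) by blast
      then obtain K \<Xi> where K: "K \<subseteq> P" "tds K R" "joint_minimal K R X T \<Xi>"
        "\<And>b. continuous_on P b \<Longrightarrow> (\<And>x. x \<in> P \<Longrightarrow> 0 \<le> b x) \<Longrightarrow> (\<And>x. x \<in> O2 \<inter> P \<Longrightarrow> 0 < b x) \<Longrightarrow>
          \<exists>L\<in>\<Xi>. 0 < L b"
        using bumps \<open>open O2\<close> unfolding bump_supply_def P_def[symmetric] R_def[symmetric] by metis
      obtain b where b: "continuous_on P b" "\<And>x. 0 \<le> b x" "\<And>x. b x \<le> (1::real)"
        "\<And>x. x \<in> P \<Longrightarrow> 0 < b x \<longleftrightarrow> x \<in> O2"
        using ex_bump[OF clP \<open>open O2\<close>] by metis
      have "0 < b x" if "x \<in> O2 \<inter> P" for x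
        using b(4) that by blast
      then obtain L where L: "L \<in> \<Xi>" "0 < L b"
        using K(4)[OF b(1) b(2)] by blast
      \<comment> \<open>The section over \<open>a\<close> consists of the tuples that belong to
        \<open>closure E\<close> once their entry \<open>i\<close> is replaced by \<open>a\<close>.
        On \<open>K \<inter> O2\<close> this holds for \<open>a1\<close>, by the induction
        hypothesis and \<open>a1 \<in> Q i\<close>, but never for \<open>a2\<close>; so
        \<open>b\<close> lives in the difference of two sections over one fibre.\<close>
      define F where "F = (K \<times> X) \<inter> (\<lambda>w. (fst w)(i := snd w)) -` closure E"
      have clF: "closed F"
      proof -
        have "continuous_on (K \<times> X) (\<lambda>w. (fst w)(i := snd w))"
          by (intro continuous_on_fun_upd continuous_intros)
        moreover have "closed (K \<times> X)"
          using X(1) K(2) by (intro closed_Times compact_imp_closed tds_compact) auto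
        ultimately show ?thesis
          unfolding F_def by (intro continuous_closed_preimage) auto
      qed
      have "L b \<le> 0"
      proof (rule section_bump_zero[where b = b and L = L and ?a1.0 = a1 and ?a2.0 = a2, OF X max K(2,3) clF])
        show "F \<subseteq> K \<times> X"
          by (auto simp: F_def)
        show "(R g z, T g a) \<in> F" if "(z, a) \<in> F" for g z a
          using that inv[of "z(i := a)" g] tds_mem[OF K(2)] tds_mem[OF X(1)]
          by (auto simp: F_def tuple_act_upd[OF i] R_def)
        show "continuous_on K b"
          using b(1) K(1) by (rule continuous_on_subset)
        fix z assume z: "z \<in> K" "0 < b z"
        then have zP: "z \<in> P" and zO: "z \<in> O2"
          using K(1) b(4) by blast+
        have "z(i := a1) \<in> closure E"
        proof (rule Suc.IH)
          show "z(i := a1) \<in> P"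
            using zP a1X i by (auto simp: P_def PiE_iff extensional_def)
          show "(z(i := a1)) s \<in> B i s" if "s < N" for s
          proof (cases "s = i")
            case True
            then show ?thesis
              using a1(1) by (simp add: B_def)
          next
            case False
            then have "z s \<in> U s" "z s \<in> X"
              using zO zP that by (auto simp: O2_def O1_def P_def)
            then show ?thesis
              using U[OF that] False by simp
          qed
        qed (use i in simp)
        then show "(z, a1) \<in> F \<and> (z, a2) \<notin> F"
          using z(1) zO a1X by (auto simp: F_def O2_def)
      qed (use a1X a2(1) a1(2) b(3) L(1) in auto)
      then show False
        using L(2) by simp
    qed
  qed
  from this[of N "restrict v {..<N}"] have 1: "restrict v {..<N} \<in> closure E"
    using v VX by (force simp: P_def B_def)
  have "\<forall>s. \<exists>U. s < N \<longrightarrow> open U \<and> V s = X \<inter> U"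
    using V unfolding openin_open by blast
  from choice[OF this] obtain U where U: "\<And>s. s < N \<Longrightarrow> open (U s) \<and> V s = X \<inter> U s"
    by blast
  have "open {z. \<forall>s<N. z s \<in> U s}"
    using U by (intro open_tuple_box) auto
  moreover note 1
  moreover have "restrict v {..<N} \<in> {z. \<forall>s<N. z s \<in> U s}"
    using U v by auto
  ultimately have "{z. \<forall>s<N. z s \<in> U s} \<inter> E \<noteq> {}"
    by (metis (no_types, lifting) IntI empty_iff open_Int_closure_eq_empty)
  then obtain z where z: "z \<in> E" "\<And>s. s < N \<Longrightarrow> z s \<in> U s"
    by blast
  then obtain g x where gx: "z = R g x" "x \<in> PiE {..<N} Q"
    by (auto simp: E_def)
  have "\<exists>x\<in>Q s. T g x \<in> V s" if s: "s < N" for s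
  proof
    show xs: "x s \<in> Q s"
      using gx(2) s by auto
    have "T g (x s) = z s"
      using gx s by (simp add: R_def tuple_act_def)
    moreover have "T g (x s) \<in> X"
      using xs QX[OF s] tds_mem[OF X(1)] by blast
    ultimately show "T g (x s) \<in> V s"
      using z(2)[OF s] U[OF s] by auto
  qed
  then show ?thesis
    using that by blast
qed

section \<open>Product states of an invariant measure\<close>

text \<open>By minimality finitely many translates of \<open>b\<close> have a sum bounded below by a
  positive constant. \<open>L\<close> is positive at this sum, hence some push-forward of
  \<open>L\<close> is positive at \<open>b\<close>.\<close>

lemma push_closed_ex_pos:
  fixes K :: "'c::metric_space set"
  assumes K: "tds K R" "minimal_sys K R" and \<Xi>: "push_closed K R \<Xi>" "L \<in> \<Xi>" "L \<in> states K"
    and b: "continuous_on K b" "\<And>x. x \<in> K \<Longrightarrow> 0 \<le> b x" and z: "z \<in> K" "0 < b z"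
  obtains L' where "L' \<in> \<Xi>" "0 < L' b"
proof -
  obtain d where d: "d > 0" "\<And>x. x \<in> K \<Longrightarrow> dist x z < d \<Longrightarrow> dist (b x) (b z) < b z"
    using b(1) z unfolding continuous_on_iff by meson
  have pos: "0 < b x" if "x \<in> K" "dist x z < d" for x
    using d(2)[OF that] by (simp add: dist_real_def)
  obtain F where F: "finite F" "F \<noteq> {}" "\<And>x y. x \<in> K \<Longrightarrow> y \<in> K \<Longrightarrow> \<exists>k\<in>F. dist (R k x) y < d"
    using minimal_sys_finite_hits[OF K d(1)] by metis
  define h where "h x = (\<Sum>k\<in>F. b (R k x))" for x
  have ck: "continuous_on K (\<lambda>x. b (R k x))" for k
    by (rule tds_compose_continuous[OF K(1) b(1)])
  have ch: "continuous_on K h"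
    unfolding h_def by (intro continuous_on_sum ck)
  have hpos: "0 < h x" if x: "x \<in> K" for x
  proof -
    obtain k where k: "k \<in> F" "dist (R k x) z < d"
      using F(3)[OF x z(1)] by blast
    have "0 < b (R k x)"
      using pos k(2) tds_mem[OF K(1) x] by blast
    also have "\<dots> \<le> h x"
      unfolding h_def using b(2) tds_mem[OF K(1) x] F(1) k(1) by (intro member_le_sum) auto
    finally show ?thesis .
  qed
  obtain w where w: "w \<in> K" "\<And>x. x \<in> K \<Longrightarrow> h w \<le> h x"
    using continuous_attains_inf[OF tds_compact[OF K(1)] _ ch] z(1) by blast
  have "h w \<le> L h"
    using state_mono[OF \<Xi>(3) continuous_on_const ch, of "h w"] w(2) state_const[OF \<Xi>(3)] by simp
  then have "0 < L h"
    using hpos[OF w(1)] by simp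
  moreover have "L (\<lambda>x. \<Sum>k\<in>G. b (R k x)) = (\<Sum>k\<in>G. push K R k L b)" if "finite G" for G
    using that
  proof (induction G)
    case empty
    show ?case
      using state_const[OF \<Xi>(3), of 0] by simp
  next
    case (insert k G)
    have "L (\<lambda>x. b (R k x) + (\<Sum>k\<in>G. b (R k x))) = L (\<lambda>x. b (R k x)) + L (\<lambda>x. \<Sum>k\<in>G. b (R k x))"
      by (intro state_add[OF \<Xi>(3)] ck continuous_on_sum)
    then show ?case
      using insert b(1) by (simp add: push_def)
  qed
  ultimately have "0 < (\<Sum>k\<in>F. push K R k L b)"
    using F(1) by (simp add: h_def[abs_def])
  then obtain k where "0 < push K R k L b"
    by (meson not_less sum_nonpos)
  then show ?thesis
    using that \<Xi>(1,2) by (auto simp: push_closed_def)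
qed

lemma integral_state:
  assumes X: "compact X" and \<mu>: "inv_measure X T \<mu>"
  shows "(\<lambda>f. if continuous_on X f then \<integral>x. f x \<partial>\<mu> else 0) \<in> states X"
proof -
  interpret prob_space \<mu>
    using \<mu> by (simp add: inv_measure_def)
  have sp: "space \<mu> = X"
    using \<mu> by (simp add: inv_measure_def)
  note int = inv_measure_continuous_integrable[OF \<mu> X]
  show ?thesis
    unfolding states_def
    using sp by (auto simp: continuous_on_add continuous_on_mult int prob_space intro!: integral_nonneg_AE)
qed

text \<open>The state of an invariant measure forms a push-closed singleton, so
  \<open>push_closed_ex_pos\<close> can only return that state.\<close>

lemma inv_measure_integral_pos:
  fixes b :: "'a::metric_space \<Rightarrow> real"
  assumes X: "tds X T" "minimal_sys X T" and \<mu>: "inv_measure X T \<mu>"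
    and b: "continuous_on X b" "\<And>x. x \<in> X \<Longrightarrow> 0 \<le> b x" and t: "t \<in> X" "0 < b t"
  shows "0 < (\<integral>x. b x \<partial>\<mu>)"
proof -
  define L where "L f = (if continuous_on X f then \<integral>x. f x \<partial>\<mu> else 0)" for f :: "'a \<Rightarrow> real"
  have L: "L \<in> states X"
    unfolding L_def[abs_def] by (rule integral_state[OF tds_compact[OF X(1)] \<mu>])
  have "push X T g L = L" for g
    using inv_measure_integral_invariant[OF X(1) \<mu>] tds_compose_continuous[OF X(1)]
    by (auto simp: push_def L_def fun_eq_iff)
  then have "push_closed X T {L}"
    by (simp add: push_closed_def)
  then obtain L' where "L' \<in> {L}" "0 < L' b"
    using push_closed_ex_pos[OF X _ singletonI L b t] by metis
  then show ?thesis
    using b(1) by (simp add: L_def)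
qed

lemma state_parameter_continuous:
  fixes X :: "'a::metric_space set" and A :: "'b::metric_space set"
  assumes L: "L \<in> states X" and X: "compact X" and A: "compact A"
    and f: "continuous_on (A \<times> X) (\<lambda>w. f (fst w) (snd w))"
  shows "continuous_on A (\<lambda>x. L (f x))"
  unfolding continuous_on_iff
proof (intro ballI allI impI)
  fix x and e :: real
  assume x: "x \<in> A" and e: "e > 0"
  have fx: "continuous_on X (f y)" if "y \<in> A" for y
    using that by (intro continuous_on_compose2[OF f, of X "\<lambda>t. (y, t)", simplified] continuous_intros) auto
  have "uniformly_continuous_on (A \<times> X) (\<lambda>w. f (fst w) (snd w))"
    using f A X by (intro compact_uniformly_continuous compact_Times)
  then obtain d where d: "d > 0" "\<And>w w'. w \<in> A \<times> X \<Longrightarrow> w' \<in> A \<times> X \<Longrightarrow> dist w' w < d \<Longrightarrow>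
      dist (f (fst w') (snd w')) (f (fst w) (snd w)) < e / 2"
    using e unfolding uniformly_continuous_on_def by (meson half_gt_zero)
  have "dist (L (f y)) (L (f x)) < e" if y: "y \<in> A" "dist y x < d" for y
  proof -
    have ab: "\<bar>f y t - f x t\<bar> < e / 2" if "t \<in> X" for t
      using d(2)[of "(x, t)" "(y, t)"] x y that by (simp add: dist_Pair_Pair dist_real_def)
    have *: "f y t \<le> f x t + e / 2" "f x t \<le> f y t + e / 2" if "t \<in> X" for t
      using ab[OF that] by linarith+
    have "L (f y) \<le> L (\<lambda>t. f x t + e / 2)"
      using * x y(1) by (intro state_mono[OF L] continuous_intros fx)
    moreover have "L (f x) \<le> L (\<lambda>t. f y t + e / 2)"
      using * x y(1) by (intro state_mono[OF L] continuous_intros fx)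
    ultimately show ?thesis
      using e by (simp add: state_add_const[OF L fx[OF x]] state_add_const[OF L fx[OF y(1)]] dist_real_def)
  qed
  then show "\<exists>d>0. \<forall>y\<in>A. dist y x < d \<longrightarrow> dist (L (f y)) (L (f x)) < e"
    using d(1) by blast
qed

text \<open>The product measure as an iterated integral, with the last coordinate innermost. The
  space \<open>tuples X 0\<close> has one point, the constant \<open>undefined\<close>, where the
  base case evaluates.\<close>

fun prod_state ::
  "'a::topological_space set \<Rightarrow> (('a \<Rightarrow> real) \<Rightarrow> real) \<Rightarrow> nat \<Rightarrow> ((nat \<Rightarrow> 'a) \<Rightarrow> real) \<Rightarrow> real" where
  "prod_state X L 0 f = f (\<lambda>_. undefined)"
| "prod_state X L (Suc n) f = (if continuous_on (tuples X (Suc n)) f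
     then prod_state X L n (\<lambda>x. L (\<lambda>t. f (x(n := t)))) else 0)"

context
  fixes X :: "'a::metric_space set" and L
  assumes cX: "compact X" and L: "L \<in> states X"
begin

lemma snoc_in: "x \<in> tuples X n \<Longrightarrow> t \<in> X \<Longrightarrow> x(n := t) \<in> tuples X (Suc n)"
  by (auto simp: PiE_iff extensional_def)

lemma continuous_snoc:
  fixes f :: "(nat \<Rightarrow> 'a) \<Rightarrow> real"
  assumes "continuous_on (tuples X (Suc n)) f"
  shows "continuous_on (tuples X n \<times> X) (\<lambda>w. f ((fst w)(n := snd w)))"
proof (rule continuous_on_compose2[OF assms])
  show "continuous_on (tuples X n \<times> X) (\<lambda>w. (fst w)(n := snd w))"
    by (intro continuous_on_fun_upd continuous_intros)
  show "(\<lambda>w. (fst w)(n := snd w)) ` (tuples X n \<times> X) \<subseteq> tuples X (Suc n)"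
    using snoc_in by force
qed

lemma continuous_snoc_right:
  fixes f :: "(nat \<Rightarrow> 'a) \<Rightarrow> real"
  assumes "continuous_on (tuples X (Suc n)) f" "x \<in> tuples X n"
  shows "continuous_on X (\<lambda>t. f (x(n := t)))"
proof -
  have "continuous_on X (\<lambda>t. (x, t))"
    by (intro continuous_intros)
  moreover have "(\<lambda>t. (x, t)) ` X \<subseteq> tuples X n \<times> X"
    using assms(2) by blast
  ultimately show ?thesis
    using continuous_on_compose2[OF continuous_snoc[OF assms(1)]] by fastforce
qed

lemma continuous_snoc_left:
  fixes f :: "(nat \<Rightarrow> 'a) \<Rightarrow> real"
  assumes "continuous_on (tuples X (Suc n)) f"
  shows "continuous_on (tuples X n) (\<lambda>x. L (\<lambda>t. f (x(n := t))))"
  using continuous_snoc[OF assms]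
  by (intro state_parameter_continuous[OF L cX compact_tuples[OF cX]])

lemma prod_state_states:
  "(\<lambda>f. if continuous_on (tuples X n) f then prod_state X L n f else 0) \<in> states (tuples X n)"
proof (induction n)
  case 0
  show ?case
    by (auto simp: states_def PiE_def extensional_def continuous_on_add continuous_on_mult)
next
  case (Suc n)
  let ?P = "tuples X n" and ?P' = "tuples X (Suc n)"
  let ?M = "\<lambda>f. if continuous_on ?P f then prod_state X L n f else 0"
  have eq: "prod_state X L (Suc n) f = ?M (\<lambda>x. L (\<lambda>t. f (x(n := t))))" if "continuous_on ?P' f" for f
    using that continuous_snoc_left by simp
  show ?case
    unfolding states_def
  proof (intro CollectI conjI allI impI; (elim conjE)?)
    fix f f' :: "(nat \<Rightarrow> 'a) \<Rightarrow> real" and c :: real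
    let ?N = "\<lambda>f. if continuous_on ?P' f then prod_state X L (Suc n) f else 0"
    show "?N f = 0" if "\<not> continuous_on ?P' f"
      using that by simp
    show "?N (\<lambda>x. f x + f' x) = ?N f + ?N f'" if f: "continuous_on ?P' f" "continuous_on ?P' f'"
    proof -
      have "?N (\<lambda>x. f x + f' x) = ?M (\<lambda>x. L (\<lambda>t. f (x(n := t)) + f' (x(n := t))))"
        using f by (simp only: eq continuous_on_add if_True)
      also have "\<dots> = ?M (\<lambda>x. L (\<lambda>t. f (x(n := t))) + L (\<lambda>t. f' (x(n := t))))"
        using f by (intro state_cong[OF Suc] state_add[OF L] continuous_snoc_right)
      also have "\<dots> = ?M (\<lambda>x. L (\<lambda>t. f (x(n := t)))) + ?M (\<lambda>x. L (\<lambda>t. f' (x(n := t))))"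
        using f by (intro state_add[OF Suc] continuous_snoc_left)
      finally show ?thesis
        using f by (simp only: eq if_True)
    qed
    show "?N (\<lambda>x. c * f x) = c * ?N f" if f: "continuous_on ?P' f"
    proof -
      have "continuous_on ?P' (\<lambda>x. c * f x)"
        using f by (intro continuous_intros)
      then have "?N (\<lambda>x. c * f x) = ?M (\<lambda>x. L (\<lambda>t. c * f (x(n := t))))"
        by (simp only: eq if_True)
      also have "\<dots> = ?M (\<lambda>x. c * L (\<lambda>t. f (x(n := t))))"
        using f by (intro state_cong[OF Suc] state_scale[OF L] continuous_snoc_right)
      also have "\<dots> = c * ?M (\<lambda>x. L (\<lambda>t. f (x(n := t))))"
        using f by (intro state_scale[OF Suc] continuous_snoc_left)
      finally show ?thesis
        using f by (simp only: eq if_True)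
    qed
    show "0 \<le> ?N f" if f: "continuous_on ?P' f" "\<forall>x\<in>?P'. 0 \<le> f x"
    proof -
      have "0 \<le> ?M (\<lambda>x. L (\<lambda>t. f (x(n := t))))"
        using f snoc_in
        by (intro state_nonneg[OF Suc] state_nonneg[OF L] continuous_snoc_left continuous_snoc_right) blast+
      then show ?thesis
        using f by (simp only: eq if_True)
    qed
    show "?N (\<lambda>x. 1) = 1"
      using state_one[OF Suc] state_one[OF L] by (simp only: eq if_True continuous_on_const)
  qed
qed

lemma prod_state_invariant:
  fixes T :: "'g::group_add \<Rightarrow> 'a \<Rightarrow> 'a"
  assumes X: "tds X T" and inv: "\<And>f. continuous_on X f \<Longrightarrow> L (\<lambda>t. f (T g t)) = L f"
    and "continuous_on (tuples X n) f"
  shows "prod_state X L n (\<lambda>x. f (tuple_act n T g x)) = prod_state X L n f"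
  using assms(3)
proof (induction n arbitrary: f)
  case 0
  have "restrict h {} = (\<lambda>_. undefined)" for h :: "nat \<Rightarrow> 'a"
    by (simp add: restrict_def)
  then show ?case
    by (simp add: tuple_act_def)
next
  case (Suc n)
  let ?P = "tuples X n" and ?P' = "tuples X (Suc n)"
  define k where "k x = L (\<lambda>t. f (x(n := t)))" for x
  have ck: "continuous_on ?P k"
    unfolding k_def using continuous_snoc_left Suc.prems by blast
  have cf: "continuous_on ?P' (\<lambda>x. f (tuple_act (Suc n) T g x))"
    by (rule tds_compose_continuous[OF tds_tuples[OF X] Suc.prems])
  note st = prod_state_states[of n]
  have "L (\<lambda>t. f (tuple_act (Suc n) T g (x(n := t)))) = k (tuple_act n T g x)" if x: "x \<in> ?P" for x
  proof -
    have y: "tuple_act n T g x \<in> ?P"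
      using tds_mem[OF tds_tuples[OF X] x] .
    have "tuple_act (Suc n) T g (x(n := t)) = (tuple_act n T g x)(n := T g t)" for t
      using x by (auto simp: tuple_act_def fun_eq_iff restrict_def less_Suc_eq)
    moreover have "L (\<lambda>t. f ((tuple_act n T g x)(n := T g t))) = k (tuple_act n T g x)"
      unfolding k_def by (rule inv[OF continuous_snoc_right[OF Suc.prems y]])
    ultimately show ?thesis
      by (simp only:)
  qed
  then have 1: "(if continuous_on ?P (\<lambda>x. L (\<lambda>t. f (tuple_act (Suc n) T g (x(n := t)))))
      then prod_state X L n (\<lambda>x. L (\<lambda>t. f (tuple_act (Suc n) T g (x(n := t))))) else 0) =
    (if continuous_on ?P (\<lambda>x. k (tuple_act n T g x)) then prod_state X L n (\<lambda>x. k (tuple_act n T g x)) else 0)"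
    by (rule state_cong[OF st])
  have "prod_state X L (Suc n) (\<lambda>x. f (tuple_act (Suc n) T g x)) = prod_state X L n (\<lambda>x. k (tuple_act n T g x))"
    using 1 cf continuous_snoc_left[OF cf] tds_compose_continuous[OF tds_tuples[OF X] ck]
    by (simp only: prod_state.simps if_True)
  also have "\<dots> = prod_state X L n k"
    by (rule Suc.IH[OF ck])
  also have "\<dots> = prod_state X L (Suc n) f"
    using Suc.prems by (simp only: prod_state.simps if_True k_def[abs_def])
  finally show ?case .
qed

lemma prod_state_pos:
  assumes pos: "\<And>f t. continuous_on X f \<Longrightarrow> (\<And>s. s \<in> X \<Longrightarrow> 0 \<le> f s) \<Longrightarrow> t \<in> X \<Longrightarrow> 0 < f t \<Longrightarrow> 0 < L f"
    and "continuous_on (tuples X n) f" "\<And>x. x \<in> tuples X n \<Longrightarrow> 0 \<le> f x"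
    "x \<in> tuples X n" "0 < f x"
  shows "0 < prod_state X L n f"
  using assms(2-)
proof (induction n arbitrary: f x)
  case 0
  then show ?case
    by simp
next
  case (Suc n)
  let ?P = "tuples X n" and ?P' = "tuples X (Suc n)"
  define y where "y = x(n := undefined)"
  have y: "y \<in> ?P" "y(n := x n) = x" "x n \<in> X"
    using Suc.prems(3) by (auto simp: y_def PiE_iff extensional_def)
  have "0 < prod_state X L n (\<lambda>x. L (\<lambda>t. f (x(n := t))))"
  proof (rule Suc.IH)
    show "continuous_on ?P (\<lambda>x. L (\<lambda>t. f (x(n := t))))"
      using Suc.prems(1) by (rule continuous_snoc_left)
    show "0 \<le> L (\<lambda>t. f (z(n := t)))" if "z \<in> ?P" for z
      by (rule state_nonneg[OF L continuous_snoc_right[OF Suc.prems(1) that]])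
        (rule Suc.prems(2)[OF snoc_in[OF that]])
    show "0 < L (\<lambda>t. f (y(n := t)))"
    proof (rule pos[of _ "x n"])
      show "continuous_on X (\<lambda>t. f (y(n := t)))"
        by (rule continuous_snoc_right[OF Suc.prems(1) y(1)])
      show "0 \<le> f (y(n := s))" if "s \<in> X" for s
        by (rule Suc.prems(2)[OF snoc_in[OF y(1) that]])
      show "0 < f (y(n := x n))"
        using Suc.prems(4) by (simp only: y(2))
    qed (rule y(3))
  qed (rule y(1))
  then show ?case
    using Suc.prems(1) by (simp only: prod_state.simps if_True)
qed

end

text \<open>The product state is invariant, so it can stand alone as \<open>\<Xi>\<close> on the
  whole tuple space, and it is positive on bumps because an invariant measure of a minimal system
  has full support.\<close>

lemma bump_supply_inv_measure:
  fixes X :: "'a::metric_space set" and T :: "'g::group_add \<Rightarrow> 'a \<Rightarrow> 'a"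
  assumes X: "tds X T" "minimal_sys X T" and \<mu>: "inv_measure X T \<mu>"
  shows "bump_supply X T N"
  unfolding bump_supply_def
proof (intro allI impI)
  fix V :: "(nat \<Rightarrow> 'a) set"
  let ?P = "tuples X N" and ?R = "tuple_act N T"
  assume V: "open V \<and> V \<inter> ?P \<noteq> {}"
  have cX: "compact X"
    using X(1) by (rule tds_compact)
  define L where "L f = (if continuous_on X f then \<integral>x. f x \<partial>\<mu> else 0)" for f :: "'a \<Rightarrow> real"
  have L: "L \<in> states X"
    unfolding L_def[abs_def] by (rule integral_state[OF cX \<mu>])
  define M where "M f = (if continuous_on ?P f then prod_state X L N f else 0)" for f :: "(nat \<Rightarrow> 'a) \<Rightarrow> real"
  have M: "M \<in> states ?P"
    unfolding M_def[abs_def] by (rule prod_state_states[OF cX L])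
  have P: "tds ?P ?R"
    by (rule tds_tuples[OF X(1)])
  have Linv: "L (\<lambda>t. f (T g t)) = L f" if "continuous_on X f" for f g
    using that tds_compose_continuous[OF X(1) that] inv_measure_integral_invariant[OF X(1) \<mu> that]
    by (simp add: L_def)
  have Mpush: "push ?P ?R g M = M" for g
  proof
    fix f
    show "push ?P ?R g M f = M f"
      using tds_compose_continuous[OF P, of f g] prod_state_invariant[OF cX L X(1) Linv, where n = N and f = f]
      by (auto simp: push_def M_def)
  qed
  have "joint_minimal ?P ?R X T {M}"
    unfolding joint_minimal_def
  proof (intro conjI allI impI ballI)
    have "{M} = {L. \<forall>f. L f = M f}"
      by (auto simp: fun_eq_iff)
    also have "closed \<dots>"
      by (intro closed_Collect_all closed_Collect_eq continuous_on_const continuous_on_product_coordinates)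
    finally show "closed {M}" .
    show "push ?P ?R g L' \<in> {M}" if "L' \<in> {M}" for g L'
      using that Mpush by simp
    fix \<Omega> assume \<Omega>: "closed \<Omega> \<and> \<Omega> \<subseteq> {M} \<times> X \<and> \<Omega> \<noteq> {} \<and>
      (\<forall>g. \<forall>(L, a)\<in>\<Omega>. (push ?P ?R g L, T g a) \<in> \<Omega>)"
    define A where "A = (\<lambda>a. (M, a)) -` \<Omega>"
    have "continuous_on UNIV (\<lambda>a :: 'a. (M, a))"
      by (intro continuous_intros)
    then have "closed A"
      unfolding A_def using \<Omega> by (intro closed_vimage) auto
    moreover have "A \<subseteq> X"
      using \<Omega> by (auto simp: A_def)
    moreover have "A \<noteq> {}"
    proof -
      obtain w where "w \<in> \<Omega>" "w \<in> {M} \<times> X"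
        using \<Omega> by blast
      then have "snd w \<in> A"
        by (auto simp: A_def)
      then show ?thesis
        by blast
    qed
    moreover have "T g ` A \<subseteq> A" for g
    proof
      fix z assume "z \<in> T g ` A"
      then obtain a where "(M, a) \<in> \<Omega>" "z = T g a"
        by (auto simp: A_def)
      then have "(push ?P ?R g M, z) \<in> \<Omega>"
        using \<Omega> by blast
      then show "z \<in> A"
        by (simp add: A_def Mpush)
    qed
    ultimately have "A = X"
      using X(2) by (simp add: minimal_sys_def)
    then show "\<Omega> = {M} \<times> X"
      using \<Omega> by (auto simp: A_def)
  qed (use M in auto)
  moreover have "0 < M b" if b: "continuous_on ?P b" "\<forall>x\<in>?P. 0 \<le> b x" "\<forall>x\<in>V \<inter> ?P. 0 < b x" for b
  proof -
    obtain x where x: "x \<in> V" "x \<in> ?P"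
      using V by blast
    have pos: "0 < L f" if "continuous_on X f" "\<And>s. s \<in> X \<Longrightarrow> 0 \<le> f s" "t \<in> X" "0 < f t" for f t
      using inv_measure_integral_pos[OF X \<mu> that] that(1) by (simp add: L_def)
    have "0 < prod_state X L N b"
      using b x by (intro prod_state_pos[OF cX L pos]) auto
    then show ?thesis
      using b(1) by (simp add: M_def)
  qed
  ultimately show "\<exists>K \<Xi>. K \<subseteq> ?P \<and> tds K ?R \<and> joint_minimal K ?R X T \<Xi> \<and>
     (\<forall>b. continuous_on ?P b \<and> (\<forall>x\<in>?P. 0 \<le> b x) \<and> (\<forall>x\<in>V \<inter> ?P. 0 < b x) \<longrightarrow> (\<exists>L\<in>\<Xi>. 0 < L b))"
    using P by (intro exI[of _ ?P] exI[of _ "{M}"]) blast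
qed

section \<open>Irreducible sets of states\<close>

text \<open>\<open>P\<close> will be closure under the action, with or without closure under
  averages; both survive intersections. Compactness keeps intersections of chains nonempty, and Zorn
  is applied to complements, so that decreasing chains become increasing ones.\<close>

lemma ex_minimal_closed:
  fixes C :: "'c::topological_space set"
  assumes C: "compact C" "closed C" "C \<noteq> {}" "P C"
    and P: "\<And>\<C>. (\<And>A. A \<in> \<C> \<Longrightarrow> P A) \<Longrightarrow> P (\<Inter>\<C>)"
  obtains M where "closed M" "M \<subseteq> C" "M \<noteq> {}" "P M"
    "\<And>A. closed A \<Longrightarrow> A \<subseteq> M \<Longrightarrow> A \<noteq> {} \<Longrightarrow> P A \<Longrightarrow> A = M"
proof -
  define \<A> where "\<A> = {A. closed A \<and> A \<subseteq> C \<and> A \<noteq> {} \<and> P A}"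
  have ne: "\<A> \<noteq> {}"
    using C by (auto simp: \<A>_def)
  have A: "closed A \<and> A \<noteq> {} \<and> A \<subseteq> C \<and> P A" if "A \<in> \<A>" for A
    using that by (simp add: \<A>_def)
  have Int: "\<Inter>\<C> \<in> \<A>" if \<C>: "\<C> \<noteq> {}" "\<C> \<subseteq> \<A>" "\<Inter>\<C> \<noteq> {}" for \<C>
  proof -
    have "closed (\<Inter>\<C>)" "P (\<Inter>\<C>)"
      using A \<C>(2) by (auto intro!: closed_Inter P)
    moreover have "\<Inter>\<C> \<subseteq> C"
      using A \<C>(1,2) by blast
    ultimately show ?thesis
      using \<C>(3) by (simp add: \<A>_def)
  qed
  have "\<exists>M\<in>uminus ` \<A>. \<forall>Z\<in>uminus ` \<A>. M \<subseteq> Z \<longrightarrow> Z = M"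
  proof (rule subset_Zorn_nonempty)
    show "uminus ` \<A> \<noteq> {}"
      using ne by simp
    fix \<D> assume \<D>: "\<D> \<noteq> {}" "subset.chain (uminus ` \<A>) \<D>"
    define \<C> where "\<C> = uminus ` \<D>"
    have sub: "\<C> \<subseteq> \<A>"
      using \<D>(2) by (auto simp: \<C>_def subset.chain_def)
    have \<C>ne: "\<C> \<noteq> {}"
      using \<D>(1) by (simp add: \<C>_def)
    have "C \<inter> \<Inter>\<C> \<noteq> {}"
    proof (rule compact_imp_fip[OF C(1)])
      show "closed T" if "T \<in> \<C>" for T
        using that sub A by blast
      fix F assume F: "finite F" "F \<subseteq> \<C>"
      then obtain G where G: "G \<subseteq> \<D>" "finite G" "F = uminus ` G"
        unfolding \<C>_def by (meson finite_subset_image)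
      show "C \<inter> \<Inter>F \<noteq> {}"
      proof (cases "G = {}")
        case True
        then show ?thesis
          using C(3) G(3) by simp
      next
        case False
        have "subset.chain N G" if "subset.chain N \<D>" for N
          using that G(1) unfolding subset.chain_def by blast
        from this[OF \<D>(2)] have "\<Union>G \<in> G"
          using G(2) False by (intro Union_in_chain)
        then have "- \<Union>G \<in> \<C>"
          using G(1) unfolding \<C>_def by blast
        moreover have "- \<Union>G = \<Inter>F"
          unfolding G(3) by (rule uminus_Sup)
        ultimately have "\<Inter>F \<in> \<A>"
          using sub by (simp only: subsetD)
        from A[OF this] show ?thesis
          by (simp add: Int_absorb1)
      qed
    qed
    then have "\<Inter>\<C> \<in> \<A>"
      using Int[OF \<C>ne sub] by blast
    moreover have "\<Union>\<D> = - \<Inter>\<C>"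
      by (auto simp: \<C>_def)
    ultimately show "\<Union>\<D> \<in> uminus ` \<A>"
      by blast
  qed
  then obtain M' where M': "M' \<in> uminus ` \<A>" "\<forall>Z\<in>uminus ` \<A>. M' \<subseteq> Z \<longrightarrow> Z = M'"
    by (rule bexE)
  from M'(1) obtain M where M: "M' = - M" "M \<in> \<A>"
    by (rule imageE)
  have "A = M" if "A \<in> \<A>" "A \<subseteq> M" for A
  proof -
    have "- A \<in> uminus ` \<A>"
      using that(1) by (rule imageI)
    moreover have "M' \<subseteq> - A"
      unfolding M(1) using that(2) by (simp only: compl_le_compl_iff)
    ultimately have "- A = M'"
      by (rule bspec[OF M'(2), THEN mp])
    then show ?thesis
      unfolding M(1) by (simp only: compl_eq_compl_iff)
  qed
  note min = this
  show ?thesis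
  proof (rule that[of M])
    show "B = M" if "closed B" "B \<subseteq> M" "B \<noteq> {}" "P B" for B
      using that A[OF M(2)] by (intro min) (simp_all add: \<A>_def subset_trans)
  qed (use A[OF M(2)] in simp_all)
qed

definition average :: "nat \<Rightarrow> (nat \<Rightarrow> 'c functional) \<Rightarrow> ('c \<Rightarrow> real) \<Rightarrow> real" where
  "average m l f = (\<Sum>i<m. l i f) / m"

text \<open>For a closed set this is convexity: repeated entries of \<open>l\<close> give all
  rational weights.\<close>

definition average_closed :: "'c functional set \<Rightarrow> bool" where
  "average_closed \<Q> \<longleftrightarrow> (\<forall>m l. m > 0 \<and> (\<forall>i<m. l i \<in> \<Q>) \<longrightarrow> average m l \<in> \<Q>)"

lemma states_average_closed: "average_closed (states K)"
  unfolding average_closed_def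
proof (intro allI impI, elim conjE)
  fix m :: nat and l
  assume m: "m > 0" and l: "\<forall>i<m. l i \<in> states K"
  then have l: "l i \<in> states K" if "i < m" for i
    using that by blast
  show "average m l \<in> states K"
    unfolding states_def
  proof (intro CollectI conjI allI impI; (elim conjE)?)
    fix f f' :: "'a \<Rightarrow> real" and c :: real
    show "average m l f = 0" if "\<not> continuous_on K f"
      using state_discontinuous[OF l that] by (simp add: average_def)
    show "average m l (\<lambda>x. f x + f' x) = average m l f + average m l f'"
      if "continuous_on K f" "continuous_on K f'"
      using state_add[OF l that] by (simp add: average_def sum.distrib add_divide_distrib)
    show "average m l (\<lambda>x. c * f x) = c * average m l f" if "continuous_on K f"
      using state_scale[OF l that] by (simp add: average_def sum_distrib_left)
    show "0 \<le> average m l f" if "continuous_on K f" "\<forall>x\<in>K. 0 \<le> f x"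
      using state_nonneg[OF l that(1)] that(2) by (auto simp: average_def intro!: sum_nonneg divide_nonneg_nonneg)
    show "average m l (\<lambda>x. 1) = 1"
      using state_one[OF l] m by (simp add: average_def)
  qed
qed

lemma push_average: "push K R g (average m l) = average m (\<lambda>i. push K R g (l i))"
  by (rule ext) (simp add: push_def average_def)

text \<open>An irreducible compact convex set of states is strongly proximal: take a state \<^term>\<open>e\<close>
maximising \<open>\<Sum>f\<in>F. (L f)\<^sup>2\<close>. By irreducibility the barycentre of the given states
can be pushed close to \<^term>\<open>e\<close>, and by strict convexity all of them come along.\<close>

lemma irreducible_contract:
  fixes m :: nat and e :: real
  assumes K: "tds K R" and Q: "closed \<Q>" "\<Q> \<subseteq> states K" "\<Q> \<noteq> {}" "push_closed K R \<Q>" "average_closed \<Q>"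
    and irr: "\<And>A. closed A \<Longrightarrow> A \<subseteq> \<Q> \<Longrightarrow> A \<noteq> {} \<Longrightarrow> push_closed K R A \<Longrightarrow> average_closed A \<Longrightarrow> A = \<Q>"
    and l: "\<And>i. i < m \<Longrightarrow> l i \<in> \<Q>" and F: "finite F" and e: "e > 0"
  shows "\<exists>g. \<forall>i<m. \<forall>j<m. \<forall>f\<in>F. \<bar>push K R g (l i) f - push K R g (l j) f\<bar> \<le> e"
proof (cases "m = 0")
  case True
  then show ?thesis
    by simp
next
  case False
  then have m: "m > 0"
    by simp
  have cQ: "compact \<Q>"
    using compact_Int_closed[OF compact_states[OF tds_compact[OF K]] Q(1)] Q(2) by (simp add: Int_absorb1)
  define dot where "dot L L' = (\<Sum>f\<in>F. L f * L' f)" for L L' :: "'a functional"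
  have coord: "continuous_on UNIV (\<lambda>L :: 'a functional. L f)" for f
    by (rule continuous_on_product_coordinates)
  have "continuous_on \<Q> (\<lambda>L. dot L L)"
    unfolding dot_def using continuous_on_subset[OF coord] by (intro continuous_intros) auto
  then obtain u where u: "u \<in> \<Q>" "\<And>L. L \<in> \<Q> \<Longrightarrow> dot L L \<le> dot u u"
    using continuous_attains_sup[OF cQ Q(3)] by blast
  \<comment> \<open>Chosen so that \<open>2 * m * \<eta>\<close>, the bound on the sum of the
    squared distances to \<open>u\<close>, equals \<open>(e / 2)\<^sup>2\<close>.\<close>
  define \<eta> where "\<eta> = (e / 2)\<^sup>2 / (2 * m)"
  have \<eta>: "\<eta> > 0"
    using e m by (simp add: \<eta>_def)
  define a where "a = average m l"
  have a: "a \<in> \<Q>"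
    using Q(5) m l unfolding average_closed_def a_def by blast
  have "\<exists>g. dot u u - \<eta> < dot (push K R g a) u"
  proof (rule ccontr)
    assume *: "\<not> ?thesis"
    \<comment> \<open>The states whose orbits stay at least \<open>\<eta>\<close> below the maximum
      in direction \<open>u\<close>. The conditions are linear, so this set is closed, invariant and
      convex; irreducibility would make it all of \<open>\<Q>\<close>, yet it cannot contain
      \<open>u\<close>.\<close>
    define A where "A = {L \<in> \<Q>. \<forall>g. dot (push K R g L) u \<le> dot u u - \<eta>}"
    have "A = \<Q>"
    proof (rule irr)
      have "continuous_on UNIV (\<lambda>L. dot (push K R g L) u)" for g
        unfolding dot_def
        by (intro continuous_intros continuous_on_product_then_coordinatewise[OF continuous_push])
      then have "closed {L. \<forall>g. dot (push K R g L) u \<le> dot u u - \<eta>}"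
        by (intro closed_Collect_all closed_Collect_le continuous_on_const)
      then have "closed (\<Q> \<inter> {L. \<forall>g. dot (push K R g L) u \<le> dot u u - \<eta>})"
        using Q(1) by (rule closed_Int[rotated])
      moreover have "\<Q> \<inter> {L. \<forall>g. dot (push K R g L) u \<le> dot u u - \<eta>} = A"
        by (auto simp: A_def)
      ultimately show "closed A"
        by simp
      show "A \<subseteq> \<Q>"
        by (auto simp: A_def)
      have "a \<in> A"
        using a * by (auto simp: A_def not_less)
      then show "A \<noteq> {}"
        by blast
      show "push_closed K R A"
        unfolding push_closed_def
      proof (intro allI ballI)
        fix g L assume L: "L \<in> A"
        then have LQ: "L \<in> \<Q>" "L \<in> states K"
          using Q(2) by (auto simp: A_def)
        have "dot (push K R h (push K R g L)) u \<le> dot u u - \<eta>" for h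
          using L by (simp add: push_push[OF K LQ(2)] A_def)
        then show "push K R g L \<in> A"
          using Q(4) LQ(1) by (simp add: A_def push_closed_def)
      qed
      show "average_closed A"
        unfolding average_closed_def
      proof (intro allI impI, elim conjE)
        fix n :: nat and k
        assume n: "n > 0" and k: "\<forall>i<n. k i \<in> A"
        have "dot (push K R g (average n k)) u \<le> dot u u - \<eta>" for g
        proof -
          have "dot (push K R g (average n k)) u = (\<Sum>f\<in>F. \<Sum>i<n. push K R g (k i) f * u f) / n"
            by (simp add: push_average average_def dot_def sum_divide_distrib sum_distrib_right)
          also have "\<dots> = (\<Sum>i<n. dot (push K R g (k i)) u) / n"
            unfolding dot_def by (subst sum.swap) simp
          also have "\<dots> \<le> (\<Sum>i<n. dot u u - \<eta>) / n"
            using k by (intro divide_right_mono sum_mono) (auto simp: A_def)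
          also have "\<dots> = dot u u - \<eta>"
            using n by simp
          finally show ?thesis .
        qed
        moreover have "average n k \<in> \<Q>"
          using Q(5) n k unfolding average_closed_def A_def by blast
        ultimately show "average n k \<in> A"
          by (simp add: A_def)
      qed
    qed
    then have "dot (push K R 0 u) u \<le> dot u u - \<eta>"
      using u(1) by (auto simp: A_def)
    then show False
      using \<eta> push_zero[OF K] u(1) Q(2) by (simp add: subset_iff)
  qed
  then obtain g where g: "dot u u - \<eta> < dot (push K R g a) u"
    by blast
  define k where "k i = push K R g (l i)" for i
  have kQ: "k i \<in> \<Q>" if "i < m" for i
    using Q(4) l[OF that] by (simp add: push_closed_def k_def)
  have "m * dot (push K R g a) u = (\<Sum>i<m. dot (k i) u)"
  proof -
    have "dot (push K R g a) u = (\<Sum>f\<in>F. \<Sum>i<m. k i f * u f) / m"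
      by (simp add: a_def push_average average_def dot_def k_def sum_divide_distrib sum_distrib_right)
    then have "m * dot (push K R g a) u = (\<Sum>f\<in>F. \<Sum>i<m. k i f * u f)"
      using m by simp
    then show ?thesis
      unfolding dot_def by (subst (asm) sum.swap)
  qed
  then have lower: "m * (dot u u - \<eta>) \<le> (\<Sum>i<m. dot (k i) u)"
    using g by (metis less_imp_le mult_left_mono of_nat_0_le_iff)
  \<comment> \<open>No state in \<open>\<Q>\<close> is longer than \<open>u\<close>, so an almost
    maximal average in direction \<open>u\<close> forces every single \<open>k i\<close> to be close
    to \<open>u\<close>.\<close>
  have "(\<Sum>i<m. \<Sum>f\<in>F. (k i f - u f)\<^sup>2) = (\<Sum>i<m. dot (k i) (k i) - 2 * dot (k i) u + dot u u)"
    by (simp add: dot_def power2_eq_square algebra_simps sum.distrib sum_subtractf sum_distrib_left)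
  also have "\<dots> \<le> (\<Sum>i<m. 2 * dot u u - 2 * dot (k i) u)"
    using u(2) kQ by (intro sum_mono) (smt (verit) lessThan_iff)
  also have "\<dots> = 2 * m * dot u u - 2 * (\<Sum>i<m. dot (k i) u)"
    by (simp add: sum_subtractf sum_distrib_left)
  also have "\<dots> \<le> 2 * m * \<eta>"
    using lower by (simp add: algebra_simps)
  also have "\<dots> = (e / 2)\<^sup>2"
    using m by (simp add: \<eta>_def)
  finally have total: "(\<Sum>i<m. \<Sum>f\<in>F. (k i f - u f)\<^sup>2) \<le> (e / 2)\<^sup>2" .
  have close: "\<bar>k i f - u f\<bar> \<le> e / 2" if "i < m" "f \<in> F" for i f
  proof -
    have "(k i f - u f)\<^sup>2 \<le> (\<Sum>f\<in>F. (k i f - u f)\<^sup>2)"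
      using F that by (intro member_le_sum) auto
    also have "\<dots> \<le> (\<Sum>i<m. \<Sum>f\<in>F. (k i f - u f)\<^sup>2)"
      using that by (intro member_le_sum[of i "{..<m}" "\<lambda>i. \<Sum>f\<in>F. (k i f - u f)\<^sup>2"]) (auto intro: sum_nonneg)
    finally have "(k i f - u f)\<^sup>2 \<le> (e / 2)\<^sup>2"
      using total by linarith
    then show ?thesis
      using e by (simp add: abs_le_square_iff[symmetric])
  qed
  have "\<bar>k i f - k j f\<bar> \<le> e" if "i < m" "j < m" "f \<in> F" for i j f
    using close[OF that(1,3)] close[OF that(2,3)] by linarith
  then show ?thesis
    unfolding k_def by blast
qed

section \<open>Incontractible systems\<close>

lemma push_closed_Inter:
  "(\<And>A. A \<in> \<C> \<Longrightarrow> push_closed K R A) \<Longrightarrow> push_closed K R (\<Inter>\<C>)"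
  unfolding push_closed_def by blast

lemma average_closed_Inter:
  "(\<And>A. A \<in> \<C> \<Longrightarrow> average_closed A) \<Longrightarrow> average_closed (\<Inter>\<C>)"
  unfolding average_closed_def by (meson InterE InterI)

lemma states_nonempty:
  assumes "x \<in> K"
  shows "states K \<noteq> {}"
proof -
  have "(\<lambda>f. if continuous_on K f then f x else 0) \<in> states K"
    using assms by (auto simp: states_def continuous_on_add continuous_on_mult)
  then show ?thesis
    by blast
qed

text \<open>Incontractible systems are disjoint from proximal ones: over a minimal tuple of points of
\<^term>\<open>X\<close>, the states in the fibres of \<^term>\<open>\<Omega>\<close> can be contracted to a common one while
the tuple stays in its minimal orbit closure.\<close>

lemma incontractible_common_state:
  fixes X :: "'a::metric_space set" and T :: "'g::group_add \<Rightarrow> 'a \<Rightarrow> 'a" and \<Xi> :: "(('c::topological_space \<Rightarrow> real) \<Rightarrow> real) set"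
  assumes X: "tds X T" and inc: "incontractible X T"
    and \<Xi>: "compact \<Xi>" "closed \<Xi>" "\<Xi> \<subseteq> states K" "push_closed K R \<Xi>"
    and contract: "\<And>m l F e. (\<And>i::nat. i < m \<Longrightarrow> l i \<in> \<Xi>) \<Longrightarrow> finite F \<Longrightarrow> 0 < (e::real) \<Longrightarrow>
      \<exists>g. \<forall>i<m. \<forall>j<m. \<forall>f\<in>F. \<bar>push K R g (l i) f - push K R g (l j) f\<bar> \<le> e"
    and \<Omega>: "closed \<Omega>" "\<Omega> \<subseteq> \<Xi> \<times> X" "\<And>g L a. (L, a) \<in> \<Omega> \<Longrightarrow> (push K R g L, T g a) \<in> \<Omega>"
    and onto: "\<And>a. a \<in> X \<Longrightarrow> \<exists>L. (L, a) \<in> \<Omega>"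
    and m: "(m::nat) > 0" and x: "x \<in> tuples X m"
  shows "\<exists>L. \<forall>i<m. (L, x i) \<in> \<Omega>"
proof -
  let ?P = "tuples X m" and ?R = "tuple_act m T"
  have P: "tds ?P ?R"
    by (rule tds_tuples[OF X])
  \<comment> \<open>The tuples with a common state form a closed invariant set. It suffices to find
    every minimal tuple in it, as these are dense by incontractibility.\<close>
  define \<D> where "\<D> = {y \<in> ?P. \<exists>L. \<forall>i<m. (L, y i) \<in> \<Omega>}"
  have \<D>_closed: "closed \<D>"
  proof -
    let ?W = "(\<Xi> \<times> ?P) \<inter> (\<Inter>i\<in>{..<m}. (\<lambda>w. (fst w, snd w i)) -` \<Omega>)"
    have cont: "continuous_on UNIV (\<lambda>w :: 'c functional \<times> (nat \<Rightarrow> 'a). (fst w, snd w i))" for i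
      by (intro continuous_on_Pair continuous_on_fst continuous_on_id
          continuous_on_product_then_coordinatewise[OF continuous_on_snd[OF continuous_on_id]])
    have "closed ((\<lambda>w. (fst w, snd w i)) -` \<Omega>)" for i :: nat
      by (rule closed_vimage[OF \<Omega>(1) cont])
    then have "closed (\<Inter>i\<in>{..<m}. (\<lambda>w. (fst w, snd w i)) -` \<Omega>)"
      by (intro closed_INT) simp
    then have "compact ?W"
      using \<Xi>(1) tds_compact[OF P] by (intro compact_Int_closed compact_Times)
    then have "compact (snd ` ?W)"
      by (intro compact_continuous_image continuous_on_snd continuous_on_id)
    moreover have "snd ` ?W = \<D>"
    proof (intro equalityI subsetI)
      fix y assume "y \<in> \<D>"
      then obtain L where L: "y \<in> ?P" "\<forall>i<m. (L, y i) \<in> \<Omega>"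
        by (auto simp: \<D>_def)
      then have "L \<in> \<Xi>"
        using m \<Omega>(2) by blast
      then have "(L, y) \<in> ?W"
        using L by simp
      then show "y \<in> snd ` ?W"
        by (rule image_eqI[rotated]) simp
    next
      fix y assume "y \<in> snd ` ?W"
      then obtain w where w: "y = snd w" "w \<in> \<Xi> \<times> ?P" "\<forall>i<m. (fst w, snd w i) \<in> \<Omega>"
        by (elim imageE IntE) simp
      then have "y \<in> ?P"
        by (simp add: mem_Times_iff)
      then show "y \<in> \<D>"
        using w(1,3) by (simp only: \<D>_def mem_Collect_eq) blast
    qed
    ultimately show ?thesis
      by (simp add: compact_imp_closed)
  qed
  have \<D>_inv: "?R g y \<in> \<D>" if y: "y \<in> \<D>" for g y
  proof -
    obtain L where L: "y \<in> ?P" "\<forall>i<m. (L, y i) \<in> \<Omega>"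
      using y by (auto simp: \<D>_def)
    then have "\<forall>i<m. (push K R g L, ?R g y i) \<in> \<Omega>"
      using \<Omega>(3) by (simp add: tuple_act_def)
    then show ?thesis
      using tds_mem[OF P L(1)] by (auto simp: \<D>_def)
  qed
  have min: "z \<in> \<D>" if z: "minimal_point ?P ?R z" for z
  proof -
    have zP: "z \<in> ?P"
      using z by (simp add: minimal_point_def)
    define M where "M = closure (orbit ?R z)"
    have M: "M \<subseteq> ?P" "\<And>g. ?R g ` M \<subseteq> M" "z \<in> M" "minimal_sys M ?R"
      using closure_orbit_invariant[OF P zP] z by (auto simp: M_def minimal_point_def)
    have "compact M"
      using tds_compact[OF P] M(1) compact_Int_closed[of ?P M] by (simp add: M_def Int_absorb1)
    have "\<forall>i. \<exists>L. i < m \<longrightarrow> (L, z i) \<in> \<Omega>"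
      using onto[OF PiE_mem[OF zP]] by blast
    from choice[OF this] obtain l where l: "\<And>i. i < m \<Longrightarrow> (l i, z i) \<in> \<Omega>"
      by blast
    have lX: "l i \<in> \<Xi>" if "i < m" for i
      using l[OF that] \<Omega>(2) by blast
    define Z where "Z = PiE {..<m} (\<lambda>_. \<Xi>) \<times> M"
    have "compact Z"
      unfolding Z_def using \<Xi>(1) \<open>compact M\<close> by (intro compact_Times compact_tuples)
    \<comment> \<open>For \<open>w = (f, e)\<close> the states \<open>k i\<close> have to agree at
      \<open>f\<close> up to \<open>e\<close>. Contraction yields a point of \<open>Z\<close> in any
      finitely many of these sets, and at a point common to all of them the \<open>k i\<close>
      coincide.\<close>
    define C where "C w = {(k, y). \<forall>i<m. (k i, y i) \<in> \<Omega> \<and> (\<forall>j<m. \<bar>k i (fst w) - k j (fst w)\<bar> \<le> snd w)}"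
      for w :: "('c \<Rightarrow> real) \<times> real"
    have "Z \<inter> (\<Inter>w\<in>UNIV \<times> {0<..}. C w) \<noteq> {}"
    proof (rule compact_imp_fip_image[OF \<open>compact Z\<close>])
      fix w :: "('c \<Rightarrow> real) \<times> real"
      have k1: "continuous_on UNIV (\<lambda>v :: (nat \<Rightarrow> 'c functional) \<times> (nat \<Rightarrow> 'a). fst v i)" for i
        by (rule continuous_on_product_then_coordinatewise[OF continuous_on_fst[OF continuous_on_id]])
      have k2: "continuous_on UNIV (\<lambda>v :: (nat \<Rightarrow> 'c functional) \<times> (nat \<Rightarrow> 'a). snd v i)" for i
        by (rule continuous_on_product_then_coordinatewise[OF continuous_on_snd[OF continuous_on_id]])
      have k3: "continuous_on UNIV (\<lambda>v :: (nat \<Rightarrow> 'c functional) \<times> (nat \<Rightarrow> 'a). fst v i f)" for i f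
        by (rule continuous_on_product_then_coordinatewise[OF k1])
      have "closed {v. (fst v i, snd v i) \<in> \<Omega>}" for i :: nat
        using closed_vimage[OF \<Omega>(1) continuous_on_Pair[OF k1[of i] k2[of i]]] by (simp add: vimage_def)
      moreover have "closed {v :: (nat \<Rightarrow> 'c functional) \<times> (nat \<Rightarrow> 'a). \<bar>fst v i (fst w) - fst v j (fst w)\<bar> \<le> snd w}" for i j
        by (intro closed_Collect_le continuous_on_const continuous_on_rabs continuous_on_diff k3)
      ultimately have "closed {v. \<forall>i. i < m \<longrightarrow> (fst v i, snd v i) \<in> \<Omega> \<and>
          (\<forall>j. j < m \<longrightarrow> \<bar>fst v i (fst w) - fst v j (fst w)\<bar> \<le> snd w)}"
        by (intro closed_Collect_all closed_Collect_imp closed_Collect_conj open_Collect_const)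
      then show "closed (C w)"
        by (simp add: C_def case_prod_beta')
    next
      fix I :: "(('c \<Rightarrow> real) \<times> real) set"
      assume I: "finite I" "I \<subseteq> UNIV \<times> {0<..}"
      define e where "e = Min (insert 1 (snd ` I))"
      have e: "0 < e" "\<And>w. w \<in> I \<Longrightarrow> e \<le> snd w"
        using I by (auto simp: e_def)
      obtain g where g: "\<forall>i<m. \<forall>j<m. \<forall>f\<in>fst ` I. \<bar>push K R g (l i) f - push K R g (l j) f\<bar> \<le> e"
        using contract[of m l, OF lX finite_imageI[OF I(1)] e(1)] by blast
      define k where "k = restrict (\<lambda>i. push K R g (l i)) {..<m}"
      have "k \<in> PiE {..<m} (\<lambda>_. \<Xi>)"
        using lX \<Xi>(4) by (auto simp: k_def push_closed_def)
      moreover have "?R g z \<in> M"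
        using M(2,3) by blast
      moreover have "(k, ?R g z) \<in> C w" if w: "w \<in> I" for w
      proof -
        have "(k i, ?R g z i) \<in> \<Omega>" if "i < m" for i
          using \<Omega>(3)[OF l[OF that]] that by (simp add: k_def tuple_act_def)
        moreover have "\<bar>k i (fst w) - k j (fst w)\<bar> \<le> snd w" if "i < m" "j < m" for i j
        proof -
          have "\<bar>push K R g (l i) (fst w) - push K R g (l j) (fst w)\<bar> \<le> e"
            using g that w by blast
          then show ?thesis
            using e(2)[OF w] that by (simp add: k_def)
        qed
        ultimately show ?thesis
          by (simp add: C_def)
      qed
      ultimately have "(k, ?R g z) \<in> Z \<inter> (\<Inter>w\<in>I. C w)"
        unfolding Z_def by blast
      then show "Z \<inter> (\<Inter>w\<in>I. C w) \<noteq> {}"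
        by blast
    qed
    then obtain k y where ky: "(k, y) \<in> Z" "\<And>w. w \<in> UNIV \<times> {0<..} \<Longrightarrow> (k, y) \<in> C w"
      by auto
    have ky\<Omega>: "(k i, y i) \<in> \<Omega>" if "i < m" for i
      using ky(2)[of "(\<lambda>_. 0, 1)"] that by (simp add: C_def)
    have "k i = k 0" if i: "i < m" for i
    proof
      fix f
      have "\<bar>k i f - k 0 f\<bar> \<le> e" if "e > 0" for e
        using ky(2)[of "(f, e)"] that i m by (simp add: C_def)
      then have "\<bar>k i f - k 0 f\<bar> \<le> 0"
        by (metis dense_ge)
      then show "k i f = k 0 f"
        by simp
    qed
    then have "\<forall>i<m. (k 0, y i) \<in> \<Omega>"
      using ky\<Omega> by metis
    moreover have yM: "y \<in> M"
      using ky(1) by (simp add: Z_def)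
    ultimately have "y \<in> \<D> \<inter> M"
      using M(1) by (auto simp: \<D>_def)
    moreover have "closed (\<D> \<inter> M)"
      using \<D>_closed by (intro closed_Int) (simp_all add: M_def)
    moreover have "?R g ` (\<D> \<inter> M) \<subseteq> \<D> \<inter> M" for g
      using \<D>_inv M(2) by blast
    \<comment> \<open>The common state was found only for some \<open>y\<close> in the orbit closure
      of \<open>z\<close>; minimality of \<open>M\<close> brings it back to
      \<open>z\<close>.\<close>
    ultimately have "\<D> \<inter> M = M"
      using M(4) unfolding minimal_sys_def by (metis empty_iff inf_le2)
    then show ?thesis
      using M(3) by blast
  qed
  have "?P \<subseteq> closure {f \<in> ?P. minimal_point ?P ?R f}"
    using inc by (simp add: incontractible_def)
  also have "\<dots> \<subseteq> \<D>"
    using min \<D>_closed by (intro closure_minimal) auto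
  finally show ?thesis
    using x by (auto simp: \<D>_def)
qed

text \<open>A closed invariant \<open>\<Omega>\<close> projects onto \<open>X\<close>. Finitely many
  of its sections share a state by \<open>incontractible_common_state\<close>, hence all do by
  compactness; their intersection is invariant and so equals \<open>\<Xi>\<close>. The contraction
  is inherited from the irreducible convex set \<open>\<Q>\<close>, while \<open>\<Xi>\<close>
  itself need not be convex.\<close>

lemma joint_minimal_incontractible:
  fixes X :: "'a::metric_space set" and T :: "'g::group_add \<Rightarrow> 'a \<Rightarrow> 'a" and K :: "'c::metric_space set"
  assumes X: "tds X T" "minimal_sys X T" and inc: "incontractible X T" and K: "tds K R" "K \<noteq> {}"
  obtains \<Xi> where "joint_minimal K R X T \<Xi>"
proof -
  have cS: "compact (states K)"
    by (rule compact_states[OF tds_compact[OF K(1)]])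
  have S0: "states K \<noteq> {}"
    using K(2) states_nonempty by blast
  have pS: "push_closed K R (states K) \<and> average_closed (states K)"
    using push_states[OF K(1)] states_average_closed by (simp add: push_closed_def)
  have Int: "push_closed K R (\<Inter>\<C>) \<and> average_closed (\<Inter>\<C>)"
    if "\<And>A. A \<in> \<C> \<Longrightarrow> push_closed K R A \<and> average_closed A" for \<C>
    using that push_closed_Inter[of \<C> K R] average_closed_Inter[of \<C>] by blast
  obtain \<Q> where Q: "closed \<Q>" "\<Q> \<subseteq> states K" "\<Q> \<noteq> {}" "push_closed K R \<Q>" "average_closed \<Q>"
    "\<And>A. closed A \<Longrightarrow> A \<subseteq> \<Q> \<Longrightarrow> A \<noteq> {} \<Longrightarrow> push_closed K R A \<Longrightarrow> average_closed A \<Longrightarrow> A = \<Q>"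
    using ex_minimal_closed[where P = "\<lambda>A. push_closed K R A \<and> average_closed A",
        OF cS closed_states S0 pS Int] by metis
  have cQ: "compact \<Q>"
    using compact_Int_closed[OF cS Q(1)] Q(2) by (simp add: Int_absorb1)
  obtain \<Xi> where \<Xi>: "closed \<Xi>" "\<Xi> \<subseteq> \<Q>" "\<Xi> \<noteq> {}" "push_closed K R \<Xi>"
    "\<And>A. closed A \<Longrightarrow> A \<subseteq> \<Xi> \<Longrightarrow> A \<noteq> {} \<Longrightarrow> push_closed K R A \<Longrightarrow> A = \<Xi>"
    using ex_minimal_closed[where P = "push_closed K R", OF cQ Q(1,3,4) push_closed_Inter] by metis
  have \<Xi>s: "\<Xi> \<subseteq> states K"
    using \<Xi>(2) Q(2) by blast
  have c\<Xi>: "compact \<Xi>"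
    using compact_Int_closed[OF cS \<Xi>(1)] \<Xi>s by (simp add: Int_absorb1)
  have cX: "compact X"
    using X(1) by (rule tds_compact)
  have contract: "\<exists>g. \<forall>i<m. \<forall>j<m. \<forall>f\<in>F. \<bar>push K R g (l i) f - push K R g (l j) f\<bar> \<le> e"
    if l: "\<And>i::nat. i < m \<Longrightarrow> l i \<in> \<Xi>" and F: "finite F" and e: "0 < (e::real)" for m l F e
  proof -
    have lQ: "l i \<in> \<Q>" if "i < m" for i
      using l[OF that] \<Xi>(2) by blast
    show ?thesis
    proof (rule irreducible_contract[OF K(1) Q(1-5) _ _ F e])
      show "A = \<Q>" if "closed A" "A \<subseteq> \<Q>" "A \<noteq> {}" "push_closed K R A" "average_closed A" for A
        by (rule Q(6)[OF that])
    qed (rule lQ)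
  qed
  have "\<Omega> = \<Xi> \<times> X" if \<Omega>: "closed \<Omega>" "\<Omega> \<subseteq> \<Xi> \<times> X" "\<Omega> \<noteq> {}"
    "\<And>g L a. (L, a) \<in> \<Omega> \<Longrightarrow> (push K R g L, T g a) \<in> \<Omega>" for \<Omega>
  proof -
    have "compact \<Omega>"
      using compact_Int_closed[OF compact_Times[OF c\<Xi> cX] \<Omega>(1)] \<Omega>(2) by (simp add: Int_absorb1)
    then have "compact (snd ` \<Omega>)"
      by (intro compact_continuous_image continuous_on_snd continuous_on_id)
    then have "closed (snd ` \<Omega>)"
      by (rule compact_imp_closed)
    moreover have "snd ` \<Omega> \<subseteq> X" "snd ` \<Omega> \<noteq> {}"
      using \<Omega>(2,3) by auto
    moreover have "T g ` snd ` \<Omega> \<subseteq> snd ` \<Omega>" for g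
    proof
      fix b assume "b \<in> T g ` snd ` \<Omega>"
      then obtain L a where "(L, a) \<in> \<Omega>" "b = T g a"
        by auto
      then have "(push K R g L, b) \<in> \<Omega>"
        using \<Omega>(4) by blast
      then show "b \<in> snd ` \<Omega>"
        by (metis image_eqI snd_conv)
    qed
    ultimately have proj: "snd ` \<Omega> = X"
      using X(2) by (simp add: minimal_sys_def)
    have onto: "\<exists>L. (L, a) \<in> \<Omega>" if "a \<in> X" for a
      using that unfolding proj[symmetric] by auto
    define sec where "sec a = {L. (L, a) \<in> \<Omega>}" for a
    have cl_sec: "closed (sec a)" for a
    proof -
      have "continuous_on UNIV (\<lambda>L :: 'c functional. (L, a))"
        by (intro continuous_on_Pair continuous_on_id continuous_on_const)
      from closed_vimage[OF \<Omega>(1) this] show ?thesis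
        by (simp add: sec_def vimage_def)
    qed
    have "\<Xi> \<inter> (\<Inter>a\<in>X. sec a) \<noteq> {}"
    proof (rule compact_imp_fip_image[OF c\<Xi> cl_sec])
      fix A assume A: "finite A" "A \<subseteq> X"
      define n where "n = card A"
      obtain h :: "nat \<Rightarrow> 'a" where h: "A = h ` {..<n}"
        unfolding n_def using A(1) by (metis ex_bij_betw_nat_finite bij_betw_imp_surj_on atLeast0LessThan)
      show "\<Xi> \<inter> (\<Inter>a\<in>A. sec a) \<noteq> {}"
      proof (cases "A = {}")
        case True
        then show ?thesis
          using \<Xi>(3) by simp
      next
        case False
        then have pos: "0 < n"
          using A(1) by (simp add: n_def card_gt_0_iff)
        have hP: "restrict h {..<n} \<in> tuples X n"
          using h A(2) by auto
        have "\<exists>L. \<forall>i<n. (L, restrict h {..<n} i) \<in> \<Omega>"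
        proof (rule incontractible_common_state[OF X(1) inc c\<Xi> \<Xi>(1) \<Xi>s \<Xi>(4) _ \<Omega>(1,2) _ _ pos hP])
          show "\<exists>g. \<forall>i<m. \<forall>j<m. \<forall>f\<in>F. \<bar>push K R g (l i) f - push K R g (l j) f\<bar> \<le> e"
            if "\<And>i::nat. i < m \<Longrightarrow> l i \<in> \<Xi>" "finite F" "0 < (e::real)" for m l F e
            by (rule contract[OF that])
        qed (fact \<Omega>(4), fact onto)
        then obtain L where L: "\<And>i. i < n \<Longrightarrow> (L, restrict h {..<n} i) \<in> \<Omega>"
          by blast
        have "L \<in> sec a" if a: "a \<in> A" for a
        proof -
          obtain i where "i < n" "a = h i"
            using h a by blast
          then show ?thesis
            using L[of i] by (simp add: sec_def)
        qed
        moreover have "L \<in> \<Xi>"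
          using L[OF pos] \<Omega>(2) by blast
        ultimately show ?thesis
          by blast
      qed
    qed
    then have ne: "\<Xi> \<inter> (\<Inter>a\<in>X. sec a) \<noteq> {}" .
    have "\<Xi> \<inter> (\<Inter>a\<in>X. sec a) = \<Xi>"
    proof (rule \<Xi>(5)[OF _ _ ne])
      show "closed (\<Xi> \<inter> (\<Inter>a\<in>X. sec a))"
        using \<Xi>(1) cl_sec by (intro closed_Int closed_INT) auto
      show "push_closed K R (\<Xi> \<inter> (\<Inter>a\<in>X. sec a))"
        unfolding push_closed_def
      proof (intro allI ballI)
        fix g L assume L: "L \<in> \<Xi> \<inter> (\<Inter>a\<in>X. sec a)"
        have "push K R g L \<in> sec b" if b: "b \<in> X" for b
        proof -
          have "(L, T (- g) b) \<in> \<Omega>"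
            using L tds_mem[OF X(1) b] by (auto simp: sec_def)
          then have "(push K R g L, T g (T (- g) b)) \<in> \<Omega>"
            by (rule \<Omega>(4))
          then show ?thesis
            by (simp add: sec_def tds_cancel[OF X(1) b])
        qed
        then show "push K R g L \<in> \<Xi> \<inter> (\<Inter>a\<in>X. sec a)"
          using L \<Xi>(4) by (auto simp: push_closed_def)
      qed
    qed simp
    then show ?thesis
      using \<Omega>(2) by (auto simp: sec_def)
  qed
  then have "joint_minimal K R X T \<Xi>"
    unfolding joint_minimal_def using \<Xi>(1,3,4) \<Xi>s by (fastforce simp: push_closed_def)
  then show ?thesis
    by (rule that)
qed

text \<open>Incontractibility puts a minimal tuple into \<open>V\<close>, and its orbit closure
  serves as \<open>K\<close>. Since \<open>K\<close> is minimal, \<open>push_closed_ex_pos\<close>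
  finds a state in \<open>\<Xi>\<close> that is positive at a bump around this tuple.\<close>

lemma bump_supply_incontractible:
  fixes X :: "'a::metric_space set" and T :: "'g::group_add \<Rightarrow> 'a \<Rightarrow> 'a"
  assumes X: "tds X T" "minimal_sys X T" and inc: "incontractible X T"
  shows "bump_supply X T N"
  unfolding bump_supply_def
proof (intro allI impI)
  fix V :: "(nat \<Rightarrow> 'a) set"
  let ?P = "tuples X N" and ?R = "tuple_act N T"
  assume V: "open V \<and> V \<inter> ?P \<noteq> {}"
  have P: "tds ?P ?R"
    by (rule tds_tuples[OF X(1)])
  have "?P \<subseteq> closure {f \<in> ?P. minimal_point ?P ?R f}"
    using inc by (simp add: incontractible_def)
  then have "V \<inter> closure {f \<in> ?P. minimal_point ?P ?R f} \<noteq> {}"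
    using V by blast
  then have "V \<inter> {f \<in> ?P. minimal_point ?P ?R f} \<noteq> {}"
    using V open_Int_closure_eq_empty by blast
  then obtain z where z: "z \<in> V" "z \<in> ?P" "minimal_point ?P ?R z"
    by blast
  define K where "K = closure (orbit ?R z)"
  have K: "K \<subseteq> ?P" "\<And>g. ?R g ` K \<subseteq> K" "z \<in> K" and Kmin: "minimal_sys K ?R"
    using closure_orbit_invariant[OF P z(2)] z(3) by (auto simp: K_def minimal_point_def)
  have cK: "compact K"
    using tds_compact[OF P] K(1) compact_Int_closed[of ?P K] by (simp add: K_def Int_absorb1)
  have tK: "tds K ?R"
    unfolding tds_def
  proof (intro conjI allI ballI)
    show "continuous_on K (?R g)" for g
      using tds_cont[OF P] K(1) by (rule continuous_on_subset)
    show "?R 0 x = x" if "x \<in> K" for x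
      using tds_zero[OF P] that K(1) by blast
    show "?R (g + h) x = ?R g (?R h x)" if "x \<in> K" for g h x
      using tds_add[OF P, of x g h] that K(1) by auto
  qed (use cK K(2) in auto)
  obtain \<Xi> where \<Xi>: "joint_minimal K ?R X T \<Xi>"
    using joint_minimal_incontractible[OF X inc tK] K(3) by blast
  have "\<exists>L\<in>\<Xi>. 0 < L b" if b: "continuous_on ?P b" "\<forall>x\<in>?P. 0 \<le> b x" "\<forall>x\<in>V \<inter> ?P. 0 < b x" for b
  proof -
    have cb: "continuous_on K b"
      using b(1) K(1) by (rule continuous_on_subset)
    have pc: "push_closed K ?R \<Xi>"
      using \<Xi> by (simp add: joint_minimal_def push_closed_def)
    obtain L where L: "L \<in> \<Xi>" "L \<in> states K"
      using \<Xi> by (auto simp: joint_minimal_def)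
    have bz: "0 < b z" and nn: "0 \<le> b x" if "x \<in> K" for x
      using b z K(1) that by blast+
    obtain L' where "L' \<in> \<Xi>" "0 < L' b"
      by (rule push_closed_ex_pos[where z = z, OF tK Kmin pc L cb])
        (erule nn, rule K(3), rule bz[OF K(3)], rule that)
    then show ?thesis
      by blast
  qed
  then show "\<exists>K \<Xi>. K \<subseteq> ?P \<and> tds K ?R \<and> joint_minimal K ?R X T \<Xi> \<and>
     (\<forall>b. continuous_on ?P b \<and> (\<forall>x\<in>?P. 0 \<le> b x) \<and> (\<forall>x\<in>V \<inter> ?P. 0 < b x) \<longrightarrow> (\<exists>L\<in>\<Xi>. 0 < L b))"
    using K(1) tK \<Xi> by (intro exI[of _ K] exI[of _ \<Xi>]) blast
qed

section \<open>Construction of independence sets\<close>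

lemma factor_map_minimal:
  assumes "factor_map X T Y S p" "minimal_sys X T"
  shows "minimal_sys Y S"
  unfolding minimal_sys_def
proof (intro conjI allI impI)
  have p: "tds X T" "tds Y S" "continuous_on X p" "p ` X = Y" "\<And>g x. x \<in> X \<Longrightarrow> p (T g x) = S g (p x)"
    using assms(1) by (auto simp: factor_map_def)
  show "Y \<noteq> {}"
    using assms(2) p(4) by (auto simp: minimal_sys_def)
  fix A assume A: "A \<subseteq> Y" "closed A" "A \<noteq> {}" "\<forall>g. S g ` A \<subseteq> A"
  have "closed (X \<inter> p -` A)"
    using p(1,3) A(2) by (simp add: continuous_closed_preimage compact_imp_closed tds_compact)
  moreover have "X \<inter> p -` A \<noteq> {}"
    using A(1,3) p(4) by blast
  moreover have "T g ` (X \<inter> p -` A) \<subseteq> X \<inter> p -` A" for g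
    using A(4) p(5) tds_mem[OF p(1)] by (auto simp: image_subset_iff)
  ultimately have "X \<inter> p -` A = X"
    using assms(2) unfolding minimal_sys_def by blast
  then show "A = Y"
    using A(1) p(4) by auto
qed

text \<open>Baire for finitely many sets: either \<open>V \<inter> Y\<close> lies in
  \<open>D k\<close>, or the open set \<open>V - D k\<close> still meets \<open>Y\<close> and is
  covered by the remaining sets.\<close>

lemma finite_closed_cover_interior:
  assumes "finite F" "open V" "V \<inter> Y \<noteq> {}" "V \<inter> Y \<subseteq> (\<Union>k\<in>F. D k)" "\<And>k. k \<in> F \<Longrightarrow> closed (D k)"
  shows "\<exists>k\<in>F. \<exists>W. open W \<and> W \<inter> Y \<noteq> {} \<and> W \<inter> Y \<subseteq> D k"
  using assms
proof (induction F arbitrary: V)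
  case (insert k F)
  show ?case
  proof (cases "V \<inter> Y \<subseteq> D k")
    case True
    then show ?thesis
      using insert.prems by blast
  next
    case False
    have "\<exists>k\<in>F. \<exists>W. open W \<and> W \<inter> Y \<noteq> {} \<and> W \<inter> Y \<subseteq> D k"
    proof (rule insert.IH)
      show "open (V - D k)"
        using insert.prems by (simp add: open_Diff)
      show "(V - D k) \<inter> Y \<noteq> {}"
        using False by blast
      show "(V - D k) \<inter> Y \<subseteq> (\<Union>k\<in>F. D k)"
        using insert.prems(3) by blast
    qed (use insert.prems in blast)
    then show ?thesis
      by blast
  qed
qed simp

text \<open>By minimality finitely many translates of a small compact ball inside \<open>U\<close>
  cover \<open>X\<close>, so translates of its image cover \<open>Y\<close>. One of them has
  interior, and translating back gives interior to the image of the ball itself.\<close>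

lemma factor_map_semi_open:
  assumes p: "factor_map X T Y S p" and min: "minimal_sys X T"
    and U: "openin (top_of_set X) U" "U \<noteq> {}"
  obtains W where "openin (top_of_set Y) W" "W \<noteq> {}" "W \<subseteq> p ` U"
proof -
  have X: "tds X T" "minimal_sys X T" and Y: "tds Y S" and pc: "continuous_on X p" "p ` X = Y"
    and pT: "\<And>g x. x \<in> X \<Longrightarrow> p (T g x) = S g (p x)"
    using p min by (auto simp: factor_map_def)
  obtain u where u: "u \<in> U"
    using U(2) by blast
  then have uX: "u \<in> X"
    using U(1) openin_imp_subset by blast
  obtain r where r: "r > 0" "cball u r \<inter> X \<subseteq> U"
    using U(1) u by (metis openin_contains_cball)
  define C where "C = X \<inter> cball u r"
  have C: "compact C" "C \<subseteq> U" "C \<subseteq> X"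
    using tds_compact[OF X(1)] r by (auto simp: C_def compact_Int_closed)
  obtain F where F: "finite F" "F \<noteq> {}" "\<And>x z. x \<in> X \<Longrightarrow> z \<in> X \<Longrightarrow> \<exists>k\<in>F. dist (T k x) z < r"
    using minimal_sys_finite_hits[OF X r(1)] by metis
  define D where "D k = S (- k) ` p ` C" for k
  have "closed (D k)" for k
  proof -
    have "compact (p ` C)"
      using C pc(1) by (intro compact_continuous_image continuous_on_subset[OF pc(1)]) auto
    moreover have "continuous_on (p ` C) (S (- k))"
      using C(3) pc(2) by (intro continuous_on_subset[OF tds_cont[OF Y]]) blast
    ultimately show ?thesis
      unfolding D_def by (simp add: compact_continuous_image compact_imp_closed)
  qed
  moreover have "UNIV \<inter> Y \<subseteq> (\<Union>k\<in>F. D k)"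
  proof
    fix y assume "y \<in> UNIV \<inter> Y"
    then obtain x where x: "x \<in> X" "y = p x"
      using pc(2) by blast
    obtain k where k: "k \<in> F" "dist (T k x) u < r"
      using F(3)[OF x(1) uX] by blast
    have "T k x \<in> C"
      using k(2) tds_mem[OF X(1) x(1)] by (simp add: C_def dist_commute)
    moreover have "y = S (- k) (p (T k x))"
      using pT[OF x(1)] tds_cancel(1)[OF Y] x pc(2) by auto
    ultimately have "y \<in> D k"
      unfolding D_def by blast
    then show "y \<in> (\<Union>k\<in>F. D k)"
      using k(1) by blast
  qed
  moreover have "UNIV \<inter> Y \<noteq> {}"
    using uX pc(2) by blast
  ultimately obtain k W where W: "open W" "W \<inter> Y \<noteq> {}" "W \<inter> Y \<subseteq> D k"
    using finite_closed_cover_interior[OF F(1) open_UNIV] by metis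
  show ?thesis
  proof (rule that[of "Y \<inter> S (- k) -` (W \<inter> Y)"])
    show "openin (top_of_set Y) (Y \<inter> S (- k) -` (W \<inter> Y))"
    proof (rule continuous_openin_preimage[OF tds_cont[OF Y]])
      show "openin (top_of_set Y) (W \<inter> Y)"
        using openin_open_Int[OF W(1), of Y] by (simp add: Int_commute)
    qed (use tds_mem[OF Y] in auto)
    obtain y where y: "y \<in> W" "y \<in> Y"
      using W(2) by blast
    then have "S k y \<in> Y \<inter> S (- k) -` (W \<inter> Y)"
      using tds_cancel(1)[OF Y] tds_mem[OF Y] by simp
    then show "Y \<inter> S (- k) -` (W \<inter> Y) \<noteq> {}"
      by blast
    show "Y \<inter> S (- k) -` (W \<inter> Y) \<subseteq> p ` U"
    proof
      fix y assume y: "y \<in> Y \<inter> S (- k) -` (W \<inter> Y)"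
      then have "S (- k) y \<in> D k"
        using W(3) by blast
      then obtain x where x: "x \<in> C" "S (- k) y = S (- k) (p x)"
        by (auto simp: D_def)
      then have "p x \<in> Y"
        using C(3) pc(2) by blast
      then have "y = p x"
        using x(2) y tds_cancel(2)[OF Y] by (metis IntD1)
      then show "y \<in> p ` U"
        using x(1) C(2) by blast
    qed
  qed
qed

lemma finite_common_radius:
  fixes P :: "'i \<Rightarrow> real \<Rightarrow> bool"
  assumes "finite I" "\<And>i. i \<in> I \<Longrightarrow> \<exists>r>0. P i r" "\<And>i r r'. P i r \<Longrightarrow> 0 < r' \<Longrightarrow> r' \<le> r \<Longrightarrow> P i r'"
  shows "\<exists>r>0. \<forall>i\<in>I. P i r"
  using assms(1,2)
proof (induction I)
  case empty
  show ?case
    by (intro exI[of _ 1]) simp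
next
  case (insert i I)
  then obtain r r' where r: "r > 0" "\<forall>i\<in>I. P i r" "r' > 0" "P i r'"
    by (meson insertCI)
  have "P j (min r r')" if "j \<in> insert i I" for j
    using that r assms(3)[of j r "min r r'"] assms(3)[of i r' "min r r'"] by auto
  then show ?case
    using r by (intro exI[of _ "min r r'"]) auto
qed

section \<open>Cylinders and the extension of an independence set by one element\<close>

definition cylinder ::
  "'a set \<Rightarrow> ('g \<Rightarrow> 'a \<Rightarrow> 'a) \<Rightarrow> (nat \<Rightarrow> 'a set) \<Rightarrow> 'g list \<Rightarrow> nat list \<Rightarrow> 'a set" where
  "cylinder X T U gs s = {x \<in> X. \<forall>i<length gs. T (gs ! i) x \<in> U (s ! i)}"

definition words :: "nat \<Rightarrow> nat \<Rightarrow> nat list set" where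
  "words k n = {s. set s \<subseteq> {..<k} \<and> length s = n}"

lemma cylinder_open:
  assumes "tds X T" "\<And>j. j < k \<Longrightarrow> open (U j)" "s \<in> words k (length gs)"
  shows "openin (top_of_set X) (cylinder X T U gs s)"
proof -
  have "openin (top_of_set X) (X \<inter> T (gs ! i) -` U (s ! i))" if "i < length gs" for i
  proof -
    have "s ! i < k"
      using assms(3) that nth_mem[of i s] by (force simp: words_def)
    then show ?thesis
      using assms(2) tds_cont[OF assms(1)] by (intro continuous_openin_preimage_gen) auto
  qed
  then have "openin (top_of_set X) (topspace (top_of_set X) \<inter> (\<Inter>i\<in>{..<length gs}. X \<inter> T (gs ! i) -` U (s ! i)))"
    by (intro openin_Int_Inter) auto
  moreover have "topspace (top_of_set X) \<inter> (\<Inter>i\<in>{..<length gs}. X \<inter> T (gs ! i) -` U (s ! i)) = cylinder X T U gs s"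
    by (auto simp: cylinder_def)
  ultimately show ?thesis
    by simp
qed

text \<open>The points \<open>c\<close> are not part of the data: each stage chooses them anew,
  close to those of the stage before.\<close>

definition extendable ::
  "'a::metric_space set \<Rightarrow> ('g::group_add \<Rightarrow> 'a \<Rightarrow> 'a) \<Rightarrow> 'b::metric_space set \<Rightarrow> ('g \<Rightarrow> 'b \<Rightarrow> 'b) \<Rightarrow> ('a \<Rightarrow> 'b)
    \<Rightarrow> (nat \<Rightarrow> 'a set) \<Rightarrow> nat \<Rightarrow> 'b set \<Rightarrow> 'g list \<Rightarrow> bool" where
  "extendable X T Y S p U k A gs \<longleftrightarrow> distinct gs \<and>
     (\<exists>c. (\<forall>s\<in>words k (length gs). \<exists>W. openin (top_of_set Y) W \<and> c s \<in> W \<and> W \<subseteq> p ` cylinder X T U gs s) \<and>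
        often_near S A (words k (length gs)) c)"

lemma extendable_step:
  fixes X :: "'a::metric_space set" and T :: "'g::group_add \<Rightarrow> 'a \<Rightarrow> 'a"
    and Y :: "'b::metric_space set"
  assumes X: "tds X T" "minimal_sys X T" and max: "max_eq_factor X T Y S p" and \<nu>: "inv_measure Y S \<nu>"
    and bumps: "\<And>N. bump_supply X T N"
    and U: "\<And>j. j < k \<Longrightarrow> open (U j)" "i0 < k" "j0 < k" "U i0 \<inter> U j0 = {}"
    and A: "closed A" "A \<subseteq> Y" "A \<noteq> {}" "\<And>j. j < k \<Longrightarrow> A \<subseteq> closure (p ` (U j \<inter> X))"
    and ext: "extendable X T Y S p U k A gs"
  shows "\<exists>g. extendable X T Y S p U k A (gs @ [g])"
proof -
  have fm: "factor_map X T Y S p" and eq: "equicontinuous_sys Y S"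
    using max by (auto simp: max_eq_factor_def)
  have Y: "tds Y S" "minimal_sys Y S" and pc: "continuous_on X p" "p ` X = Y"
    and pT: "\<And>g x. x \<in> X \<Longrightarrow> p (T g x) = S g (p x)"
    using fm factor_map_minimal[OF fm X(2)] by (auto simp: factor_map_def)
  define n where "n = length gs"
  obtain c where dist: "distinct gs"
    and c: "\<And>s. s \<in> words k n \<Longrightarrow> \<exists>W. openin (top_of_set Y) W \<and> c s \<in> W \<and> W \<subseteq> p ` cylinder X T U gs s"
    and near: "often_near S A (words k n) c"
    using ext unfolding extendable_def n_def by blast
  have fin: "finite (words k m)" for m
    unfolding words_def by (rule finite_lists_length_eq) simp
  have butlast: "butlast t \<in> words k n" if "t \<in> words k (Suc n)" for t
    using that by (auto simp: words_def dest: in_set_butlastD)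
  have snoc: "s @ [j] \<in> words k (Suc n)" if "s \<in> words k n" "j < k" for s j
    using that by (auto simp: words_def)
  have cY: "c s \<in> Y" if "s \<in> words k n" for s
    using c[OF that] openin_imp_subset by blast
  \<comment> \<open>A longer word first takes over the point of its parent; later that point is
    moved by less than \<open>d\<close> into the interior of the image of the smaller
    cylinder.\<close>
  have "often_near S A (words k (Suc n)) (\<lambda>t. c (butlast t))"
    by (rule often_near_reindex[OF near, of _ butlast]) (simp add: butlast)
  then obtain d where d: "d > 0" "\<And>c'. (\<And>t. t \<in> words k (Suc n) \<Longrightarrow> c' t \<in> Y \<and> dist (c (butlast t)) (c' t) < d) \<Longrightarrow>
      often_near S A (words k (Suc n)) c'"
    using often_near_open[OF Y eq \<nu> A(1-3) fin, of "Suc n" "\<lambda>t. c (butlast t)"] cY butlast by metis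
  have "\<exists>r>0. \<forall>s\<in>words k n. ball (c s) r \<inter> Y \<subseteq> p ` cylinder X T U gs s"
  proof (rule finite_common_radius[OF fin])
    fix s assume "s \<in> words k n"
    then obtain W where W: "openin (top_of_set Y) W" "c s \<in> W" "W \<subseteq> p ` cylinder X T U gs s"
      using c by blast
    then obtain r where "r > 0" "ball (c s) r \<inter> Y \<subseteq> W"
      by (metis openin_contains_ball)
    then show "\<exists>r>0. ball (c s) r \<inter> Y \<subseteq> p ` cylinder X T U gs s"
      using W(3) by blast
  qed (meson Int_mono order_refl order_trans subset_ball)
  then obtain r0 where r0: "r0 > 0" "\<And>s. s \<in> words k n \<Longrightarrow> ball (c s) r0 \<inter> Y \<subseteq> p ` cylinder X T U gs s"
    by blast
  \<comment> \<open>\<open>r0\<close> keeps the balls inside the images of the cylinders, so that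
    they can serve as \<open>W\<close> in \<open>relative_mixing\<close>; \<open>d\<close> limits
    the later move of the points.\<close>
  define r where "r = min r0 d"
  have r: "r > 0" "r \<le> d"
    using r0(1) d(1) by (auto simp: r_def)
  have r': "ball (c s) r \<inter> Y \<subseteq> p ` cylinder X T U gs s" if "s \<in> words k n" for s
  proof -
    have "ball (c s) r \<subseteq> ball (c s) r0"
      by (rule subset_ball) (simp add: r_def)
    then show ?thesis
      using r0(2)[OF that] by blast
  qed
  obtain \<rho> where \<rho>: "\<rho> > 0" "\<And>y z g. y \<in> Y \<Longrightarrow> z \<in> Y \<Longrightarrow> dist y z < \<rho> \<Longrightarrow> dist (S g y) (S g z) < r"
    using eq r(1) unfolding equicontinuous_sys_def by meson
  obtain g0 where g0: "\<And>s. s \<in> words k n \<Longrightarrow> infdist (S g0 (c s)) A < \<rho> / 2"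
    using often_near_ex[OF near, of "\<rho> / 2"] \<rho>(1) by (metis half_gt_zero)
  \<comment> \<open>\<open>A\<close> lies in the closure of the image of \<open>U j\<close>, so some
    \<open>x\<close> in \<open>U j\<close> lies over a point close to \<open>S g0 (c s)\<close>.
    Pulled back by \<open>- g0\<close> it lies over the ball around \<open>c s\<close>, where
    relative mixing can reach it.\<close>
  have target: "\<exists>v. v \<in> X \<and> T g0 v \<in> U j \<and> dist (c s) (p v) < r" if s: "s \<in> words k n" and j: "j < k" for s j
  proof -
    obtain a where a: "a \<in> A" "dist (S g0 (c s)) a < \<rho> / 2"
      using g0[OF s] A(3) infdist_notempty[OF A(3)] by (metis cINF_less_iff bdd_below_image_dist)
    have "a \<in> closure (p ` (U j \<inter> X))"
      using A(4)[OF j] a(1) by blast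
    then obtain x where x: "x \<in> U j" "x \<in> X" "dist (p x) a < \<rho> / 2"
      using \<rho>(1) unfolding closure_approachable by (metis (no_types, lifting) IntE half_gt_zero imageE)
    have pxY: "p x \<in> Y"
      using x(2) pc(2) by blast
    have "dist (S g0 (c s)) (p x) < \<rho>"
      using a(2) x(3) dist_triangle_half_r[of a "S g0 (c s)" \<rho> "p x"] by (simp add: dist_commute)
    then have "dist (S (- g0) (S g0 (c s))) (S (- g0) (p x)) < r"
      by (rule \<rho>(2)[OF tds_mem[OF Y(1) cY[OF s]] pxY])
    then have "dist (c s) (p (T (- g0) x)) < r"
      using tds_cancel(1)[OF Y(1) cY[OF s]] pT[OF x(2)] by simp
    then show ?thesis
      using tds_cancel(2)[OF X(1) x(2)] tds_mem[OF X(1) x(2)] x(1) by (intro exI[of _ "T (- g0) x"]) simp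
  qed
  have "\<forall>w. \<exists>v. w \<in> words k n \<times> {..<k} \<longrightarrow> v \<in> X \<and> T g0 v \<in> U (snd w) \<and> dist (c (fst w)) (p v) < r"
    using target by fastforce
  from choice[OF this] obtain v where v: "\<And>w. w \<in> words k n \<times> {..<k} \<Longrightarrow>
      v w \<in> X \<and> T g0 (v w) \<in> U (snd w) \<and> dist (c (fst w)) (p (v w)) < r"
    by blast
  define Q where "Q s = cylinder X T U gs s \<inter> (X \<inter> p -` ball (c s) r)" for s
  have Q_open: "openin (top_of_set X) (Q s)" if "s \<in> words k n" for s
  proof -
    have "openin (top_of_set X) (X \<inter> p -` ball (c s) r)"
      by (intro continuous_openin_preimage_gen pc(1)) simp
    moreover have "openin (top_of_set X) (cylinder X T U gs s)"
    proof (rule cylinder_open[OF X(1)])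
      show "s \<in> words k (length gs)"
        using that by (simp add: n_def)
    qed (rule U(1))
    ultimately show ?thesis
      unfolding Q_def by (rule openin_Int[rotated])
  qed
  define N where "N = card (words k n \<times> {..<k})"
  have finp: "finite (words k n \<times> {..<k})"
    using fin by simp
  obtain h where h: "bij_betw h {..<N} (words k n \<times> {..<k})"
    using ex_bij_betw_nat_finite[OF finp] by (auto simp: N_def atLeast0LessThan)
  have hw: "h m \<in> words k n \<times> {..<k}" if "m < N" for m
    using h that by (auto simp: bij_betw_def)
  \<comment> \<open>One coordinate for each pair of a word and a letter, so that a single
    \<open>g1\<close> serves all of them. The targets are preimages under \<open>T g0\<close>; thus
    \<open>g0 + g1\<close> leads into \<open>U j\<close>.\<close>
  obtain g1 where g1: "\<And>m. m < N \<Longrightarrow> \<exists>x\<in>Q (fst (h m)). T g1 x \<in> X \<inter> T g0 -` U (snd (h m))"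
  proof (rule relative_mixing[OF X max bumps, where N = N and Q = "\<lambda>m. Q (fst (h m))"
        and V = "\<lambda>m. X \<inter> T g0 -` U (snd (h m))" and W = "\<lambda>m. Y \<inter> ball (c (fst (h m))) r"
        and v = "\<lambda>m. v (h m)"])
    fix m assume m: "m < N"
    note hm = hw[OF m]
    have s: "fst (h m) \<in> words k n" and j: "snd (h m) < k"
      using hm by auto
    show "openin (top_of_set X) (Q (fst (h m)))"
      by (rule Q_open[OF s])
    show "openin (top_of_set X) (X \<inter> T g0 -` U (snd (h m)))"
      by (intro continuous_openin_preimage_gen tds_cont[OF X(1)] U(1) j)
    show "openin (top_of_set Y) (Y \<inter> ball (c (fst (h m))) r)"
      by (intro openin_open_Int) simp
    show "Y \<inter> ball (c (fst (h m))) r \<subseteq> p ` Q (fst (h m))"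
    proof
      fix y assume y: "y \<in> Y \<inter> ball (c (fst (h m))) r"
      then obtain x where "x \<in> cylinder X T U gs (fst (h m))" "y = p x"
        using r'[OF s] by blast
      then show "y \<in> p ` Q (fst (h m))"
        using y by (auto simp: Q_def cylinder_def)
    qed
    show "v (h m) \<in> X \<inter> T g0 -` U (snd (h m))" "p (v (h m)) \<in> Y \<inter> ball (c (fst (h m))) r"
      using v[OF hm] pc(2) by auto
  qed (use that in blast)
  define g where "g = g0 + g1"
  have hit: "\<exists>x\<in>Q s. T g x \<in> U j" if s: "s \<in> words k n" and j: "j < k" for s j
  proof -
    have "(s, j) \<in> h ` {..<N}"
      using h s j by (simp add: bij_betw_def)
    then obtain m where m: "m < N" "h m = (s, j)"
      by auto
    obtain x where x: "x \<in> Q s" "T g1 x \<in> X \<inter> T g0 -` U j"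
      using g1[OF m(1)] m(2) by auto
    then have "x \<in> X"
      by (simp add: Q_def)
    then have "T g x \<in> U j"
      using x(2) tds_add[OF X(1), of x g0 g1] by (simp add: g_def)
    then show ?thesis
      using x(1) by blast
  qed
  have snoc_cyl: "cylinder X T U (gs @ [g]) (s @ [j]) = cylinder X T U gs s \<inter> (X \<inter> T g -` U j)"
    if "s \<in> words k n" for s j
    using that by (auto simp: cylinder_def words_def n_def nth_append less_Suc_eq)
  \<comment> \<open>If \<open>g\<close> were already in the list, a point in the cylinder of the
    constant word \<open>i0\<close> would be sent into \<open>U i0\<close> by \<open>g\<close>,
    while \<open>hit\<close> provides such a point that goes to \<open>U j0\<close>.\<close>
  have "g \<notin> set gs"
  proof
    assume "g \<in> set gs"
    then obtain i where i: "i < n" "g = gs ! i"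
      by (auto simp: n_def in_set_conv_nth)
    have w: "replicate n i0 \<in> words k n"
      using U(2) by (auto simp: words_def)
    obtain x where x: "x \<in> Q (replicate n i0)" "T g x \<in> U j0"
      using hit[OF w U(3)] by blast
    then have "T (gs ! i) x \<in> U (replicate n i0 ! i)"
      using i(1) by (simp add: Q_def cylinder_def n_def)
    then show False
      using x(2) i U(4) by auto
  qed
  then have dist': "distinct (gs @ [g])"
    using dist by simp
  have "\<exists>y W. openin (top_of_set Y) W \<and> y \<in> W \<and> W \<subseteq> p ` cylinder X T U (gs @ [g]) t \<and> dist (c (butlast t)) y < d"
    if t: "t \<in> words k (Suc n)" for t
  proof -
    obtain s j where sj: "t = s @ [j]" "s \<in> words k n" "j < k"
    proof -
      have "t \<noteq> []"
        using t by (auto simp: words_def)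
      then have "t = butlast t @ [last t]" "last t < k"
        using t by (auto simp: words_def subset_iff)
      then show thesis
        using that butlast[OF t] by blast
    qed
    \<comment> \<open>The intersection with \<open>Q s\<close>, and not just with the cylinder,
      keeps the image inside the ball around \<open>c s\<close>, so any interior point of this image
      is an admissible new point.\<close>
    define O1 where "O1 = Q s \<inter> (X \<inter> T g -` U j)"
    have "openin (top_of_set X) O1"
      unfolding O1_def
      by (intro openin_Int Q_open sj continuous_openin_preimage_gen tds_cont[OF X(1)] U(1))
    moreover have "O1 \<noteq> {}"
      using hit[OF sj(2,3)] by (auto simp: O1_def Q_def)
    ultimately obtain W where W: "openin (top_of_set Y) W" "W \<noteq> {}" "W \<subseteq> p ` O1"
      using factor_map_semi_open[OF fm X(2)] by metis
    obtain y where y: "y \<in> W"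
      using W(2) by blast
    have "O1 \<subseteq> cylinder X T U (gs @ [g]) t"
      unfolding sj(1) snoc_cyl[OF sj(2)] by (auto simp: O1_def Q_def)
    moreover have "dist (c s) y < r"
      using y W(3) by (auto simp: O1_def Q_def)
    ultimately show ?thesis
      using W y r(2) sj(1) by (intro exI[of _ y] exI[of _ W]) auto
  qed
  then have "\<forall>t. \<exists>y. t \<in> words k (Suc n) \<longrightarrow> (\<exists>W. openin (top_of_set Y) W \<and> y \<in> W \<and>
      W \<subseteq> p ` cylinder X T U (gs @ [g]) t) \<and> dist (c (butlast t)) y < d"
    by blast
  from choice[OF this] obtain c' where c': "\<And>t. t \<in> words k (Suc n) \<Longrightarrow>
      (\<exists>W. openin (top_of_set Y) W \<and> c' t \<in> W \<and> W \<subseteq> p ` cylinder X T U (gs @ [g]) t) \<and> dist (c (butlast t)) (c' t) < d"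
    by blast
  have "often_near S A (words k (Suc n)) c'"
  proof (rule d(2))
    fix t assume t: "t \<in> words k (Suc n)"
    show "c' t \<in> Y \<and> dist (c (butlast t)) (c' t) < d"
      using c'[OF t] openin_imp_subset by blast
  qed
  then have "extendable X T Y S p U k A (gs @ [g])"
    unfolding extendable_def using dist' c' by (auto simp: n_def)
  then show ?thesis
    by blast
qed

lemma infinite_independence:
  fixes X :: "'a::metric_space set" and T :: "'g::group_add \<Rightarrow> 'a \<Rightarrow> 'a"
    and Y :: "'b::metric_space set"
  assumes X: "tds X T" "minimal_sys X T" and max: "max_eq_factor X T Y S p" and \<nu>: "inv_measure Y S \<nu>"
    and bumps: "\<And>N. bump_supply X T N"
    and U: "\<And>j. j < k \<Longrightarrow> open (U j)" "i0 < (k::nat)" "j0 < k" "U i0 \<inter> U j0 = {}"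
    and A: "closed A" "A \<subseteq> Y" "measure \<nu> A > 0" "\<And>j. j < k \<Longrightarrow> A \<subseteq> closure (p ` (U j \<inter> X))"
  shows "\<exists>J. infinite J \<and> (\<forall>I \<sigma>. finite I \<and> I \<subseteq> J \<and> (\<forall>g\<in>I. \<sigma> g < k) \<longrightarrow>
    (\<exists>x\<in>X. \<forall>g\<in>I. T g x \<in> U (\<sigma> g)))"
proof -
  have fm: "factor_map X T Y S p"
    using max by (auto simp: max_eq_factor_def)
  have Y: "tds Y S" "minimal_sys Y S" and pc: "p ` X = Y"
    using fm factor_map_minimal[OF fm X(2)] by (auto simp: factor_map_def)
  have A0: "A \<noteq> {}"
    using A(3) by auto
  then obtain y0 where y0: "y0 \<in> Y"
    using A(2) by blast
  let ?E = "extendable X T Y S p U k A"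
  \<comment> \<open>The only word of length 0 has all of \<open>X\<close> as its cylinder, so any
    point of \<open>Y\<close> is interior to the image; positive measure of \<open>A\<close>
    supplies the recurrence.\<close>
  have "?E []"
  proof -
    have w: "words k 0 = {[]}"
      by (auto simp: words_def)
    have "cylinder X T U [] s = X" for s
      by (simp add: cylinder_def)
    moreover have "often_near S A {[]} (\<lambda>_ :: nat list. y0)"
      by (rule often_near_single[OF Y \<nu> A(1-3)]) (rule y0)
    ultimately show ?thesis
      unfolding extendable_def using y0 pc by (auto simp: w intro!: exI[of _ "\<lambda>_. y0"] exI[of _ Y])
  qed
  moreover have "\<exists>gs'. ?E gs' \<and> (\<exists>g. gs' = gs @ [g])" if "?E gs" for gs
    using extendable_step[OF X max \<nu> bumps U A(1,2) A0 A(4) that] by blast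
  ultimately obtain f where f: "\<And>n. ?E (f n)" "\<And>n. \<exists>g. f (Suc n) = f n @ [g]" "f 0 = []"
    using dependent_nat_choice[of "\<lambda>n gs. ?E gs \<and> (n = 0 \<longrightarrow> gs = [])" "\<lambda>n gs gs'. \<exists>g. gs' = gs @ [g]"]
    by auto
  have len: "length (f n) = n" for n
  proof (induction n)
    case (Suc n)
    then show ?case
      using f(2)[of n] by auto
  qed (simp add: f(3))
  have mono: "set (f m) \<subseteq> set (f n)" if "m \<le> n" for m n
    using that
  proof (induction n rule: dec_induct)
    case (step n)
    then show ?case
      using f(2)[of n] by auto
  qed simp
  have card: "card (set (f n)) = n" for n
    using f(1)[of n] len[of n] by (simp add: extendable_def distinct_card)
  define J where "J = (\<Union>n. set (f n))"
  have "infinite J"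
  proof
    assume "finite J"
    then have "card (set (f (Suc (card J)))) \<le> card J"
      by (intro card_mono) (auto simp: J_def)
    then show False
      by (simp add: card)
  qed
  moreover have indep: "\<exists>x\<in>X. \<forall>g\<in>I. T g x \<in> U (\<sigma> g)"
    if I: "finite I" "I \<subseteq> J" and \<sigma>: "\<And>g. g \<in> I \<Longrightarrow> \<sigma> g < k" for I \<sigma>
  proof -
    have "\<exists>n. I \<subseteq> set (f n)"
      using I
    proof (induction I)
      case (insert g I)
      then obtain n m where "I \<subseteq> set (f n)" "g \<in> set (f m)"
        by (auto simp: J_def)
      then have "insert g I \<subseteq> set (f (max n m))"
        using mono[of n "max n m"] mono[of m "max n m"] by auto
      then show ?case
        by blast
    qed simp
    then obtain n where n: "I \<subseteq> set (f n)"
      by blast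
    \<comment> \<open>A word has to prescribe a letter at every element of the list; outside
      \<open>I\<close> it is filled up with \<open>i0\<close>.\<close>
    define s where "s = map (\<lambda>g. if g \<in> I then \<sigma> g else i0) (f n)"
    have "s \<in> words k (length (f n))"
      using \<sigma> U(2) by (auto simp: s_def words_def)
    then have "cylinder X T U (f n) s \<noteq> {}"
      using f(1)[of n] unfolding extendable_def by blast
    then obtain x where x: "x \<in> X" "\<And>i. i < length (f n) \<Longrightarrow> T (f n ! i) x \<in> U (s ! i)"
      by (auto simp: cylinder_def)
    have "T g x \<in> U (\<sigma> g)" if g: "g \<in> I" for g
    proof -
      obtain i where i: "i < length (f n)" "f n ! i = g"
        using n g by (metis in_set_conv_nth subsetD)
      then show ?thesis
        using x(2)[OF i(1)] g by (simp add: s_def)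
    qed
    then show ?thesis
      using x(1) by blast
  qed
  ultimately show ?thesis
    by (intro exI[of _ J] conjI allI impI) (simp, elim conjE, rule indep, simp_all)
qed

section \<open>Return times, full support, and the passage to fibres\<close>

lemma infinite_return_times:
  fixes T :: "'g::group_add \<Rightarrow> 'a::metric_space \<Rightarrow> 'a"
  assumes inf: "infinite (UNIV :: 'g set)" and X: "tds X T" "minimal_sys X T" and z: "z \<in> X"
    and U: "open U" "z \<in> U"
  shows "infinite {g. T g z \<in> U}"
proof
  assume fin: "finite {g. T g z \<in> U}"
  obtain r where r: "r > 0" "ball z r \<subseteq> U"
    using U openE by blast
  obtain F where F: "finite F" "F \<noteq> {}" "\<And>x y. x \<in> X \<Longrightarrow> y \<in> X \<Longrightarrow> \<exists>k\<in>F. dist (T k x) y < r"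
    using minimal_sys_finite_hits[OF X r(1)] by metis
  \<comment> \<open>Every \<open>g\<close> becomes a return time after adding some \<open>k\<close>
    in \<open>F\<close> on the left, so finitely many return times would make the group
    finite.\<close>
  have "UNIV \<subseteq> (\<lambda>(k, h). - k + h) ` (F \<times> {g. T g z \<in> U})"
  proof
    fix g :: 'g
    obtain k where k: "k \<in> F" "dist (T k (T g z)) z < r"
      using F(3)[OF tds_mem[OF X(1) z] z] by blast
    then have "T (k + g) z \<in> U"
      using r(2) tds_add[OF X(1) z] by (auto simp: dist_commute)
    moreover have "g = - k + (k + g)"
      by (simp add: add.assoc[symmetric])
    ultimately show "g \<in> (\<lambda>(k, h). - k + h) ` (F \<times> {g. T g z \<in> U})"
      using k(1) by (metis (mono_tags, lifting) SigmaI case_prod_conv image_eqI mem_Collect_eq)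
  qed
  then have "finite (UNIV :: 'g set)"
    using F(1) fin by (meson finite_SigmaI finite_imageI finite_subset)
  then show False
    using inf by simp
qed

text \<open>Full support of \<open>\<nu>\<close> is what turns a set of full measure into a dense
  one.\<close>

lemma inv_measure_open_pos:
  assumes Y: "tds Y S" "minimal_sys Y S" and \<nu>: "inv_measure Y S \<nu>" and V: "open V" "V \<inter> Y \<noteq> {}"
  shows "V \<inter> Y \<notin> null_sets \<nu>"
proof
  assume null: "V \<inter> Y \<in> null_sets \<nu>"
  have sp: "space \<nu> = Y"
    using \<nu> by (simp add: inv_measure_def)
  obtain t where t: "t \<in> V" "t \<in> Y"
    using V(2) by blast
  have "closed Y"
    using Y(1) compact_imp_closed tds_compact by blast
  then obtain b where b: "continuous_on Y b" "\<And>x. 0 \<le> b x" "\<And>x. b x \<le> (1::real)"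
    "\<And>x. x \<in> Y \<Longrightarrow> 0 < b x \<longleftrightarrow> x \<in> V"
    using ex_bump[OF _ V(1)] by metis
  have "0 < (\<integral>y. b y \<partial>\<nu>)"
    using inv_measure_integral_pos[OF Y \<nu> b(1) _ t(2)] b(2) b(4)[OF t(2)] t(1) by blast
  moreover have "AE y in \<nu>. b y = 0"
  proof (rule AE_I'[OF null])
    show "{y \<in> space \<nu>. b y \<noteq> 0} \<subseteq> V \<inter> Y"
      using b(2,4) by (force simp: sp less_le)
  qed
  then have "(\<integral>y. b y \<partial>\<nu>) = 0"
    by (rule integral_eq_zero_AE)
  ultimately show False
    by simp
qed

lemma IT_set_fibre:
  fixes X :: "'a::metric_space set" and T :: "'g::group_add \<Rightarrow> 'a \<Rightarrow> 'a"
    and Y :: "'b::metric_space set" and B :: "nat \<Rightarrow> 'a set"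
  assumes inf: "infinite (UNIV :: 'g set)"
    and X: "tds X T" "minimal_sys X T" and max: "max_eq_factor X T Y S p" and \<nu>: "inv_measure Y S \<nu>"
    and bumps: "\<And>N. bump_supply X T N"
    and B: "\<And>k. open (B k)" "\<And>x V. x \<in> X \<Longrightarrow> open V \<Longrightarrow> x \<in> V \<Longrightarrow> \<exists>k. x \<in> B k \<and> B k \<subseteq> V"
    and y: "y \<in> Y" "\<And>F. finite F \<Longrightarrow> measure \<nu> (Y \<inter> (\<Inter>k\<in>F. closure (p ` (B k \<inter> X)))) = 0 \<Longrightarrow>
      y \<notin> Y \<inter> (\<Inter>k\<in>F. closure (p ` (B k \<inter> X)))"
  shows "IT_set X T {x \<in> X. p x = y}"
  unfolding IT_set_def IT_tuple_def
proof (intro conjI allI impI; (elim conjE)?)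
  have Yc: "tds Y S" and pX: "p ` X = Y"
    using max by (auto simp: max_eq_factor_def factor_map_def)
  show "{x \<in> X. p x = y} \<noteq> {}"
    using y(1) pX by blast
  fix xs :: "'a list" and Us :: "'a set list"
  assume xs: "xs \<noteq> []" "set xs \<subseteq> {x \<in> X. p x = y}" and len: "length Us = length xs"
    and Us: "\<forall>k<length xs. open (Us ! k) \<and> xs ! k \<in> Us ! k"
  let ?n = "length xs"
  have xsX: "xs ! k \<in> X" "p (xs ! k) = y" if "k < ?n" for k
    using xs(2) nth_mem[OF that] by auto
  have n: "0 < ?n"
    using xs(1) by simp
  show "\<exists>J. infinite J \<and> indep_set X T (map (\<lambda>U. U \<inter> X) Us) J"
  \<comment> \<open>Equal entries admit no disjoint neighbourhoods, as
    \<open>infinite_independence\<close> would require. For them a single point that returns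
    infinitely often to the common neighbourhood is enough.\<close>
  proof (cases "\<forall>k<?n. xs ! k = xs ! 0")
    case True
    define z where "z = xs ! 0"
    have z: "z \<in> X"
      using xsX(1)[OF n] by (simp add: z_def)
    have z': "xs ! k = z" if "k < ?n" for k
      using True that by (simp add: z_def)
    have "open (\<Inter>k\<in>{..<?n}. Us ! k)"
      using Us by (intro open_INT) auto
    moreover have "z \<in> (\<Inter>k\<in>{..<?n}. Us ! k)"
      using Us z' by force
    ultimately have "infinite {g. T g z \<in> (\<Inter>k\<in>{..<?n}. Us ! k)}"
      by (rule infinite_return_times[OF inf X z])
    moreover have "indep_set X T (map (\<lambda>U. U \<inter> X) Us) {g. T g z \<in> (\<Inter>k\<in>{..<?n}. Us ! k)}"
      unfolding indep_set_def
    proof (intro allI impI; elim conjE)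
      fix I and \<sigma> :: "'g \<Rightarrow> nat"
      assume I: "I \<subseteq> {g. T g z \<in> (\<Inter>k\<in>{..<?n}. Us ! k)}" and \<sigma>: "\<sigma> ` I \<subseteq> {..<length (map (\<lambda>U. U \<inter> X) Us)}"
      have "T g z \<in> map (\<lambda>U. U \<inter> X) Us ! \<sigma> g" if g: "g \<in> I" for g
      proof -
        have s: "\<sigma> g < length Us"
          using \<sigma> g by auto
        then have "T g z \<in> Us ! \<sigma> g"
          using I g len by auto
        then show ?thesis
          using s tds_mem[OF X(1) z] by simp
      qed
      then have "z \<in> (\<Inter>g\<in>I. {x \<in> X. T g x \<in> map (\<lambda>U. U \<inter> X) Us ! \<sigma> g})"
        using z by blast
      then show "(\<Inter>g\<in>I. {x \<in> X. T g x \<in> map (\<lambda>U. U \<inter> X) Us ! \<sigma> g}) \<noteq> {}"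
        by blast
    qed
    ultimately show ?thesis
      by blast
  next
    case False
    then obtain i0 where i0: "i0 < ?n" "xs ! i0 \<noteq> xs ! 0"
      by blast
    define D where "D = dist (xs ! i0) (xs ! 0)"
    have D: "D > 0"
      using i0(2) by (simp add: D_def)
    \<comment> \<open>The radius \<open>D / 2\<close> makes the neighbourhoods of
      \<open>xs ! i0\<close> and \<open>xs ! 0\<close> disjoint. Taking them from the base
      \<open>B\<close> makes \<open>A\<close> one of the countably many sets that \<open>y\<close>
      avoids if they are null.\<close>
    have "\<exists>k. xs ! i \<in> B k \<and> B k \<subseteq> Us ! i \<inter> ball (xs ! i) (D / 2)" if i: "i < ?n" for i
      using Us i D by (intro B(2)[OF xsX(1)[OF i]]) auto
    then have "\<forall>i. \<exists>k. i < ?n \<longrightarrow> xs ! i \<in> B k \<and> B k \<subseteq> Us ! i \<inter> ball (xs ! i) (D / 2)"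
      by blast
    from choice[OF this] obtain w where
      w: "\<And>i. i < ?n \<Longrightarrow> xs ! i \<in> B (w i) \<and> B (w i) \<subseteq> Us ! i \<inter> ball (xs ! i) (D / 2)"
      by blast
    define U where "U i = B (w i)" for i
    have U: "open (U i)" for i
      by (simp add: U_def B(1))
    have w': "xs ! i \<in> U i" "U i \<subseteq> Us ! i" "U i \<subseteq> ball (xs ! i) (D / 2)" if "i < ?n" for i
      using w[OF that] by (auto simp: U_def)
    define A where "A = Y \<inter> (\<Inter>k\<in>w ` {..<?n}. closure (p ` (B k \<inter> X)))"
    have A_eq: "A = Y \<inter> (\<Inter>i\<in>{..<?n}. closure (p ` (U i \<inter> X)))"
      by (simp add: A_def U_def)
    have "y \<in> closure (p ` (U i \<inter> X))" if "i < ?n" for i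
    proof -
      have "p (xs ! i) \<in> p ` (U i \<inter> X)"
        using w'(1)[OF that] xsX(1)[OF that] by blast
      then show ?thesis
        unfolding xsX(2)[OF that] by (rule subsetD[OF closure_subset])
    qed
    then have "y \<in> A"
      using y(1) by (auto simp: A_eq)
    then have "measure \<nu> A \<noteq> 0"
      using y(2)[of "w ` {..<?n}"] by (auto simp: A_def)
    then have Apos: "measure \<nu> A > 0"
      by (simp add: less_le)
    have Acl: "closed A"
      unfolding A_eq using compact_imp_closed[OF tds_compact[OF Yc]] by (intro closed_Int closed_INT) auto
    have disj: "U i0 \<inter> U 0 = {}"
    proof (rule ccontr)
      assume "\<not> ?thesis"
      then obtain z where "z \<in> U i0" "z \<in> U 0"
        by blast
      then have "dist (xs ! i0) z < D / 2" "dist (xs ! 0) z < D / 2"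
        using w'(3)[OF i0(1)] w'(3)[OF n] by auto
      then show False
        using dist_triangle2[of "xs ! i0" "xs ! 0" z] by (simp add: D_def)
    qed
    have "\<exists>J. infinite J \<and> (\<forall>I \<sigma>. finite I \<and> I \<subseteq> J \<and> (\<forall>g\<in>I. \<sigma> g < ?n) \<longrightarrow>
        (\<exists>x\<in>X. \<forall>g\<in>I. T g x \<in> U (\<sigma> g)))"
    proof (rule infinite_independence[OF X max \<nu> bumps U i0(1) n disj Acl _ Apos])
      show "A \<subseteq> closure (p ` (U j \<inter> X))" if "j < ?n" for j
        using that by (auto simp: A_eq)
      show "A \<subseteq> Y"
        by (auto simp: A_eq)
    qed
    then obtain J where J: "infinite J" "\<forall>I \<sigma>. finite I \<and> I \<subseteq> J \<and> (\<forall>g\<in>I. \<sigma> g < ?n) \<longrightarrow>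
        (\<exists>x\<in>X. \<forall>g\<in>I. T g x \<in> U (\<sigma> g))"
      by (elim exE conjE) (rule that)
    have "indep_set X T (map (\<lambda>U. U \<inter> X) Us) J"
      unfolding indep_set_def
    proof (intro allI impI; elim conjE)
      fix I and \<sigma> :: "'g \<Rightarrow> nat"
      assume I: "finite I" "I \<subseteq> J" and \<sigma>: "\<sigma> ` I \<subseteq> {..<length (map (\<lambda>U. U \<inter> X) Us)}"
      have s: "\<sigma> g < ?n" if "g \<in> I" for g
        using \<sigma> that len by auto
      obtain x where x: "x \<in> X" "\<And>g. g \<in> I \<Longrightarrow> T g x \<in> U (\<sigma> g)"
        using J(2)[rule_format, of I \<sigma>] I s by blast
      have "T g x \<in> map (\<lambda>U. U \<inter> X) Us ! \<sigma> g" if g: "g \<in> I" for g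
        using x(2)[OF g] w'(2)[OF s[OF g]] s[OF g] len tds_mem[OF X(1) x(1)] by auto
      then have "x \<in> (\<Inter>g\<in>I. {x \<in> X. T g x \<in> map (\<lambda>U. U \<inter> X) Us ! \<sigma> g})"
        using x(1) by blast
      then show "(\<Inter>g\<in>I. {x \<in> X. T g x \<in> map (\<lambda>U. U \<inter> X) Us ! \<sigma> g}) \<noteq> {}"
        by blast
    qed
    then show ?thesis
      using J(1) by blast
  qed
qed

theorem theorem1p3:
  fixes X :: "'a::metric_space set" and T :: "'g::{group_add,countable} \<Rightarrow> 'a \<Rightarrow> 'a"
    and Y :: "'b::metric_space set" and S :: "'g \<Rightarrow> 'b \<Rightarrow> 'b" and p :: "'a \<Rightarrow> 'b"
    and \<nu> :: "'b measure"
  assumes "infinite (UNIV :: 'g set)"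
    and "tds X T" and "minimal_sys X T"
    and "max_eq_factor X T Y S p"
    and "inv_measure Y S \<nu>"
    and "incontractible X T \<or> (local_Bronstein X T \<and> (\<exists>\<mu>. inv_measure X T \<mu>))"
  shows "\<exists>Z. gdelta_in (top_of_set Y) Z \<and> Y \<subseteq> closure Z \<and> Z \<in> sets \<nu> \<and> measure \<nu> Z = 1
           \<and> (\<forall>y\<in>Z. IT_set X T {x\<in>X. p x = y})"
proof -
  have bumps: "bump_supply X T N" for N
    using assms(6) bump_supply_incontractible[OF assms(2,3)] bump_supply_inv_measure[OF assms(2,3)] by blast
  have fm: "factor_map X T Y S p"
    using assms(4) by (simp add: max_eq_factor_def)
  have Y: "tds Y S" "minimal_sys Y S"
    using fm factor_map_minimal[OF fm assms(3)] by (auto simp: factor_map_def)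
  have clY: "closed Y"
    using Y(1) compact_imp_closed tds_compact by blast
  interpret prob_space \<nu>
    using assms(5) by (simp add: inv_measure_def)
  have sp: "space \<nu> = Y" and se: "sets \<nu> = sets (restrict_space borel Y)"
    using assms(5) by (auto simp: inv_measure_def)
  have "X \<noteq> {}"
    using assms(3) by (simp add: minimal_sys_def)
  then obtain B :: "nat \<Rightarrow> 'a set" where B: "\<And>k. open (B k)"
    "\<And>x V. x \<in> X \<Longrightarrow> open V \<Longrightarrow> x \<in> V \<Longrightarrow> \<exists>k. x \<in> B k \<and> B k \<subseteq> V"
    using compact_countable_base[OF tds_compact[OF assms(2)]] by metis
  define A where "A F = Y \<inter> (\<Inter>k\<in>F. closure (p ` (B k \<inter> X)))" for F :: "nat set"
  \<comment> \<open>A tuple involves only finitely many neighbourhoods, so finite index sets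
    suffice, and there are countably many of these.\<close>
  define \<F> where "\<F> = {F. finite F \<and> measure \<nu> (A F) = 0}"
  have cnt: "countable \<F>"
    by (rule countable_subset[OF _ countable_Collect_finite]) (auto simp: \<F>_def)
  have clA: "closed (A F)" for F
    unfolding A_def using clY by (intro closed_Int closed_INT) auto
  have AY: "A F \<subseteq> Y" for F
    by (auto simp: A_def)
  have As: "A F \<in> sets \<nu>" for F
  proof -
    have "A F \<in> sets borel"
      using clA by auto
    then show ?thesis
      using AY[of F] by (auto simp: se sets_restrict_space)
  qed
  have "A F \<in> null_sets \<nu>" if "F \<in> \<F>" for F
    using that As[of F] by (intro null_setsI) (auto simp: \<F>_def emeasure_eq_measure)
  then have null: "(\<Union>F\<in>\<F>. A F) \<in> null_sets \<nu>"
    using cnt by (intro null_sets_UN')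
  define Z where "Z = Y - (\<Union>F\<in>\<F>. A F)"
  \<comment> \<open>Inserting \<open>Y\<close> keeps the family nonempty, so that its intersection
    is \<open>Z\<close> even if \<open>\<F>\<close> is empty.\<close>
  have "gdelta_in (top_of_set Y) (\<Inter>(insert Y ((\<lambda>F. Y - A F) ` \<F>)))"
  proof (rule gdelta_in_Inter)
    show "countable (insert Y ((\<lambda>F. Y - A F) ` \<F>))"
      using cnt by simp
    fix C assume "C \<in> insert Y ((\<lambda>F. Y - A F) ` \<F>)"
    moreover have "openin (top_of_set Y) (Y - A F)" for F
    proof -
      have "openin (top_of_set Y) (Y \<inter> - A F)"
        using clA by (intro openin_open_Int) auto
      then show ?thesis
        by (simp add: Diff_eq)
    qed
    ultimately have "openin (top_of_set Y) C"
      by auto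
    then show "gdelta_in (top_of_set Y) C"
      by (rule open_imp_gdelta_in)
  qed simp
  moreover have "\<Inter>(insert Y ((\<lambda>F. Y - A F) ` \<F>)) = Z"
    by (auto simp: Z_def)
  ultimately have "gdelta_in (top_of_set Y) Z"
    by simp
  moreover have "Y \<subseteq> closure Z"
  proof
    fix y assume y: "y \<in> Y"
    show "y \<in> closure Z"
    proof (rule ccontr)
      assume "y \<notin> closure Z"
      define V where "V = - closure Z"
      have "V \<inter> Y \<subseteq> (\<Union>F\<in>\<F>. A F)"
        using closure_subset[of Z] by (auto simp: V_def Z_def)
      moreover have "open V"
        unfolding V_def by (intro open_Compl closed_closure)
      then have "V \<inter> Y \<in> sets \<nu>"
        by (auto simp: se sets_restrict_space)
      ultimately have "V \<inter> Y \<in> null_sets \<nu>"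
        using null null_sets_subset by blast
      moreover have "V \<inter> Y \<noteq> {}"
        using y \<open>y \<notin> closure Z\<close> by (auto simp: V_def)
      ultimately show False
        using inv_measure_open_pos[OF Y assms(5) \<open>open V\<close>] by blast
    qed
  qed
  moreover have "Z \<in> sets \<nu>" "measure \<nu> Z = 1"
  proof -
    have N: "(\<Union>F\<in>\<F>. A F) \<in> sets \<nu>" "measure \<nu> (\<Union>F\<in>\<F>. A F) = 0"
      using null by (auto simp: null_sets_def measure_def)
    have "Z = space \<nu> - (\<Union>F\<in>\<F>. A F)"
      by (simp add: Z_def sp)
    then show "Z \<in> sets \<nu>" "measure \<nu> Z = 1"
      using N prob_compl[OF N(1)] by auto
  qed
  moreover have "IT_set X T {x \<in> X. p x = y}" if y: "y \<in> Z" for y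
  proof (rule IT_set_fibre[where B = B, OF assms(1-5) bumps B])
    show "y \<in> Y"
      using y by (simp add: Z_def)
    show "y \<notin> Y \<inter> (\<Inter>k\<in>F. closure (p ` (B k \<inter> X)))"
      if "finite F" "measure \<nu> (Y \<inter> (\<Inter>k\<in>F. closure (p ` (B k \<inter> X)))) = 0" for F
    proof -
      have "F \<in> \<F>"
        using that by (simp add: \<F>_def A_def)
      then have "y \<notin> A F"
        using y by (auto simp: Z_def)
      then show ?thesis
        by (simp only: A_def not_False_eq_True)
    qed
  qed
  ultimately show ?thesis
    by blast
qed

end
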